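(* Assume that all nontrivial zeros of the Riemann zeta function $\zeta(s)$ lie on the line $\Re(s) = 1/2$. Then there exists $X_0 \geq 2$ such that for all real numbers $x \geq X_0$ and all real numbers $y$ with $x^{1/2} (\log x)^3 \leq y \leq x$, one has $$\pi(x+y) < \pi(x) + \pi(y).$$
   Context: For a real number $t \geq 1$, $\pi(t) = \#\{p \leq t : p \text{ is prime}\}$ denotes the prime counting function, and $\log$ is the natural logarithm. The nontrivial zeros of $\zeta(s)$ are those in the strip $0 < \Re(s) < 1$. *)

theory Defs
  imports "HOL-Complex_Analysis.Complex_Analysis" "HOL-Computational_Algebra.Primes"
begin

definition prime_pi :: "real \<Rightarrow> nat" where
  "prime_pi t = card {p::nat. prime p \<and> real p \<le> t}"

definition zeta_series :: "complex \<Rightarrow> complex" where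
  "zeta_series s = (\<Sum>n. 1 / of_nat (Suc n) powr s)"

text \<open>
  The analytic continuation of the Dirichlet series to the plane punctured at 1. It exists and is
  unique (\<open>riemann_zeta_exists\<close> and \<open>riemann_zeta_unique\<close> below); the value at the pole 1 is
  unspecified.
\<close>

definition riemann_zeta :: "complex \<Rightarrow> complex" where
  "riemann_zeta = (SOME f. f holomorphic_on (- {1}) \<and> (\<forall>s. 1 < Re s \<longrightarrow> f s = zeta_series s))"

lemma half_plane_series:
  fixes f :: "nat \<Rightarrow> complex \<Rightarrow> complex"
  assumes hol: "\<And>n. f n holomorphic_on {s. c < Re s}"
    and bound: "\<And>x d. 0 < d \<Longrightarrow> Re x = c + 2 * d \<Longrightarrow>
      \<exists>C\<ge>0. \<forall>n. \<forall>y\<in>ball x d. norm (f n y) \<le> C * real (Suc n) powr (-1-d)"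
  shows "\<exists>g. g holomorphic_on {s. c < Re s} \<and> (\<forall>s. c < Re s \<longrightarrow> (\<lambda>n. f n s) sums g s)"
proof -
  let ?S = "{s. c < Re s}"
  have op: "open ?S" by (rule open_halfspace_Re_gt)
  have 1: "f n field_differentiable (at x)" if "x \<in> ?S" for n x
    using holomorphic_on_imp_differentiable_at[OF hol op that] .
  have 2: "\<exists>d h. 0 < d \<and> summable h \<and> range h \<subseteq> \<real>\<^sub>\<ge>\<^sub>0 \<and>
        (\<forall>\<^sub>F n in sequentially. \<forall>y\<in>ball x d \<inter> ?S. cmod (f n y) \<le> cmod (h n))"
    if x: "x \<in> ?S" for x
  proof -
    define d where "d = (Re x - c) / 2"
    have d: "d > 0" using x by (simp add: d_def)
    obtain C where C: "0 \<le> C" "\<And>n y. y \<in> ball x d \<Longrightarrow> norm (f n y) \<le> C * real (Suc n) powr (-1-d)"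
      using bound[OF d, of x] by (auto simp: d_def field_simps)
    define h where "h = (\<lambda>n. complex_of_real (C * real (Suc n) powr (-1-d)))"
    have "summable (\<lambda>n. real n powr (-1-d))"
      using d by (simp add: summable_real_powr_iff)
    hence "summable (\<lambda>n. real (Suc n) powr (-1-d))"
      by (rule summable_Suc_iff[THEN iffD2])
    hence "summable h" unfolding h_def by (intro summable_of_real summable_mult)
    moreover have "h n \<in> \<real>\<^sub>\<ge>\<^sub>0" for n
      unfolding h_def using C(1) by (subst nonneg_Reals_of_real_iff) simp
    moreover have "cmod (f n y) \<le> cmod (h n)" if "y \<in> ball x d" for n y
    proof -
      have "cmod (h n) = C * real (Suc n) powr (-1-d)"
        unfolding h_def norm_of_real using C(1) by simp
      thus ?thesis using C(2)[OF that, of n] by simp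
    qed
    ultimately show ?thesis
      using d by (intro exI[of _ d] exI[of _ h]) auto
  qed
  obtain g where g: "\<forall>x \<in> ?S. ((\<lambda>n. f n x) sums g x) \<and> g field_differentiable (at x)"
    using series_differentiable_comparison_complex[OF op 1 2] by blast
  hence "g holomorphic_on ?S"
    by (auto simp: holomorphic_on_def intro: field_differentiable_at_within)
  thus ?thesis using g by blast
qed

lemma zeta_series_aux:
  "\<exists>g. g holomorphic_on {s. 1 < Re s} \<and>
       (\<forall>s. 1 < Re s \<longrightarrow> (\<lambda>n. 1 / of_nat (Suc n) powr s) sums g s)"
proof (rule half_plane_series)
  show "(\<lambda>s. 1 / of_nat (Suc n) powr s) holomorphic_on {s. 1 < Re s}" for n
    by (intro holomorphic_intros) (simp del: of_nat_Suc)
next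
  fix x :: complex and d :: real assume d: "0 < d" "Re x = 1 + 2 * d"
  have "cmod (1 / of_nat (Suc n) powr y) \<le> 1 * real (Suc n) powr (-1-d)" if "y \<in> ball x d" for n y
  proof -
    have "\<bar>Re x - Re y\<bar> < d"
      using that abs_Re_le_cmod[of "x - y"] by (auto simp: dist_norm)
    hence "Re y \<ge> 1 + d" using d by linarith
    hence "real (Suc n) powr - Re y \<le> real (Suc n) powr (-1-d)"
      by (intro powr_mono) auto
    moreover have "cmod (1 / of_nat (Suc n) powr y) = real (Suc n) powr - Re y"
      by (simp add: norm_divide norm_powr_real_powr powr_minus divide_inverse norm_inverse del: of_nat_Suc)
    ultimately show ?thesis by linarith
  qed
  thus "\<exists>C\<ge>0. \<forall>n. \<forall>y\<in>ball x d. cmod (1 / of_nat (Suc n) powr y) \<le> C * real (Suc n) powr (-1-d)"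
    by (intro exI[of _ 1]) auto
qed

lemma zeta_series_sums:
  "1 < Re s \<Longrightarrow> (\<lambda>n. 1 / of_nat (Suc n) powr s) sums zeta_series s"
  using zeta_series_aux unfolding zeta_series_def by (metis sums_unique)

lemma zeta_series_holomorphic: "zeta_series holomorphic_on {s. 1 < Re s}"
proof -
  obtain g where g: "g holomorphic_on {s. 1 < Re s}"
    "\<And>s. 1 < Re s \<Longrightarrow> (\<lambda>n. 1 / of_nat (Suc n) powr s) sums g s"
    using zeta_series_aux by blast
  have "zeta_series s = g s" if "s \<in> {s. 1 < Re s}" for s
    using that sums_unique2[OF zeta_series_sums g(2)] by simp
  thus ?thesis using g(1) holomorphic_cong[of _ _ zeta_series g] by blast
qed

lemma holomorphic_gbinomial: "(\<lambda>s::complex. (1 - s) gchoose j) holomorphic_on A"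
  unfolding gbinomial_prod_rev by (intro holomorphic_intros) auto

definition zeta_rem :: "nat \<Rightarrow> nat \<Rightarrow> complex \<Rightarrow> complex" where
  "zeta_rem K m s = of_nat (m + 2) powr (1 - s)
     - (\<Sum>j\<le>K. ((1 - s) gchoose j) * of_nat (m + 1) powr (1 - s - of_nat j))"

lemma gbinomial_Suc_mult:
  "of_nat (Suc i) * (a gchoose Suc i) = (a - of_nat i) * (a gchoose i :: complex)"
  by (simp only: gbinomial_absorption gbinomial_absorb_comp)

lemma norm_zeta_rem_le:
  assumes "0 \<le> Re s + real K"
  shows "norm (zeta_rem K m s) \<le>
    norm ((1 - s) gchoose Suc K) * real (Suc K) * real (m + 1) powr (- Re s - real K)"
proof -
  let ?S = "closed_segment (of_nat (m + 1)) (of_nat (m + 2)) :: complex set"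
  let ?f = "\<lambda>i x. fact i * ((1 - s) gchoose i) * x powr (1 - s - of_nat i)"
  let ?B = "fact (Suc K) * norm ((1 - s) gchoose Suc K) * real (m + 1) powr (- Re s - real K)"
  have S: "\<exists>t. x = complex_of_real t \<and> real (m + 1) \<le> t" if "x \<in> ?S" for x
  proof -
    from that obtain u where u: "0 \<le> u" "x = (1 - u) *\<^sub>R of_nat (m + 1) + u *\<^sub>R of_nat (m + 2)"
      by (auto simp: closed_segment_def)
    hence "x = complex_of_real (real (m + 1) + u)"
      by (simp add: algebra_simps scaleR_conv_of_real)
    thus ?thesis using u(1) by (intro exI[of _ "real (m+1) + u"]) auto
  qed
  have *: "norm (?f 0 (of_nat (m + 2)) - (\<Sum>i\<le>K. ?f i (of_nat (m + 1)) * (of_nat (m + 2) - of_nat (m + 1)) ^ i / fact i))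
     \<le> ?B * norm (of_nat (m + 2) - of_nat (m + 1) :: complex) ^ Suc K / fact K"
  proof (rule field_Taylor)
    fix i x assume "x \<in> ?S" "i \<le> K"
    then obtain t where t: "x = complex_of_real t" "real (m + 1) \<le> t" using S by blast
    hence x: "x \<notin> \<real>\<^sub>\<le>\<^sub>0" by simp
    have e: "fact (Suc i) * ((1 - s) gchoose Suc i) = fact i * ((1 - s) gchoose i) * (1 - s - of_nat i)"
      using gbinomial_Suc_mult[of i "1 - s"] by (simp add: mult.assoc mult.left_commute del: of_nat_Suc)
    have "((\<lambda>x. x powr (1 - s - of_nat i)) has_field_derivative
        (1 - s - of_nat i) * x powr (1 - s - of_nat i - 1)) (at x within ?S)"
      using has_field_derivative_powr[OF x] has_field_derivative_at_within by blast
    from DERIV_cmult[OF this, of "fact i * ((1 - s) gchoose i)"]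
    show "(?f i has_field_derivative ?f (Suc i) x) (at x within ?S)"
      unfolding e by (simp add: algebra_simps)
  next
    fix x assume "x \<in> ?S"
    then obtain t where t: "x = complex_of_real t" "real (m + 1) \<le> t" using S by blast
    have "norm (x powr (1 - s - of_nat (Suc K))) = t powr (- Re s - real K)"
      using t by (simp add: norm_powr_real_powr)
    also have "\<dots> \<le> real (m + 1) powr (- Re s - real K)"
      using t assms by (intro powr_mono2') auto
    finally show "norm (?f (Suc K) x) \<le> ?B"
      by (simp add: norm_mult mult_left_mono del: fact_Suc of_nat_Suc of_nat_add)
  qed auto
  have "?f 0 (of_nat (m + 2)) - (\<Sum>i\<le>K. ?f i (of_nat (m + 1)) * (of_nat (m + 2) - of_nat (m + 1)) ^ i / fact i)
      = zeta_rem K m s"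
    by (simp add: zeta_rem_def)
  moreover have "?B * norm (of_nat (m + 2) - of_nat (m + 1) :: complex) ^ Suc K / fact K =
      norm ((1 - s) gchoose Suc K) * real (Suc K) * real (m + 1) powr (- Re s - real K)"
    by (simp add: fact_Suc del: of_nat_Suc of_nat_add) simp
  ultimately show ?thesis using * by (simp only:)
qed

lemma zeta_rem_sums:
  "\<exists>r. r holomorphic_on {s. 1 - real K < Re s} \<and>
       (\<forall>s. 1 - real K < Re s \<longrightarrow> (\<lambda>m. zeta_rem K m s) sums r s)"
proof (rule half_plane_series)
  show "zeta_rem K n holomorphic_on {s. 1 - real K < Re s}" for n
    unfolding zeta_rem_def by (intro holomorphic_intros holomorphic_gbinomial)
next
  fix x :: complex and d :: real assume d: "0 < d" "Re x = 1 - real K + 2 * d"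
  have "compact ((\<lambda>s. (1 - s) gchoose Suc K) ` cball x d)"
    by (rule compact_continuous_image[OF holomorphic_on_imp_continuous_on[OF holomorphic_gbinomial] compact_cball])
  then obtain C where C: "\<And>s. s \<in> cball x d \<Longrightarrow> norm ((1 - s) gchoose Suc K) \<le> C"
    using compact_imp_bounded bounded_iff[THEN iffD1] image_eqI by metis
  have "x \<in> cball x d" using d(1) by simp
  hence C0: "0 \<le> C" by (rule order_trans[OF norm_ge_zero C])
  have "cmod (zeta_rem K n y) \<le> (C * real (Suc K)) * real (Suc n) powr (-1-d)" if "y \<in> ball x d" for n y
  proof -
    have "\<bar>Re x - Re y\<bar> < d"
      using that abs_Re_le_cmod[of "x - y"] by (auto simp: dist_norm)
    hence y: "Re y + real K \<ge> 1 + d" using d by linarith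
    have "cmod (zeta_rem K n y) \<le>
        norm ((1 - y) gchoose Suc K) * real (Suc K) * real (n + 1) powr (- Re y - real K)"
      using y d by (intro norm_zeta_rem_le) auto
    also have "\<dots> \<le> (C * real (Suc K)) * real (Suc n) powr (-1-d)"
    proof (intro mult_mono)
      show "norm ((1 - y) gchoose Suc K) \<le> C" using that by (intro C) auto
      show "real (n + 1) powr (- Re y - real K) \<le> real (Suc n) powr (-1-d)"
        unfolding Suc_eq_plus1 using y by (intro powr_mono) auto
    qed (use C0 in auto)
    finally show ?thesis .
  qed
  thus "\<exists>C\<ge>0. \<forall>n. \<forall>y\<in>ball x d. cmod (zeta_rem K n y) \<le> C * real (Suc n) powr (-1-d)"
    using C0 by (intro exI[of _ "C * real (Suc K)"]) auto
qed

text \<open>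
  Summing the Taylor expansion of (n+1)^(1-s) around n over all n expresses (s-1) zeta(s) through
  its values at s+1, s+2, ..., up to a remainder holomorphic in a larger half-plane.
\<close>

lemma zeta_series_shift:
  assumes s: "1 < Re s" and r: "(\<lambda>m. zeta_rem K m s) sums r" and K: "1 \<le> K"
  shows "(s - 1) * zeta_series s = 1 + r - (\<Sum>j=2..K. ((1 - s) gchoose (j - 1)) / of_nat j *
           ((s + of_nat (j - 1) - 1) * zeta_series (s + of_nat (j - 1))))"
proof -
  let ?c = "\<lambda>j. (1 - s) gchoose j"
  have tele: "(\<lambda>m. of_nat (m + 2) powr (1 - s) - of_nat (m + 1) powr (1 - s)) sums (0 - 1)"
  proof -
    have "(\<lambda>m. norm (of_nat (m + 1) powr (1 - s))) = (\<lambda>m. real (m + 1) powr (1 - Re s))"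
      by (auto simp: norm_powr_real_powr simp del: of_nat_add)
    moreover have "(\<lambda>m. real (m + 1) powr (1 - Re s)) \<longlonglongrightarrow> 0"
      using LIMSEQ_Suc[OF tendsto_neg_powr[OF _ filterlim_real_sequentially, of "1 - Re s"]] s by simp
    ultimately have "(\<lambda>m. norm (of_nat (m + 1) powr (1 - s))) \<longlonglongrightarrow> 0"
      by (simp only:)
    hence "(\<lambda>m. of_nat (m + 1) powr (1 - s)) \<longlonglongrightarrow> 0"
      by (rule tendsto_norm_zero_cancel)
    from telescope_sums[OF this] show ?thesis by simp
  qed
  have A: "(\<lambda>m. \<Sum>j=1..K. ?c j * (1 / of_nat (Suc m) powr (s + of_nat (j - 1)))) sums
        (\<Sum>j=1..K. ?c j * zeta_series (s + of_nat (j - 1)))"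
    using s by (intro sums_sum sums_mult zeta_series_sums) simp
  have B: "(\<Sum>j=1..K. ?c j * (1 / of_nat (Suc m) powr (s + of_nat (j - 1)))) =
     (of_nat (m + 2) powr (1 - s) - of_nat (m + 1) powr (1 - s)) - zeta_rem K m s" for m
  proof -
    have "{..K} = insert 0 {1..K}" by auto
    hence "(\<Sum>j\<le>K. ?c j * of_nat (m + 1) powr (1 - s - of_nat j)) =
        of_nat (m + 1) powr (1 - s) + (\<Sum>j=1..K. ?c j * of_nat (m + 1) powr (1 - s - of_nat j))"
      by simp
    moreover have "(\<Sum>j=1..K. ?c j * (1 / of_nat (Suc m) powr (s + of_nat (j - 1)))) =
        (\<Sum>j=1..K. ?c j * of_nat (m + 1) powr (1 - s - of_nat j))"
    proof (intro sum.cong refl)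
      fix j assume "j \<in> {1..K}"
      hence *: "1 - s - of_nat j = - (s + of_nat (j - 1))"
        by (simp add: of_nat_diff)
      show "?c j * (1 / of_nat (Suc m) powr (s + of_nat (j - 1))) = ?c j * of_nat (m + 1) powr (1 - s - of_nat j)"
        unfolding * by (simp only: powr_minus Suc_eq_plus1 inverse_eq_divide)
    qed
    ultimately show ?thesis
      unfolding zeta_rem_def by (simp only: diff_diff_eq diff_diff_eq2) simp
  qed
  have C: "(\<Sum>j=1..K. ?c j * zeta_series (s + of_nat (j - 1))) = 0 - 1 - r"
    by (rule sums_unique2[OF A]) (unfold B, rule sums_diff[OF tele r])
  have D: "?c j * zeta_series (s + of_nat (j - 1)) =
      - (?c (j - 1) / of_nat j * ((s + of_nat (j - 1) - 1) * zeta_series (s + of_nat (j - 1))))"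
    if j: "j \<in> {1..K}" for j
  proof -
    obtain i where i: "j = Suc i" using j by (cases j) auto
    have "of_nat (Suc i) * ?c (Suc i) = (1 - s - of_nat i) * ?c i"
      by (rule gbinomial_Suc_mult)
    hence "?c (Suc i) = (1 - s - of_nat i) * ?c i / of_nat (Suc i)"
      by (simp add: eq_divide_eq mult.commute del: of_nat_Suc)
    hence "?c j = - (?c (j - 1) / of_nat j * (s + of_nat (j - 1) - 1))"
      unfolding i by (simp add: algebra_simps minus_divide_left diff_divide_distrib add_divide_distrib del: of_nat_Suc)
    thus ?thesis by (simp only: mult_minus_left mult.assoc)
  qed
  let ?g = "\<lambda>j. ?c (j - 1) / of_nat j * ((s + of_nat (j - 1) - 1) * zeta_series (s + of_nat (j - 1)))"
  have "(\<Sum>j=1..K. ?c j * zeta_series (s + of_nat (j - 1))) = - (\<Sum>j=1..K. ?g j)"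
    unfolding sum_negf[symmetric] by (rule sum.cong[OF refl D])
  moreover have "{1..K} = insert 1 {2..K}" using K by auto
  hence "(\<Sum>j=1..K. ?g j) = (s - 1) * zeta_series s + (\<Sum>j=2..K. ?g j)" by simp
  moreover have "(a::complex) = 1 + r - c" if "t = 0 - 1 - r" "t = - b" "b = a + c" for a b c t
    using that by (metis add_diff_cancel_right' diff_0 diff_minus_eq_add minus_diff_commute minus_equation_iff add.commute)
  ultimately show ?thesis using C by blast
qed

lemma zeta_half_plane:
  "\<exists>G. G holomorphic_on {s. 1 - real k < Re s} \<and>
       (\<forall>s. 1 < Re s \<longrightarrow> G s = (s - 1) * zeta_series s)"
proof (induction k)
  case 0
  show ?case
    by (intro exI[of _ "\<lambda>s. (s - 1) * zeta_series s"])
       (auto intro!: holomorphic_intros zeta_series_holomorphic)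
next
  case (Suc k)
  then obtain G where G: "G holomorphic_on {s. 1 - real k < Re s}"
    "\<And>s. 1 < Re s \<Longrightarrow> G s = (s - 1) * zeta_series s" by blast
  obtain r where r: "r holomorphic_on {s. 1 - real (Suc k) < Re s}"
    "\<And>s. 1 - real (Suc k) < Re s \<Longrightarrow> (\<lambda>m. zeta_rem (Suc k) m s) sums r s"
    using zeta_rem_sums[of "Suc k"] by blast
  let ?H = "\<lambda>s. 1 + r s - (\<Sum>j=2..Suc k. ((1 - s) gchoose (j - 1)) / of_nat j * G (s + of_nat (j - 1)))"
  have "(\<lambda>s. G (s + of_nat (j - 1))) holomorphic_on {s. 1 - real (Suc k) < Re s}" if "2 \<le> j" for j
  proof -
    have "(G \<circ> (\<lambda>s. s + of_nat (j - 1))) holomorphic_on {s. 1 - real (Suc k) < Re s}"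
      using that by (intro holomorphic_on_compose_gen[OF _ G(1)] holomorphic_intros) (auto simp: of_nat_diff)
    thus ?thesis by (simp add: o_def)
  qed
  hence "?H holomorphic_on {s. 1 - real (Suc k) < Re s}"
    by (intro holomorphic_intros r holomorphic_gbinomial) auto
  moreover have "?H s = (s - 1) * zeta_series s" if s: "1 < Re s" for s
  proof -
    have "(\<Sum>j=2..Suc k. ((1 - s) gchoose (j - 1)) / of_nat j * G (s + of_nat (j - 1))) =
      (\<Sum>j=2..Suc k. ((1 - s) gchoose (j - 1)) / of_nat j *
           ((s + of_nat (j - 1) - 1) * zeta_series (s + of_nat (j - 1))))"
      using s by (intro sum.cong refl) (subst G(2), auto)
    thus ?thesis using zeta_series_shift[OF s r(2)] s by simp
  qed
  ultimately show ?case by blast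
qed

lemma riemann_zeta_exists:
  "\<exists>f. f holomorphic_on (- {1}) \<and> (\<forall>s. 1 < Re s \<longrightarrow> f s = zeta_series s)"
proof -
  obtain G where G: "\<And>k. G k holomorphic_on {s. 1 - real k < Re s}"
    "\<And>k s. 1 < Re s \<Longrightarrow> G k s = (s - 1) * zeta_series s"
    using zeta_half_plane by metis
  have eq: "G k s = G l s" if kl: "k \<le> l" and s: "1 - real k < Re s" for k l s
  proof (rule analytic_continuation_open[where f = "G k" and g = "G l"])
    show "open {s. 1 < Re s}" "open {s. 1 - real k < Re s}"
      by (rule open_halfspace_Re_gt)+
    show "connected {s. 1 - real k < Re s}"
      by (intro convex_connected convex_halfspace_Re_gt)
    show "{s. 1 < Re s} \<noteq> {}" by (auto intro: exI[of _ 2])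
    show "G l holomorphic_on {s. 1 - real k < Re s}"
      using kl by (intro holomorphic_on_subset[OF G(1)]) auto
  qed (use G s in auto)
  define F where "F = (\<lambda>s. G (nat \<lceil>2 - Re s\<rceil>) s)"
  have F: "F s = G k s" if "1 - real k < Re s" for k s
  proof -
    have "1 - real (nat \<lceil>2 - Re s\<rceil>) < Re s" by linarith
    thus ?thesis unfolding F_def using that eq by (metis linear)
  qed
  have "F field_differentiable (at s)" for s
  proof -
    obtain k where k: "1 - real k < Re s" using reals_Archimedean2[of "1 - Re s"] by (auto simp: algebra_simps)
    have "F holomorphic_on {s. 1 - real k < Re s}"
      using G(1)[of k] by (rule holomorphic_transform) (simp add: F)
    thus ?thesis
      using k by (intro holomorphic_on_imp_differentiable_at[OF _ open_halfspace_Re_gt]) auto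
  qed
  hence "F holomorphic_on A" for A
    by (auto simp: holomorphic_on_def intro: field_differentiable_at_within)
  hence "(\<lambda>s. F s / (s - 1)) holomorphic_on - {1}"
    by (intro holomorphic_intros) auto
  moreover have "F s / (s - 1) = zeta_series s" if "1 < Re s" for s
    using that F[of 0 s] G(2)[of s 0] by auto
  ultimately show ?thesis by blast
qed

lemma riemann_zeta_unique:
  assumes "f holomorphic_on (- {1})" "\<And>s. 1 < Re s \<Longrightarrow> f s = zeta_series s"
    and "g holomorphic_on (- {1})" "\<And>s. 1 < Re s \<Longrightarrow> g s = zeta_series s"
    and "s \<noteq> 1"
  shows "f s = g s"
proof (rule analytic_continuation_open[where f = f and g = g])
  show "open {s. 1 < Re s}" by (rule open_halfspace_Re_gt)
  show "connected (- {1::complex})"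
    by (simp add: connected_punctured_universe)
  show "{s. 1 < Re s} \<noteq> {}" by (auto intro: exI[of _ 2])
qed (use assms in auto)

lemma riemann_zeta_holomorphic: "riemann_zeta holomorphic_on (- {1})"
  and riemann_zeta_eq_zeta_series: "1 < Re s \<Longrightarrow> riemann_zeta s = zeta_series s"
  using someI_ex[OF riemann_zeta_exists] by (auto simp: riemann_zeta_def)

end

theory Submission
  imports Defs "HOL-Number_Theory.Prime_Powers" "HOL-Real_Asymp.Real_Asymp"
begin

text \<open>
  Write \<open>H\<close> for the logarithmic derivative of \<open>(s - 1) \<zeta>(s)\<close>, so that the Dirichlet series of the von
  Mangoldt function is \<open>1 / (s - 1) - H(s)\<close>. Shifting the line of integration in Perron's formula for
  the Riesz mean \<open>\<Sum>\<^bsub>n \<le> x\<^esub> \<Lambda>(n) (x - n)\<close> from \<open>Re s = 2\<close> to \<open>Re s = 1/2 + 1/ln x\<close> crosses, under the Riemann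
  hypothesis, only the pole at 1. No zero is crossed, so no sum over zeros, functional equation or Hadamard product is needed;
  it suffices to bound \<open>H\<close> on the new line. In a disc around \<open>2 + it\<close>, dividing out the \<open>O(ln t)\<close> zeros with
  Blaschke factors shows that \<open>H(s)\<close> is \<open>\<Sum> 1 / (s - \<rho>)\<close> up to \<open>O(ln t)\<close>. On the line
  \<open>Re s = 1/2 + \<epsilon>\<close> each \<open>1 / |s - \<rho>|\<close> is, by the AM-GM inequality, at most
  \<open>\<epsilon>\<^sup>-\<^sup>1\<^sup>/\<^sup>2\<close> times the sum of a Cauchy density and a constant, so \<open>H\<close> has size
  \<open>\<epsilon>\<^sup>-\<^sup>1\<^sup>/\<^sup>2 ln t\<close> on average, whereas the pointwise bound is only \<open>\<epsilon>\<^sup>-\<^sup>1 ln t\<close>. This yields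
  \<open>\<psi>(x) = x + O(\<surd>x (ln x)\<^sup>5\<^sup>/\<^sup>2)\<close>, and the saving of half a logarithm over \<open>(ln x)\<^sup>3\<close> is exactly what is used.

  Then \<open>\<pi>(x + y) - \<pi>(x) \<le> (y + o(y)) / ln x\<close>. If \<open>y \<le> x\<^sup>9\<^sup>/\<^sup>1\<^sup>0\<close>, this is less than
  \<open>\<pi>(y) \<sim> y / ln y\<close>. For larger \<open>y\<close> the error is a power smaller than \<open>y\<close>, and the primes up to \<open>y/2\<close>, whose logarithms
  are smaller than \<open>ln y\<close> by \<open>ln 2\<close>, make \<open>\<pi>(y)\<close> exceed \<open>y / ln y\<close> by a constant times \<open>y / (ln y)\<^sup>2\<close>.
\<close>

section \<open>The zeta function right of the imaginary axis\<close>

text \<open>The Riesz mean stands in for \<psi> because its kernel \<open>1 / (s * (s + 1))\<close>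
  is absolutely integrable on vertical lines, so the integral and its shift converge without
  truncation. Returning to \<psi> by a difference of step 1 costs no further logarithm: up to
  constants the kernel difference is at most x^(1/2+\<epsilon>) / |s| times min(1, x/|s|), hence at
  most x^(1/2) |s|^(-1-\<epsilon>) for \<epsilon> = 1 / ln x, because x^\<epsilon> is then constant.
  Against the weight |t|^(-1-\<epsilon>) the factor ln t integrates to \<epsilon>^(-2); the mean
  size \<epsilon>^(-1/2) of H makes this \<epsilon>^(-5/2). The pointwise bound for H would give (ln
  x)^3 with an uncontrolled constant, just too much for the allowed range of y. Integrating 1/|s -
  \<rho>| exactly would even replace \<epsilon>^(-1/2) by ln(1/\<epsilon>), but the weaker power
  suffices. The hypothesis speaks only of zeros with 0 < Re s < 1. That there are none with Re s >=
  1 is proved by reading the order of a zero off the limit of e f'(z+e)/f(z+e) as e decreases to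
  0.\<close>

lemma norm_sums_le:
  fixes f :: "nat \<Rightarrow> 'a::banach"
  assumes "f sums a" "g sums b" "\<And>n. norm (f n) \<le> g n"
  shows "norm a \<le> b"
  using norm_suminf_le[of f g] assms by (simp add: sums_iff)

text \<open>
  \<open>(s - 1) \<zeta>(s)\<close> for \<open>Re s > 0\<close>; elsewhere the series may diverge and the value is meaningless.
\<close>

definition zf :: "complex \<Rightarrow> complex" where
  "zf s = 1 + (\<Sum>m. zeta_rem 1 m s)"

lemma zf_holomorphic: "zf holomorphic_on {s. 0 < Re s}"
  and zeta_rem_1_sums: "0 < Re s \<Longrightarrow> (\<lambda>m. zeta_rem 1 m s) sums (zf s - 1)"
proof -
  obtain r where r: "r holomorphic_on {s. 0 < Re s}"
    "\<And>s. 0 < Re s \<Longrightarrow> (\<lambda>m. zeta_rem 1 m s) sums r s"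
    using zeta_rem_sums[of 1] by auto
  have eq: "zf s = 1 + r s" if "0 < Re s" for s
    using r(2)[OF that] by (simp add: zf_def sums_iff)
  have "(\<lambda>s. 1 + r s) holomorphic_on {s. 0 < Re s}"
    by (intro holomorphic_intros r)
  thus "zf holomorphic_on {s. 0 < Re s}"
    by (rule holomorphic_transform) (simp add: eq)
  show "(\<lambda>m. zeta_rem 1 m s) sums (zf s - 1)" if "0 < Re s"
    using r(2)[OF that] eq[OF that] by simp
qed

text \<open>This value is the residue of zeta at its pole. It shows that 1 is not a zero of
  \<open>zf\<close>, so that \<open>zf_logderiv\<close> is regular there.\<close>

lemma zf_1 [simp]: "zf 1 = 1"
proof -
  have "of_nat (m + 1) \<noteq> (0::complex)" "of_nat (m + 2) \<noteq> (0::complex)" for m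
    by (simp_all only: of_nat_eq_0_iff)
  hence "zeta_rem 1 m 1 = 0" for m
    by (simp only: zeta_rem_def) (simp del: of_nat_add of_nat_Suc)
  thus ?thesis by (simp add: zf_def)
qed

lemma zf_eq_zeta_series:
  assumes "1 < Re s"
  shows "zf s = (s - 1) * zeta_series s"
  \<comment> \<open>For \<open>K = 1\<close> the sum over \<open>j = 2..K\<close> in the shift
    formula is empty.\<close>
  using zeta_series_shift[OF assms zeta_rem_1_sums] assms by simp

lemma zf_eq_riemann_zeta:
  assumes "0 < Re s" "s \<noteq> 1"
  shows "zf s = (s - 1) * riemann_zeta s"
proof (rule analytic_continuation_open[where f = zf and g = "\<lambda>s. (s - 1) * riemann_zeta s"])
  show "open {s. 1 < Re s}" by (rule open_halfspace_Re_gt)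
  show "open ({s. 0 < Re s} - {1})" by (intro open_delete open_halfspace_Re_gt)
  show "connected ({s. 0 < Re s} - {1})"
    by (intro connected_open_delete open_halfspace_Re_gt convex_connected convex_halfspace_Re_gt) simp
  show "{s. 1 < Re s} \<noteq> {}" by (auto intro: exI[of _ 2])
  show "zf holomorphic_on {s. 0 < Re s} - {1}"
    by (rule holomorphic_on_subset[OF zf_holomorphic]) auto
  show "(\<lambda>s. (s - 1) * riemann_zeta s) holomorphic_on {s. 0 < Re s} - {1}"
    by (intro holomorphic_intros holomorphic_on_subset[OF riemann_zeta_holomorphic]) auto
qed (use assms zf_eq_zeta_series riemann_zeta_eq_zeta_series in auto)

text \<open>The first-order Taylor remainder is O(|s|^2 m^(-Re s - 1)), which is summable uniformly
  for Re s >= 1/4. Only the logarithm of this bound enters later. The abscissa 1/4 is the leftmost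
  point of the disc of radius 7/4 around 2 + it.\<close>

lemma norm_zf_bound: "\<exists>C>0. \<forall>s. 1/4 \<le> Re s \<longrightarrow> norm (zf s) \<le> C * (1 + norm s)^2"
proof -
  define Z where "Z = (\<Sum>m. real (m + 1) powr (-5/4))"
  have summ: "summable (\<lambda>m. real (m + 1) powr (-5/4))"
    using summable_Suc_iff[of "\<lambda>m. real m powr (-5/4)"] by (simp add: summable_real_powr_iff)
  have Z: "Z \<ge> 0" unfolding Z_def by (intro suminf_nonneg summ) auto
  have "norm (zf s) \<le> (1 + Z) * (1 + norm s)^2" if s: "1/4 \<le> Re s" for s
  proof -
    let ?c = "norm ((1 - s) gchoose Suc 1) * real (Suc 1)"
    have b: "norm (zeta_rem 1 m s) \<le> ?c * real (m + 1) powr (-5/4)" for m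
    proof -
      have "norm (zeta_rem 1 m s) \<le> ?c * real (m + 1) powr (- Re s - real 1)"
        using s by (intro norm_zeta_rem_le) auto
      also have "\<dots> \<le> ?c * real (m + 1) powr (-5/4)"
        using s by (intro mult_left_mono powr_mono) auto
      finally show ?thesis .
    qed
    have c: "?c \<le> (1 + norm s)^2"
    proof -
      have "((1 - s) gchoose Suc 1) = (1 - s) * (-s) / 2"
        by (simp add: gbinomial_prod_rev numeral_2_eq_2 atLeast0_lessThan_Suc)
      hence "?c = norm (1 - s) * norm s" by (simp add: norm_mult norm_divide)
      also have "\<dots> \<le> (1 + norm s) * (1 + norm s)"
        using norm_triangle_ineq4[of 1 s] by (intro mult_mono) auto
      finally show ?thesis by (simp add: power2_eq_square)
    qed
    have "norm (zf s - 1) \<le> (\<Sum>m. ?c * real (m + 1) powr (-5/4))"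
      using s by (intro norm_sums_le[OF zeta_rem_1_sums summable_sums b] summable_mult summ) auto
    also have "\<dots> = ?c * Z" unfolding Z_def by (rule suminf_mult[OF summ])
    also have "\<dots> \<le> (1 + norm s)^2 * Z" using c Z by (rule mult_right_mono)
    finally have "norm (zf s - 1) \<le> (1 + norm s)^2 * Z" .
    moreover have "norm (zf s) \<le> 1 + norm (zf s - 1)"
      using norm_triangle_ineq[of 1 "zf s - 1"] by simp
    moreover have "1 \<le> (1 + norm s)^2" by (simp add: one_le_power)
    ultimately have "norm (zf s) \<le> (1 + norm s)^2 + (1 + norm s)^2 * Z" by linarith
    thus ?thesis by (simp only: distrib_right mult_1_left mult.commute)
  qed
  thus ?thesis using Z by (intro exI[of _ "1 + Z"]) auto
qed

text \<open>At Re s = 2 the terms from n = 2 on add up to at most pi^2/6 - 1 < 1 in modulus,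
  whatever t is. The zero count in a disc needs such a lower bound at the centre.\<close>

lemma norm_zf_lower: "\<exists>c>0. \<forall>t. c \<le> norm (zf (Complex 2 t))"
proof -
  have S: "(\<lambda>n. 1 / (real n + 1)^2) sums (pi^2/6)"
    using inverse_squares_sums by (simp add: add.commute)
  have S': "(\<lambda>n. 1 / (real (Suc n) + 1)^2) sums (pi^2/6 - 1)"
    using S by (subst sums_Suc_iff) simp
  \<comment> \<open>3.2^2 = 10.24 < 12, so pi^2/6 < 2.\<close>
  have "pi < 3.2" using pi_approx by (simp add: abs_if split: if_splits)
  hence "pi^2 < 3.2^2" by (intro power_strict_mono) auto
  hence p: "0 < 2 - pi^2/6" by (simp add: power2_eq_square)
  have "2 - pi^2/6 \<le> norm (zf (Complex 2 t))" for t
  proof -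
    let ?s = "Complex 2 t"
    have n: "norm (1 / of_nat (Suc n) powr ?s) = 1 / (real n + 1)^2" for n
      by (simp add: norm_divide norm_powr_real_powr powr_numeral add.commute)
    have "(\<lambda>n. 1 / of_nat (Suc n) powr ?s) sums zeta_series ?s"
      by (intro zeta_series_sums) auto
    hence "(\<lambda>n. 1 / of_nat (Suc (Suc n)) powr ?s) sums (zeta_series ?s - 1)"
      by (subst sums_Suc_iff) simp
    hence "norm (zeta_series ?s - 1) \<le> pi^2/6 - 1"
      by (rule norm_sums_le[OF _ S']) (simp only: n order.refl)
    moreover have "1 \<le> norm (zeta_series ?s) + norm (zeta_series ?s - 1)"
      using norm_triangle_ineq4[of "zeta_series ?s" "zeta_series ?s - 1"] by simp
    ultimately have z: "2 - pi^2/6 \<le> norm (zeta_series ?s)" by linarith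
    have "1 \<le> norm (?s - 1)" using abs_Re_le_cmod[of "?s - 1"] by simp
    hence "1 * norm (zeta_series ?s) \<le> norm (?s - 1) * norm (zeta_series ?s)"
      by (rule mult_right_mono) auto
    thus ?thesis using z by (simp add: zf_eq_zeta_series norm_mult)
  qed
  thus ?thesis using p by blast
qed

section \<open>The Dirichlet series of the von Mangoldt function\<close>

lemma norm_inverse_nat_powr: "norm (1 / (of_nat n :: complex) powr s) = real n powr (- Re s)"
  by (cases "n = 0") (simp_all add: norm_divide norm_powr_real_powr powr_minus_divide)

lemma summable_ln_powr:
  assumes "1 < \<sigma>"
  shows "summable (\<lambda>n. ln (real n) * real n powr (- \<sigma>))"
proof (rule summable_comparison_test')
  define \<delta> where "\<delta> = (\<sigma> - 1) / 2"
  have \<delta>: "0 < \<delta>" using assms by (simp add: \<delta>_def)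
  show "summable (\<lambda>n. (1 / \<delta>) * real n powr (\<delta> - \<sigma>))"
    using assms by (intro summable_mult) (simp add: summable_real_powr_iff \<delta>_def field_simps)
  fix n :: nat assume n: "1 \<le> n"
  have "ln (real n) * real n powr (- \<sigma>) \<le> (real n powr \<delta> / \<delta>) * real n powr (- \<sigma>)"
    using n \<delta> by (intro mult_right_mono ln_powr_bound) auto
  also have "\<dots> = (1 / \<delta>) * real n powr (\<delta> - \<sigma>)" by (simp add: powr_diff powr_minus_divide)
  finally show "norm (ln (real n) * real n powr (- \<sigma>)) \<le> (1 / \<delta>) * real n powr (\<delta> - \<sigma>)"
    using n by simp
qed

lemma mangoldt_le_ln: "mangoldt n \<le> ln (real n)"
proof (cases "primepow n")
  case True
  hence n: "1 < n" using primepow_gt_Suc_0 by auto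
  hence "aprimedivisor n \<le> n" "0 < aprimedivisor n"
    using aprimedivisor_le_nat[of n] aprimedivisor_pos_nat[of n] by auto
  thus ?thesis using True by (simp add: mangoldt_def)
next
  case False
  thus ?thesis by (cases "n = 0") (simp_all add: mangoldt_def)
qed

definition mangoldt_series :: "complex \<Rightarrow> complex" where
  "mangoldt_series s = (\<Sum>n. mangoldt n / of_nat n powr s)"

lemma norm_mangoldt_term_le:
  "norm (mangoldt n / (of_nat n :: complex) powr s) \<le> ln (real n) * real n powr (- Re s)"
proof -
  have "norm (mangoldt n / (of_nat n :: complex) powr s) = mangoldt n * norm (1 / (of_nat n :: complex) powr s)"
    by (simp add: norm_divide)
  also have "\<dots> \<le> ln (real n) * real n powr (- Re s)"
    unfolding norm_inverse_nat_powr by (intro mult_right_mono mangoldt_le_ln) auto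
  finally show ?thesis .
qed

lemma summable_norm_mangoldt_term:
  assumes "1 < Re s"
  shows "summable (\<lambda>n. norm (mangoldt n / (of_nat n :: complex) powr s))"
  by (rule summable_comparison_test'[OF summable_ln_powr[OF assms], of 0])
     (simp only: real_norm_def abs_norm_cancel norm_mangoldt_term_le)

lemma mangoldt_series_sums:
  assumes "1 < Re s"
  shows "(\<lambda>n. mangoldt n / of_nat n powr s) sums mangoldt_series s"
  unfolding mangoldt_series_def
  by (rule summable_sums[OF summable_norm_cancel[OF summable_norm_mangoldt_term[OF assms]]])

lemma zeta_series_sums':
  assumes "1 < Re s"
  shows "(\<lambda>n. 1 / of_nat n powr s) sums zeta_series s"
proof -
  let ?h = "\<lambda>n. 1 / of_nat n powr s"
  have "(\<lambda>n. ?h (Suc n)) sums zeta_series s \<longleftrightarrow> ?h sums (zeta_series s + ?h 0)" by (rule sums_Suc_iff)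
  thus ?thesis using zeta_series_sums[OF assms] by simp
qed

text \<open>This is the identity \<Lambda> * 1 = ln for Dirichlet convolution. Absolute convergence
  makes the product an unordered sum over pairs (d, m), which is regrouped along d m = n by the
  bijection between pairs and divisors.\<close>

lemma Dirichlet_convolution_mangoldt:
  assumes s: "1 < Re s"
  shows "(\<lambda>n. complex_of_real (ln (real n)) / of_nat n powr s) sums (mangoldt_series s * zeta_series s)"
proof -
  let ?S = "SIGMA n:{1::nat..}. {d. d dvd n}" and ?c = "\<lambda>n. complex_of_real (ln (real n)) / of_nat n powr s"
  define a where "a n = mangoldt n / (of_nat n :: complex) powr s" for n
  define b where "b n = 1 / (of_nat n :: complex) powr s" for n
  let ?ab = "\<lambda>n. \<Sum>d | d dvd n. a d * b (n div d)"
  have a0: "a 0 = 0" and b0: "b 0 = 0" by (simp_all add: a_def b_def)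
  have sb: "summable (\<lambda>n. norm (b n))"
    unfolding b_def norm_inverse_nat_powr using s by (simp add: summable_real_powr_iff)
  have A: "(a has_sum mangoldt_series s) UNIV" unfolding a_def
    by (intro norm_summable_imp_has_sum summable_norm_mangoldt_term mangoldt_series_sums s)
  have B: "(b has_sum zeta_series s) UNIV"
    using sb zeta_series_sums'[OF s] unfolding b_def by (intro norm_summable_imp_has_sum)
  have nA: "(\<lambda>n. norm (a n)) summable_on UNIV"
    using summable_norm_mangoldt_term[OF s] unfolding a_def by (simp add: summable_on_UNIV_nonneg_real_iff)
  have nB: "(\<lambda>n. norm (b n)) summable_on UNIV" using sb by (simp add: summable_on_UNIV_nonneg_real_iff)
  have "0 \<le> (\<Sum>\<^sub>\<infinity>m. norm (b m))" by (rule infsum_nonneg) simp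
  hence "(\<lambda>x. norm (case x of (d, m) \<Rightarrow> a d * b m)) summable_on (UNIV \<times> UNIV)"
  proof -
    assume S0: "0 \<le> (\<Sum>\<^sub>\<infinity>m. norm (b m))"
    have inner: "(\<lambda>m. norm (a d * b m)) summable_on UNIV" for d
      unfolding norm_mult by (rule summable_on_cmult_right[OF nB])
    have isum: "(\<Sum>\<^sub>\<infinity>m. norm (a d * b m)) = norm (a d) * (\<Sum>\<^sub>\<infinity>m. norm (b m))" for d
      unfolding norm_mult by (rule infsum_cmult_right')
    have outer: "(\<lambda>d. norm (\<Sum>\<^sub>\<infinity>m. norm (a d * b m))) summable_on UNIV"
      unfolding isum real_norm_def abs_mult abs_norm_cancel abs_of_nonneg[OF S0]
      by (rule summable_on_cmult_left[OF nA])
    show ?thesis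
      by (subst Infinite_Sum.abs_summable_on_Sigma_iff) (simp add: inner outer del: real_norm_def)
  qed
  hence "(\<lambda>(d, m). a d * b m) summable_on (UNIV \<times> UNIV)" by (rule abs_summable_summable)
  then obtain T where T: "((\<lambda>(d, m). a d * b m) has_sum T) (UNIV \<times> UNIV)" by (auto simp: summable_on_def)
  have "((\<lambda>d. a d * zeta_series s) has_sum T) UNIV"
    by (rule has_sum_SigmaD[OF T]) (auto intro!: has_sum_cmult_right B)
  moreover have "((\<lambda>d. a d * zeta_series s) has_sum (mangoldt_series s * zeta_series s)) UNIV"
    by (intro has_sum_cmult_left A)
  ultimately have Teq: "T = mangoldt_series s * zeta_series s" by (rule has_sum_unique)
  \<comment> \<open>Both factors vanish at index 0, since \<open>0 powr s = 0\<close> and division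
    by 0 gives 0. On positive indices \<open>n div d\<close> recovers the second factor.\<close>
  have "((\<lambda>(d, m). a d * b m) has_sum T) ({1..} \<times> {1..})"
    by (rule has_sum_cong_neutral[THEN iffD1, OF _ _ _ T]) (auto simp: Suc_le_eq, metis a0 gr0I, metis b0 gr0I)
  moreover have "bij_betw (\<lambda>(n, d). (d, n div d)) ?S ({1..} \<times> {1::nat..})"
  proof (rule bij_betw_byWitness[where f' = "\<lambda>(d, m). (d * m, d)"])
    have pos: "1 \<le> d \<and> 1 \<le> n div d" if "1 \<le> n" "d dvd n" for n d :: nat
    proof -
      from that(2) obtain m where "n = d * m" by auto
      moreover from this that(1) have "0 < d" "0 < m" by (auto intro!: gr0I)
      ultimately show ?thesis by (simp add: Suc_le_eq)
    qed
    show "(\<lambda>(n, d). (d, n div d)) ` ?S \<subseteq> {1..} \<times> {1::nat..}"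
      using pos by force
    show "(\<lambda>(d, m). (d * m, d)) ` ({1..} \<times> {1::nat..}) \<subseteq> ?S"
      by force
    show "\<forall>x\<in>?S. (\<lambda>(d, m). (d * m, d)) ((\<lambda>(n, d). (d, n div d)) x) = x"
      by auto
    show "\<forall>x\<in>{1..} \<times> {1::nat..}. (\<lambda>(n, d). (d, n div d)) ((\<lambda>(d, m). (d * m, d)) x) = x"
      by auto
  qed
  ultimately have "((\<lambda>x. (\<lambda>(d, m). a d * b m) ((\<lambda>(n, d). (d, n div d)) x)) has_sum T) ?S"
    by (simp only: has_sum_reindex_bij_betw)
  hence hs: "((\<lambda>n. ?ab n) has_sum T) {1..}"
  proof (rule has_sum_SigmaD)
    fix n :: nat assume "n \<in> {1..}"
    hence "finite {d. d dvd n}" by auto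
    from has_sum_finite[OF this, of "\<lambda>d. a d * b (n div d)"]
    show "((\<lambda>d. (\<lambda>(d, m). a d * b m) ((\<lambda>(n, d). (d, n div d)) (n, d))) has_sum
      (?ab n)) {d. d dvd n}" by simp
  qed
  have eq: "(?ab n) = ?c n"
    if n: "n \<in> {1..}" for n
  proof -
    have "a d * b (n div d) = mangoldt d / of_nat n powr s" if d: "d dvd n" for d
    proof -
      from d obtain m where m: "n = d * m" by auto
      have dm: "0 < d" "0 < m" using n m by (auto intro!: Nat.gr0I)
      have "(of_nat n :: complex) powr s = of_nat d powr s * of_nat m powr s"
        unfolding m of_nat_mult by (rule powr_times_real) (auto)
      thus ?thesis using dm by (simp add: a_def b_def m)
    qed
    hence "(?ab n) = (\<Sum>d | d dvd n. mangoldt d / of_nat n powr s)"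
      by (intro sum.cong) auto
    also have "\<dots> = (\<Sum>d | d dvd n. mangoldt d) / of_nat n powr s" by (simp add: sum_divide_distrib)
    also have "(\<Sum>d | d dvd n. mangoldt d) = complex_of_real (ln (real n))"
      using n by (intro mangoldt_sum) auto
    finally show ?thesis .
  qed
  have "((\<lambda>n. ?c n) has_sum T) {1..}"
    by (rule has_sum_cong[THEN iffD1, OF eq hs])
  moreover have "((\<lambda>n. ?c n) has_sum T) {1..} \<longleftrightarrow>
      ((\<lambda>n. ?c n) has_sum T) UNIV"
    by (rule has_sum_cong_neutral) (auto simp: not_less_eq_eq)
  ultimately have "((\<lambda>n. ?c n) has_sum T) UNIV"
    by simp
  thus ?thesis unfolding Teq by (rule has_sum_imp_sums)
qed

text \<open>Differentiating termwise gives minus the series of ln n / n^s, which the convolution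
  identity has already summed. The product form avoids dividing by zeta before its nonvanishing is
  known.\<close>

lemma deriv_zeta_series:
  assumes s: "1 < Re s"
  shows "deriv zeta_series s = - (mangoldt_series s * zeta_series s)"
proof -
  let ?S = "{s. 1 < Re s}"
  let ?f = "\<lambda>n s. 1 / of_nat (Suc n) powr (s::complex)"
  let ?f' = "\<lambda>n s. - (complex_of_real (ln (real (Suc n))) / of_nat (Suc n) powr (s::complex))"
  have op: "open ?S" by (rule open_halfspace_Re_gt)
  have der: "(?f n has_field_derivative ?f' n x) (at x)" for n x
  proof -
    have "((\<lambda>s. of_nat (Suc n) powr (- s)) has_field_derivative
        (Ln (of_nat (Suc n)) * of_nat (Suc n) powr (- x) * (- 1))) (at x)"
      by (rule DERIV_chain2[OF has_field_derivative_powr_right])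
         (auto intro!: derivative_eq_intros simp del: of_nat_Suc)
    moreover have "Ln (of_nat (Suc n)) = complex_of_real (ln (real (Suc n)))"
      using Ln_of_real[of "real (Suc n)"] by (simp del: of_nat_Suc)
    ultimately show ?thesis by (simp add: powr_minus_divide del: of_nat_Suc)
  qed
  have dom: "\<exists>d h. 0 < d \<and> summable h \<and> range h \<subseteq> \<real>\<^sub>\<ge>\<^sub>0 \<and>
        (\<forall>\<^sub>F n in sequentially. \<forall>y\<in>ball x d \<inter> ?S. cmod (?f n y) \<le> cmod (h n))"
    if x: "x \<in> ?S" for x
  proof -
    define d where "d = (Re x - 1) / 2"
    have d: "0 < d" using x by (simp add: d_def)
    define h where "h n = complex_of_real (real (Suc n) powr (- (1 + d)))" for n
    have "summable h" unfolding h_def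
      using d summable_Suc_iff[of "\<lambda>n. real n powr (- (1 + d))"]
      by (intro summable_of_real) (simp add: summable_real_powr_iff)
    moreover have "range h \<subseteq> \<real>\<^sub>\<ge>\<^sub>0" unfolding h_def by (auto simp: nonneg_Reals_of_real_iff)
    moreover have "cmod (?f n y) \<le> cmod (h n)" if "y \<in> ball x d" for n y
    proof -
      have "\<bar>Re x - Re y\<bar> < d" using that abs_Re_le_cmod[of "x - y"] by (auto simp: dist_norm)
      hence "1 + d \<le> Re y" by (simp add: d_def abs_if field_simps split: if_splits)
      hence "real (Suc n) powr (- Re y) \<le> real (Suc n) powr (- (1 + d))" by (intro powr_mono) auto
      thus ?thesis unfolding norm_inverse_nat_powr h_def by simp
    qed
    ultimately show ?thesis using d by (intro exI[of _ d] exI[of _ h]) auto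
  qed
  let ?P = "\<lambda>g g' x. ((\<lambda>n. ?f n x) sums g x) \<and> ((\<lambda>n. ?f' n x) sums g' x) \<and> (g has_field_derivative g' x) (at x)"
  have "\<exists>g g'. \<forall>x\<in>?S. ?P g g' x"
    by (rule series_and_derivative_comparison_complex[OF op der dom])
  then obtain g g' where "\<forall>x\<in>?S. ?P g g' x"
    by (elim exE)
  hence g: "\<And>x. x \<in> ?S \<Longrightarrow> (\<lambda>n. ?f n x) sums g x" "\<And>x. x \<in> ?S \<Longrightarrow> (\<lambda>n. ?f' n x) sums g' x"
     "\<And>x. x \<in> ?S \<Longrightarrow> (g has_field_derivative g' x) (at x)"
    by (simp_all only:)
  have eq: "g x = zeta_series x" if "x \<in> ?S" for x
    using sums_unique2[OF g(1)[OF that] zeta_series_sums] that by simp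
  have "(zeta_series has_field_derivative g' s) (at s)"
    by (rule has_field_derivative_transform_within_open[OF g(3) op]) (use s eq in auto)
  hence A: "deriv zeta_series s = g' s" by (rule DERIV_imp_deriv)
  have B: "(\<lambda>n. ?f' n s) sums (- (mangoldt_series s * zeta_series s))"
  proof (rule sums_minus)
    let ?h = "\<lambda>n. complex_of_real (ln (real n)) / of_nat n powr s"
    have "(\<lambda>n. ?h (Suc n)) sums (mangoldt_series s * zeta_series s) \<longleftrightarrow>
        ?h sums (mangoldt_series s * zeta_series s + ?h 0)" by (rule sums_Suc_iff)
    thus "(\<lambda>n. ?h (Suc n)) sums (mangoldt_series s * zeta_series s)"
      using Dirichlet_convolution_mangoldt[OF s] by simp
  qed
  have C: "(\<lambda>n. ?f' n s) sums g' s" using s by (intro g(2)) simp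
  show ?thesis unfolding A by (rule sums_unique2[OF C B])
qed

section \<open>Zeros\<close>

text \<open>The limit is the residue of f'/f at z, that is, the order of vanishing, approached along
  the horizontal ray to the right. There the Dirichlet series of the logarithmic derivative is
  available, so orders of zeros can be tested against it.\<close>

lemma logderiv_at_right_limit:
  fixes f :: "complex \<Rightarrow> complex"
  assumes f: "f holomorphic_on S" and S: "open S" "connected S" "z \<in> S" and nz: "\<exists>w\<in>S. f w \<noteq> 0"
  shows "\<exists>n::nat. (f z = 0 \<longleftrightarrow> 0 < n) \<and>
    ((\<lambda>e. e * Re (deriv f (z + of_real e) / f (z + of_real e))) \<longlongrightarrow> real n) (at_right 0)"
proof -
  define n where "n = nat (zorder f z)"
  define g where "g = zor_poly f z"
  have ex: "(if f z = 0 then zorder f z > 0 else zorder f z = 0) \<and>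
      (\<exists>r>0. cball z r \<subseteq> S \<and> g holomorphic_on cball z r \<and>
       (\<forall>w\<in>cball z r. f w = g w * (w - z) ^ n \<and> g w \<noteq> 0))"
    unfolding n_def g_def by (rule zorder_exist_zero[OF f S nz])
  then obtain r where r: "0 < r" "cball z r \<subseteq> S" "g holomorphic_on cball z r"
    and fg: "\<And>w. w \<in> cball z r \<Longrightarrow> f w = g w * (w - z) ^ n" and g0: "\<And>w. w \<in> cball z r \<Longrightarrow> g w \<noteq> 0"
    by blast
  have n: "f z = 0 \<longleftrightarrow> 0 < n" using ex unfolding n_def by (auto split: if_splits)
  have gb: "g holomorphic_on ball z r" by (rule holomorphic_on_subset[OF r(3)]) auto
  have ld: "e * Re (deriv f (z + of_real e) / f (z + of_real e)) =
      e * Re (deriv g (z + of_real e) / g (z + of_real e)) + real n" if e: "0 < e" "e < r" for e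
  proof -
    let ?w = "z + of_real e"
    have w: "?w \<in> ball z r" using e by (simp add: dist_norm)
    have gw: "g ?w \<noteq> 0" using g0 w by auto
    have "((\<lambda>w. g w * (w - z) ^ n) has_field_derivative
       (deriv g ?w * (?w - z) ^ n + of_nat n * (?w - z) ^ (n - 1) * g ?w)) (at ?w)"
      by (auto intro!: derivative_eq_intros holomorphic_derivI[OF gb open_ball w])
    hence "(f has_field_derivative
       (deriv g ?w * (?w - z) ^ n + of_nat n * (?w - z) ^ (n - 1) * g ?w)) (at ?w)"
      by (rule has_field_derivative_transform_within_open[OF _ open_ball w]) (simp add: fg)
    hence "deriv f ?w = deriv g ?w * of_real e ^ n + of_nat n * of_real e ^ (n - 1) * g ?w"
      using DERIV_imp_deriv by fastforce
    moreover have "f ?w = g ?w * of_real e ^ n" using fg[of ?w] w by simp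
    \<comment> \<open>For \<open>n = 0\<close> the truncated exponent \<open>n - 1\<close> does no
      harm because of the factor \<open>of_nat n\<close>.\<close>
    moreover have "of_real e * (of_nat n * of_real e ^ (n - 1)) = (of_nat n * of_real e ^ n :: complex)"
      by (cases n) simp_all
    ultimately have "of_real e * (deriv f ?w / f ?w) = of_real e * (deriv g ?w / g ?w) + of_nat n"
      using gw e by (simp add: field_simps)
    moreover have "e * Re X = Re (of_real e * X)" for X by simp
    ultimately show ?thesis by (simp only: plus_complex.sel complex_Re_of_nat)
  qed
  have cont: "isCont (\<lambda>w. deriv g w / g w) z"
  proof -
    have "deriv g holomorphic_on ball z r" by (rule holomorphic_deriv[OF gb open_ball])
    hence "(\<lambda>w. deriv g w / g w) holomorphic_on ball z r"
      using g0 by (intro holomorphic_intros gb) auto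
    thus ?thesis using r by (intro continuous_on_interior[OF holomorphic_on_imp_continuous_on]) auto
  qed
  have "((\<lambda>e. z + of_real e) \<longlongrightarrow> z) (at_right 0)"
  proof -
    have "((\<lambda>e. z + of_real e) \<longlongrightarrow> z + of_real 0) (at_right 0)" by (intro tendsto_intros)
    thus ?thesis by simp
  qed
  hence lim: "((\<lambda>e. deriv g (z + of_real e) / g (z + of_real e)) \<longlongrightarrow> deriv g z / g z) (at_right 0)"
    by (rule isCont_tendsto_compose[OF cont])
  have "((\<lambda>e. e * Re (deriv g (z + of_real e) / g (z + of_real e)) + real n) \<longlongrightarrow> 0 * Re (deriv g z / g z) + real n) (at_right 0)"
    by (rule tendsto_add[OF tendsto_mult[OF tendsto_ident_at tendsto_Re[OF lim]] tendsto_const])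
  moreover have "eventually (\<lambda>e. e * Re (deriv g (z + of_real e) / g (z + of_real e)) + real n =
     e * Re (deriv f (z + of_real e) / f (z + of_real e))) (at_right 0)"
    using eventually_at_right_less[of 0] eventually_at_right_real[OF r(1)]
    by eventually_elim (auto simp: ld)
  ultimately have "((\<lambda>e. e * Re (deriv f (z + of_real e) / f (z + of_real e))) \<longlongrightarrow> real n) (at_right 0)"
    using Lim_transform_eventually by fastforce
  thus ?thesis using n by blast
qed

definition zf_logderiv :: "complex \<Rightarrow> complex" where
  "zf_logderiv s = deriv zf s / zf s"

lemma norm_mangoldt_series_le:
  assumes \<sigma>: "1 < \<sigma>" "\<sigma> \<le> Re s"
  shows "norm (mangoldt_series s) \<le> (\<Sum>n. ln (real n) * real n powr (- \<sigma>))"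
proof (rule norm_sums_le[OF mangoldt_series_sums summable_sums[OF summable_ln_powr[OF \<sigma>(1)]]])
  fix n
  have "norm (mangoldt n / (of_nat n :: complex) powr s) \<le> ln (real n) * real n powr (- Re s)"
    by (rule norm_mangoldt_term_le)
  also have "\<dots> \<le> ln (real n) * real n powr (- \<sigma>)"
    using \<sigma> by (cases "n = 0") (auto intro!: mult_left_mono powr_mono)
  finally show "norm (mangoldt n / (of_nat n :: complex) powr s) \<le> ln (real n) * real n powr (- \<sigma>)" .
qed (use \<sigma> in auto)

lemma zf_2_nonzero: "zf 2 \<noteq> 0"
proof -
  obtain c where "0 < c" "\<And>t. c \<le> norm (zf (Complex 2 t))" using norm_zf_lower by blast
  moreover have "Complex 2 0 = 2" by (simp add: complex_eq_iff)
  ultimately show ?thesis by (metis norm_zero not_le)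
qed

text \<open>A zero of order n would force e times the logarithmic derivative at s + e to tend to n >
  0. That derivative equals minus \<open>mangoldt_series\<close>, which stays bounded, so the limit
  is 0.\<close>

lemma zeta_series_nonzero:
  assumes s: "1 < Re s"
  shows "zeta_series s \<noteq> 0"
proof
  assume 0: "zeta_series s = 0"
  have "zeta_series 2 \<noteq> 0" using zf_2_nonzero zf_eq_zeta_series[of 2] by auto
  hence "\<exists>w\<in>{s. 1 < Re s}. zeta_series w \<noteq> 0" by (intro bexI[of _ 2]) auto
  then obtain n :: nat where n: "0 < n" and lim:
    "((\<lambda>e. e * Re (deriv zeta_series (s + of_real e) / zeta_series (s + of_real e))) \<longlongrightarrow> real n) (at_right 0)"
    using logderiv_at_right_limit[OF zeta_series_holomorphic open_halfspace_Re_gt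
        convex_connected[OF convex_halfspace_Re_gt], of s] s 0 by auto
  define B where "B = (\<Sum>n. ln (real n) * real n powr (- Re s))"
  have B0: "0 \<le> B" using norm_mangoldt_series_le[OF s order.refl] norm_ge_zero order_trans unfolding B_def by blast
  have ev: "eventually (\<lambda>e. e * Re (deriv zeta_series (s + of_real e) / zeta_series (s + of_real e)) \<le> e * B) (at_right 0)"
    using eventually_at_right_less[of 0]
  proof eventually_elim
    case (elim e)
    have "deriv zeta_series (s + of_real e) = - (mangoldt_series (s + of_real e) * zeta_series (s + of_real e))"
      using s elim by (intro deriv_zeta_series) auto
    hence "Re (deriv zeta_series (s + of_real e) / zeta_series (s + of_real e)) \<le> norm (mangoldt_series (s + of_real e))"
      \<comment> \<open>If zeta vanishes at the shifted point, the quotient is 0 by convention and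
        the bound is trivial.\<close>
      using abs_Re_le_cmod[of "mangoldt_series (s + of_real e)"] by (cases "zeta_series (s + of_real e) = 0") auto
    also have "\<dots> \<le> B" unfolding B_def using s elim by (intro norm_mangoldt_series_le) auto
    finally show ?case using elim by (intro mult_left_mono) auto
  qed
  have "((\<lambda>e. e * B) \<longlongrightarrow> 0 * B) (at_right 0)" by (intro tendsto_intros)
  hence "real n \<le> 0 * B" by (rule tendsto_le[OF trivial_limit_at_right_real _ lim ev])
  thus False using n by simp
qed

lemma mangoldt_series_eq_zf:
  assumes s: "1 < Re s"
  shows "mangoldt_series s = 1 / (s - 1) - zf_logderiv s"
proof -
  have op: "open {s. 1 < Re s}" by (rule open_halfspace_Re_gt)
  have "(zeta_series has_field_derivative deriv zeta_series s) (at s)"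
    using holomorphic_derivI[OF zeta_series_holomorphic op] s by simp
  hence "((\<lambda>s. (s - 1) * zeta_series s) has_field_derivative (zeta_series s + (s - 1) * deriv zeta_series s)) (at s)"
    by (auto intro!: derivative_eq_intros)
  hence "(zf has_field_derivative (zeta_series s + (s - 1) * deriv zeta_series s)) (at s)"
    by (rule has_field_derivative_transform_within_open[OF _ op]) (use s zf_eq_zeta_series in auto)
  hence "deriv zf s = zeta_series s - (s - 1) * (mangoldt_series s * zeta_series s)"
    using DERIV_imp_deriv deriv_zeta_series[OF s] by fastforce
  moreover have "L = 1 / w - (Z - w * (L * Z)) / (w * Z)" if "w \<noteq> 0" "Z \<noteq> 0" for L w Z :: complex
    using that by (simp add: diff_divide_distrib)
  moreover have "s - 1 \<noteq> 0" using s by auto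
  ultimately show ?thesis
    unfolding zf_logderiv_def zf_eq_zeta_series[OF s] using zeta_series_nonzero[OF s] by metis
qed

text \<open>Termwise this is 3 + 4 cos \<theta> + cos 2\<theta> = 2 (1 + cos \<theta>)^2 >= 0 with
  \<theta> = t ln n.\<close>

lemma mangoldt_series_341:
  assumes \<sigma>: "1 < \<sigma>"
  shows "0 \<le> 3 * Re (mangoldt_series (Complex \<sigma> 0)) + 4 * Re (mangoldt_series (Complex \<sigma> t)) +
     Re (mangoldt_series (Complex \<sigma> (2 * t)))"
proof -
  let ?T = "\<lambda>u n. mangoldt n * (real n powr (-\<sigma>) * cos (u * ln (real n)))"
  have Re_term: "Re (mangoldt n / of_nat n powr Complex \<sigma> u) = ?T u n" for n u
  proof (cases "n = 0")
    case False
    have "1 / (of_nat n :: complex) powr Complex \<sigma> u = exp (- Complex \<sigma> u * of_real (ln (real n)))"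
      using False by (simp add: powr_def exp_minus Ln_of_nat divide_inverse)
    hence "Re (1 / (of_nat n :: complex) powr Complex \<sigma> u) = real n powr (-\<sigma>) * cos (u * ln (real n))"
      using False by (simp add: Re_exp powr_def)
    moreover have "Re (mangoldt n / (of_nat n :: complex) powr Complex \<sigma> u) =
        mangoldt n * Re (1 / (of_nat n :: complex) powr Complex \<sigma> u)"
    proof -
      have "mangoldt n / (of_nat n :: complex) powr Complex \<sigma> u =
        of_real (mangoldt n) * (1 / (of_nat n :: complex) powr Complex \<sigma> u)" by simp
      thus ?thesis by (metis Re_complex_of_real Im_complex_of_real times_complex.sel(1) mult_zero_left diff_zero)
    qed
    ultimately show ?thesis by simp
  qed simp
  have S: "(\<lambda>n. ?T u n) sums Re (mangoldt_series (Complex \<sigma> u))" for u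
    using sums_Re[OF mangoldt_series_sums[of "Complex \<sigma> u"]] \<sigma> unfolding Re_term by simp
  have "(\<lambda>n. 3 * (?T 0 n) +
      4 * (?T t n) +
      ?T (2 * t) n) sums
    (3 * Re (mangoldt_series (Complex \<sigma> 0)) + 4 * Re (mangoldt_series (Complex \<sigma> t)) +
     Re (mangoldt_series (Complex \<sigma> (2 * t))))"
    by (intro sums_add sums_mult S)
  moreover have "0 \<le> 3 * (?T 0 n) +
      4 * (?T t n) +
      ?T (2 * t) n" for n
  proof -
    define x where "x = cos (t * ln (real n))"
    have c2: "cos (2 * t * ln (real n)) = 2 * x^2 - 1"
      using cos_double_cos[of "t * ln (real n)"] by (simp add: x_def mult.assoc)
    have "3 * (?T 0 n) +
      4 * (?T t n) +
      ?T (2 * t) n =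
      mangoldt n * real n powr (-\<sigma>) * (2 * (1 + x)^2)"
      unfolding c2 x_def[symmetric] by (simp add: algebra_simps power2_eq_square)
    thus ?thesis by (simp add: mangoldt_nonneg)
  qed
  ultimately show ?thesis by (rule sums_le[OF _ sums_zero, rotated])
qed

text \<open>Multiply the 3-4-1 inequality at abscissa 1 + e by e and let e tend to 0. The pole at 1
  contributes 3, a zero of order n1 at 1 + it contributes -4 n1, and one of order n2 at 1 + 2it
  contributes -n2. The result 0 <= 3 - 4 n1 - n2 rules out n1 >= 1.\<close>

lemma zf_nonzero_Re_1:
  assumes t: "t \<noteq> 0"
  shows "zf (Complex 1 t) \<noteq> 0"
proof
  assume 0: "zf (Complex 1 t) = 0"
  have nz: "\<exists>w\<in>{s. 0 < Re s}. zf w \<noteq> 0" using zf_2_nonzero by (intro bexI[of _ 2]) auto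
  have lim: "\<exists>n::nat. (zf (Complex 1 u) = 0 \<longleftrightarrow> 0 < n) \<and>
     ((\<lambda>e. e * Re (zf_logderiv (Complex (1 + e) u))) \<longlongrightarrow> real n) (at_right 0)" for u
  proof -
    have "Complex 1 u + of_real e = Complex (1 + e) u" for e by (simp add: complex_eq_iff)
    thus ?thesis
      using logderiv_at_right_limit[OF zf_holomorphic open_halfspace_Re_gt
        convex_connected[OF convex_halfspace_Re_gt] _ nz, of "Complex 1 u"]
      unfolding zf_logderiv_def by simp
  qed
  obtain n0 :: nat where n0: "zf (Complex 1 0) = 0 \<longleftrightarrow> 0 < n0"
    "((\<lambda>e. e * Re (zf_logderiv (Complex (1 + e) 0))) \<longlongrightarrow> real n0) (at_right 0)" using lim by blast
  obtain n1 :: nat where n1: "0 < n1"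
    "((\<lambda>e. e * Re (zf_logderiv (Complex (1 + e) t))) \<longlongrightarrow> real n1) (at_right 0)" using lim 0 by blast
  obtain n2 :: nat where n2:
    "((\<lambda>e. e * Re (zf_logderiv (Complex (1 + e) (2 * t)))) \<longlongrightarrow> real n2) (at_right 0)" using lim by blast
  have "Complex 1 0 = 1" by (simp add: complex_eq_iff)
  hence n00: "n0 = 0" using n0(1) by simp
  have pole: "((\<lambda>e. e * Re (1 / (Complex (1 + e) u - 1))) \<longlongrightarrow> 0) (at_right 0)" if u: "u \<noteq> 0" for u
  proof -
    have "((\<lambda>e. e * (e / (e^2 + u^2))) \<longlongrightarrow> 0 * (0 / (0^2 + u^2))) (at_right 0)"
      using u by (intro tendsto_intros) auto
    moreover have "Re (1 / (Complex (1 + e) u - 1)) = e / (e^2 + u^2)" for e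
      by (simp add: Re_divide)
    ultimately show ?thesis by simp
  qed
  have pole1: "((\<lambda>e. e * Re (1 / (Complex (1 + e) 0 - 1))) \<longlongrightarrow> 1) (at_right 0)"
  proof (rule tendsto_eventually)
    show "eventually (\<lambda>e. e * Re (1 / (Complex (1 + e) 0 - 1)) = 1) (at_right 0)"
      using eventually_at_right_less[of 0] by eventually_elim (simp add: Re_divide power2_eq_square)
  qed
  let ?G = "\<lambda>u e. e * Re (1 / (Complex (1 + e) u - 1)) - e * Re (zf_logderiv (Complex (1 + e) u))"
  have "((\<lambda>e. 3 * ?G 0 e + 4 * ?G t e + ?G (2 * t) e)
     \<longlongrightarrow> 3 * (1 - real n0) + 4 * (0 - real n1) + (0 - real n2)) (at_right 0)"
    using t by (intro tendsto_intros pole pole1 n0 n1 n2) auto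
  moreover have "eventually (\<lambda>e. 0 \<le> 3 * ?G 0 e + 4 * ?G t e + ?G (2 * t) e) (at_right 0)"
    using eventually_at_right_less[of 0]
  proof eventually_elim
    case (elim e)
    have eq: "?G u e =
        e * Re (mangoldt_series (Complex (1 + e) u))" for u
      using elim by (subst mangoldt_series_eq_zf) (auto simp: algebra_simps)
    have "0 \<le> e * (3 * Re (mangoldt_series (Complex (1 + e) 0)) + 4 * Re (mangoldt_series (Complex (1 + e) t)) +
       Re (mangoldt_series (Complex (1 + e) (2 * t))))"
      using elim by (intro mult_nonneg_nonneg mangoldt_series_341) auto
    thus ?case unfolding eq by (simp add: algebra_simps)
  qed
  ultimately have "0 \<le> 3 * (1 - real n0) + 4 * (0 - real n1) + (0 - real n2)"
    by (rule tendsto_lowerbound[OF _ _ trivial_limit_at_right_real])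
  thus False using n00 n1(1) by simp
qed

lemma zf_zero_imp_critical:
  assumes RH: "\<And>s. riemann_zeta s = 0 \<Longrightarrow> 0 < Re s \<Longrightarrow> Re s < 1 \<Longrightarrow> Re s = 1 / 2"
    and s: "0 < Re s" "zf s = 0"
  shows "Re s = 1 / 2"
proof -
  have s1: "s \<noteq> 1" using s by auto
  have "\<not> 1 < Re s" using zf_eq_zeta_series[of s] zeta_series_nonzero[of s] s s1 by auto
  moreover have "Re s \<noteq> 1"
  proof
    assume "Re s = 1"
    hence "s = Complex 1 (Im s)" by (simp add: complex_eq_iff)
    thus False using zf_nonzero_Re_1[of "Im s"] s s1 by (metis complex_eq_iff one_complex.sel complex.sel)
  qed
  ultimately have "Re s < 1" by linarith
  moreover have "riemann_zeta s = 0" using zf_eq_riemann_zeta[OF s(1) s1] s s1 by simp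
  ultimately show ?thesis using RH s(1) by blast
qed

section \<open>Local factorisation of holomorphic functions\<close>

text \<open>Since Re h < L, the value h(z) lies closer to 0 than to 2L, so h / (2L - h) maps the
  disc into the unit disc and fixes 0. Schwarz's lemma bounds it, hence h, on the disc of radius (R
  + r)/2. Cauchy's inequality on circles of radius (R - r)/2 then bounds the derivative.\<close>

lemma Borel_Caratheodory_deriv:
  assumes h: "h holomorphic_on ball 0 R" and h0: "h 0 = 0" and L: "0 < L"
    and le: "\<And>z. z \<in> ball 0 R \<Longrightarrow> Re (h z) < L"
    and r: "0 < r" "r < R" and z: "norm z \<le> r"
  shows "norm (deriv h z) \<le> 8 * R * L / (R - r)^2"
proof -
  define \<phi> where "\<phi> z = h (of_real R * z) / (2 * of_real L - h (of_real R * z))" for z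
  have R: "0 < R" using r by simp
  have inb: "of_real R * w \<in> ball 0 R" if "norm w < 1" for w :: complex
    using that R by (simp add: norm_mult)
  have den: "2 * of_real L - h w \<noteq> 0" if "w \<in> ball 0 R" for w
  proof
    assume "2 * of_real L - h w = 0"
    hence "Re (h w) = 2 * L" by (simp add: complex_eq_iff)
    thus False using le[OF that] L by simp
  qed
  have hol: "\<phi> holomorphic_on ball 0 1"
  proof -
    have "(h \<circ> (\<lambda>z. of_real R * z)) holomorphic_on ball 0 1"
      by (intro holomorphic_on_compose_gen[OF _ h] holomorphic_intros) (use inb in auto)
    hence "(\<lambda>z. h (of_real R * z)) holomorphic_on ball 0 1" by (simp add: o_def)
    thus ?thesis unfolding \<phi>_def
      using den[OF inb] by (intro holomorphic_intros) auto
  qed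
  have lt1: "norm (\<phi> w) < 1" if "norm w < 1" for w
  proof -
    let ?u = "h (of_real R * w)"
    have re: "Re ?u < L" using le[OF inb[OF that]] .
    have "(norm ?u)^2 < (norm (2 * of_real L - ?u))^2"
    proof -
      have "(norm (2 * of_real L - ?u))^2 - (norm ?u)^2 = 4 * L * (L - Re ?u)"
        unfolding cmod_power2 by (simp add: power2_eq_square algebra_simps)
      moreover have "0 < 4 * L * (L - Re ?u)" using L re by simp
      ultimately show ?thesis by linarith
    qed
    hence lt: "norm ?u < norm (2 * of_real L - ?u)"
      using norm_ge_zero power2_less_imp_less by blast
    hence "0 < norm (2 * of_real L - ?u)" using norm_ge_zero le_less_trans by blast
    thus ?thesis unfolding \<phi>_def norm_divide using lt by simp
  qed
  have schwarz: "norm (\<phi> w) \<le> norm w" if "norm w < 1" for w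
    using Schwarz_Lemma(1)[OF hol _ lt1 that] by (simp add: \<phi>_def h0)
  have hb: "norm (h w) \<le> 4 * R * L / (R - r)" if w: "norm w \<le> (R + r) / 2" for w
  proof -
    define v where "v = w / of_real R"
    have w': "w = of_real R * v" using R by (simp add: v_def)
    have v: "norm v < 1" "norm v \<le> (R + r) / (2 * R)" "norm w < R"
      using w r R by (auto simp: v_def norm_divide field_simps)
    have d: "2 * of_real L - h w \<noteq> 0" using den v by simp
    have e: "h w = \<phi> v * (2 * of_real L - h w)"
      unfolding \<phi>_def w'[symmetric] using d by simp
    have "norm (h w) \<le> norm (\<phi> v) * (2 * L + norm (h w))"
      by (subst e, subst norm_mult, rule mult_left_mono)
         (use norm_triangle_ineq4[of "2 * of_real L" "h w"] L in \<open>auto simp: norm_mult\<close>)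
    also have "\<dots> \<le> (R + r) / (2 * R) * (2 * L + norm (h w))"
      using schwarz[OF v(1)] v L by (intro mult_right_mono) auto
    finally have "(2 * R) * norm (h w) \<le> (R + r) * (2 * L + norm (h w))"
      using R by (simp add: field_simps)
    hence "(R - r) * norm (h w) \<le> (R + r) * (2 * L)"
      by (simp add: algebra_simps)
    also have "\<dots> \<le> (2 * R) * (2 * L)" using r L by (intro mult_right_mono) auto
    finally show ?thesis using r by (simp add: field_simps)
  qed
  have sub: "norm w \<le> (R + r) / 2" if "w \<in> cball z ((R - r) / 2)" for w
  proof -
    have "norm w \<le> norm z + norm (w - z)" using norm_triangle_sub by blast
    thus ?thesis using that z by (simp add: dist_norm norm_minus_commute)
  qed
  have subR: "cball z ((R - r) / 2) \<subseteq> ball 0 R"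
  proof
    fix w assume "w \<in> cball z ((R - r) / 2)"
    from sub[OF this] show "w \<in> ball 0 R" using r by simp
  qed
  have "norm ((deriv ^^ 1) h z) \<le> fact 1 * (4 * R * L / (R - r)) / ((R - r) / 2) ^ 1"
  proof (rule Cauchy_inequality)
    show "h holomorphic_on ball z ((R - r) / 2)"
      by (rule holomorphic_on_subset[OF h]) (use subR in auto)
    show "continuous_on (cball z ((R - r) / 2)) h"
      by (rule holomorphic_on_imp_continuous_on[OF holomorphic_on_subset[OF h subR]])
    show "norm (h x) \<le> 4 * R * L / (R - r)" if "norm (z - x) = (R - r) / 2" for x
      using that by (intro hb sub) (simp add: dist_norm)
  qed (use r in auto)
  thus ?thesis using r by (simp add: power2_eq_square field_simps)
qed

lemma norm_prod_list:
  fixes xs :: "'a::real_normed_div_algebra list"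
  shows "norm (prod_list xs) = prod_list (map norm xs)"
  by (induction xs) (simp_all add: norm_mult)

text \<open>Jensen's inequality in multiplicative form. On |z| = R the factor (R^2 - cnj a z)/R has
  the same modulus as z - a, so the maximum principle carries the bound M over to \<open>gt\<close>.
  At 0 the new factor has modulus R instead of |a| <= r, so every listed zero gains a factor
  R/r.\<close>

lemma zero_divisor_list_bound:
  assumes g: "g holomorphic_on S" and S: "open S" "cball 0 R \<subseteq> S" and R: "0 < r" "r < R"
    and eq: "\<And>z. z \<in> S \<Longrightarrow> f z = g z * (\<Prod>a\<leftarrow>as. z - a)"
    and as: "set as \<subseteq> cball 0 r"
    and M: "\<And>z. z \<in> cball 0 R \<Longrightarrow> norm (f z) \<le> M"
  defines "gt \<equiv> \<lambda>z. g z * (\<Prod>a\<leftarrow>as. (of_real (R^2) - cnj a * z) / of_real R)"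
  shows "\<And>z. z \<in> cball 0 R \<Longrightarrow> norm (gt z) \<le> M"
    and "norm (f 0) * (R / r) ^ length as \<le> norm (gt 0)"
    and "gt holomorphic_on S"
proof -
  have R0: "0 < R" using R by simp
  have blaschke: "norm ((of_real (R^2) - cnj a * z) / of_real R) = norm (z - a)" if "norm z = R" for a z
  proof -
    have "of_real (R^2) - cnj a * z = z * cnj (z - a)"
      using that complex_norm_square[of z] by (simp add: algebra_simps)
    thus ?thesis using that R0 by (simp add: norm_mult norm_divide del: complex_cnj_diff)
  qed
  show hol: "gt holomorphic_on S"
    unfolding gt_def
  proof (intro holomorphic_on_mult g)
    show "(\<lambda>z. \<Prod>a\<leftarrow>as. (of_real (R^2) - cnj a * z) / of_real R) holomorphic_on S"
      using R0 by (induction as) (auto intro!: holomorphic_intros)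
  qed
  show bd: "norm (gt z) \<le> M" if z: "z \<in> cball 0 R" for z
  proof (rule maximum_modulus_frontier[of gt "cball 0 R" M z])
    show "gt holomorphic_on interior (cball 0 R)"
      by (rule holomorphic_on_subset[OF hol]) (use S interior_subset in blast)
    show "continuous_on (closure (cball 0 R)) gt"
      using holomorphic_on_imp_continuous_on[OF holomorphic_on_subset[OF hol S(2)]] by simp
    show "norm (gt w) \<le> M" if "w \<in> frontier (cball 0 R)" for w
    proof -
      have w: "norm w = R" using that R0 by (simp add: frontier_cball)
      have "norm (\<Prod>a\<leftarrow>as. (of_real (R^2) - cnj a * w) / of_real R) = norm (\<Prod>a\<leftarrow>as. w - a)"
        unfolding norm_prod_list by (simp only: map_map o_def blaschke[OF w])
      moreover have "w \<in> S" using w S by auto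
      ultimately have "norm (gt w) = norm (f w)" unfolding gt_def by (simp add: norm_mult eq)
      thus ?thesis using M[of w] w by simp
    qed
  qed (use z in auto)
  have "0 \<in> S" using S R0 by auto
  have eta: "(-) (0::complex) = uminus" by (simp add: fun_eq_iff)
  have "norm (\<Prod>a\<leftarrow>as. 0 - a) * (R / r) ^ length as \<le> norm (\<Prod>a\<leftarrow>as. (of_real (R^2) - cnj a * 0) / of_real R)"
    using as
  proof (induction as)
    case (Cons a as)
    have "norm a * (R / r) \<le> R" using Cons.prems R by (simp add: field_simps)
    hence "(norm a * (R / r)) * (norm (\<Prod>a\<leftarrow>as. 0 - a) * (R / r) ^ length as) \<le>
       R * norm (\<Prod>a\<leftarrow>as. (of_real (R^2) - cnj a * 0) / of_real R)"
      using Cons R by (intro mult_mono) auto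
    moreover have "norm ((of_real (R^2) - cnj a * 0) / of_real R) = R"
      using R0 by (simp add: norm_divide power2_eq_square norm_mult)
    moreover have "norm (\<Prod>a\<leftarrow>a # as. (of_real (R^2) - cnj a * 0) / of_real R) =
      norm ((of_real (R^2) - cnj a * 0) / of_real R) * norm (\<Prod>a\<leftarrow>as. (of_real (R^2) - cnj a * 0) / of_real R)"
      unfolding list.map prod_list.Cons norm_mult ..
    moreover have "norm (\<Prod>a\<leftarrow>a # as. 0 - a) * (R / r) ^ length (a # as) =
      (norm a * (R / r)) * (norm (\<Prod>a\<leftarrow>as. 0 - a) * (R / r) ^ length as)"
      unfolding list.map prod_list.Cons norm_mult
      by (simp only: eta diff_0 norm_minus_cancel length_Cons power_Suc mult_ac)
    ultimately show ?case by (simp only:)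
  qed simp
  hence "norm (g 0) * (norm (\<Prod>a\<leftarrow>as. 0 - a) * (R / r) ^ length as) \<le> norm (g 0) *
       norm (\<Prod>a\<leftarrow>as. (of_real (R^2) - cnj a * 0) / of_real R)"
    by (rule mult_left_mono) auto
  thus "norm (f 0) * (R / r) ^ length as \<le> norm (gt 0)"
    unfolding gt_def eq[OF \<open>0 \<in> S\<close>] by (simp only: norm_mult mult.assoc)
qed


lemma prod_list_has_field_derivative:
  fixes p :: "'b \<Rightarrow> complex \<Rightarrow> complex"
  assumes "\<And>a. a \<in> set as \<Longrightarrow> (p a has_field_derivative p' a) (at z)"
    and "\<And>a. a \<in> set as \<Longrightarrow> p a z \<noteq> 0"
  shows "((\<lambda>z. \<Prod>a\<leftarrow>as. p a z) has_field_derivative (\<Prod>a\<leftarrow>as. p a z) * (\<Sum>a\<leftarrow>as. p' a / p a z)) (at z)"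
  using assms
proof (induction as)
  case (Cons a as)
  have "((\<lambda>z. p a z * (\<Prod>a\<leftarrow>as. p a z)) has_field_derivative
     (p' a * (\<Prod>a\<leftarrow>as. p a z) + (\<Prod>a\<leftarrow>as. p a z) * (\<Sum>a\<leftarrow>as. p' a / p a z) * p a z)) (at z)"
    using Cons by (intro DERIV_mult) auto
  moreover have "p a z \<noteq> 0" using Cons.prems by simp
  moreover have "p' a * Q + Q * S * p a z = (p a z * Q) * (p' a / p a z + S)" if "p a z \<noteq> 0" for Q S
    using that by (simp add: field_simps)
  ultimately show ?case by simp
qed auto

lemma logderiv_mult_prod_list:
  fixes p :: "'b \<Rightarrow> complex \<Rightarrow> complex"
  assumes g: "(g has_field_derivative g') (at z)" "g z \<noteq> 0"
    and p: "\<And>a. a \<in> set as \<Longrightarrow> (p a has_field_derivative p' a) (at z)"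
      "\<And>a. a \<in> set as \<Longrightarrow> p a z \<noteq> 0"
    and S: "open S" "z \<in> S" and f: "\<And>z. z \<in> S \<Longrightarrow> f z = g z * (\<Prod>a\<leftarrow>as. p a z)"
  shows "deriv f z / f z = g' / g z + (\<Sum>a\<leftarrow>as. p' a / p a z)"
proof -
  let ?P = "\<Prod>a\<leftarrow>as. p a z"
  have P: "?P \<noteq> 0" using p(2) by (auto simp: prod_list_zero_iff)
  have "((\<lambda>z. g z * (\<Prod>a\<leftarrow>as. p a z)) has_field_derivative
      (g' * ?P + ?P * (\<Sum>a\<leftarrow>as. p' a / p a z) * g z)) (at z)"
    by (intro DERIV_mult g prod_list_has_field_derivative p)
  hence "(f has_field_derivative (g' * ?P + ?P * (\<Sum>a\<leftarrow>as. p' a / p a z) * g z)) (at z)"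
    by (rule has_field_derivative_transform_within_open[OF _ S]) (simp add: f)
  hence "deriv f z = g' * ?P + ?P * (\<Sum>a\<leftarrow>as. p' a / p a z) * g z" by (rule DERIV_imp_deriv)
  moreover have "f z = g z * ?P" using f S by simp
  ultimately show ?thesis using g P by (simp add: divide_simps) (simp add: algebra_simps)
qed

text \<open>Zeros are taken out as a list of linear factors of maximal length, with repetitions
  recording multiplicity. Trading these factors for Blaschke factors leaves a function without zeros
  in the disc of radius R', of modulus at most M and not smaller than f at 0. It has a holomorphic
  logarithm there, and the Borel-Caratheodory bound applies to that. The Blaschke factors themselves
  add at most R'/(R^2 - R'^2) each to the logarithmic derivative.\<close>

lemma local_factorisation_0:
  fixes f :: "complex \<Rightarrow> complex"
  assumes f: "f holomorphic_on S" and S: "open S" "cball 0 R \<subseteq> S"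
    and r: "0 < r" "r < R'" "R' < R" and f0: "f 0 \<noteq> 0"
    and M: "\<And>z. z \<in> cball 0 R \<Longrightarrow> norm (f z) \<le> M"
  defines "L \<equiv> ln (M / norm (f 0))"
  shows "\<exists>as. set as \<subseteq> {a \<in> cball 0 R'. f a = 0} \<and> real (length as) * ln (R / R') \<le> L \<and>
    (\<forall>z\<in>cball 0 r. f z \<noteq> 0 \<longrightarrow> norm (deriv f z / f z - (\<Sum>a\<leftarrow>as. 1 / (z - a))) \<le>
       8 * R' * (L + 1) / (R' - r)^2 + real (length as) * (R' / (R^2 - R'^2)))"
proof -
  define P where "P as \<longleftrightarrow> set as \<subseteq> cball 0 R' \<and>
     (\<exists>g. g holomorphic_on S \<and> (\<forall>z\<in>S. f z = g z * (\<Prod>a\<leftarrow>as. z - a)))" for as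
  have R'0: "0 < R'" and R0: "0 < R" using r by auto
  have RR: "1 < R / R'" using r R'0 by (simp add: field_simps)
  have zS: "0 \<in> S" using S R0 by auto
  have M0: "norm (f 0) \<le> M" using M[of 0] R0 by simp
  have Mpos: "0 < M" using M0 f0 by (meson less_le_trans zero_less_norm_iff)
  have L0: "0 \<le> L" unfolding L_def using M0 f0 by (intro ln_ge_zero) (simp add: field_simps)
  have len: "real (length as) * ln (R / R') \<le> L" if "P as" for as
  proof -
    from that obtain g where g: "g holomorphic_on S" "\<And>z. z \<in> S \<Longrightarrow> f z = g z * (\<Prod>a\<leftarrow>as. z - a)"
      and as: "set as \<subseteq> cball 0 R'" unfolding P_def by blast
    note b = zero_divisor_list_bound[OF g(1) S R'0 r(3) g(2) as M]
    have "norm (f 0) * (R / R') ^ length as \<le> M"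
      using b(2) b(1)[of 0] R0 by auto
    hence "(R / R') ^ length as \<le> M / norm (f 0)" using f0 by (simp add: field_simps)
    hence "ln ((R / R') ^ length as) \<le> L"
      unfolding L_def using RR by (intro ln_mono) auto
    thus ?thesis using RR by (simp add: ln_realpow)
  qed
  have "P []" unfolding P_def using f by auto
  \<comment> \<open>The Jensen bound limits the length of every admissible list, so a longest one
    exists.\<close>
  moreover have "\<forall>as. P as \<longrightarrow> length as < Suc (nat \<lceil>L / ln (R / R')\<rceil>)"
  proof (intro allI impI)
    fix as assume "P as"
    from len[OF this] have "real (length as) \<le> L / ln (R / R')"
      using RR by (simp add: field_simps)
    thus "length as < Suc (nat \<lceil>L / ln (R / R')\<rceil>)" by linarith
  qed
  ultimately have "\<exists>as. P as \<and> (\<forall>bs. P bs \<longrightarrow> length bs \<le> length as)"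
    by (rule ex_has_greatest_nat)
  then obtain as where as: "P as" and max: "\<And>bs. P bs \<Longrightarrow> length bs \<le> length as"
    by (elim exE conjE) simp
  then obtain g where g: "g holomorphic_on S" "\<And>z. z \<in> S \<Longrightarrow> f z = g z * (\<Prod>a\<leftarrow>as. z - a)"
    and asub: "set as \<subseteq> cball 0 R'" unfolding P_def by blast
  \<comment> \<open>A zero of the cofactor would allow one more linear factor to be split off
    (removable singularity), against maximality.\<close>
  have g_nz: "g a \<noteq> 0" if a: "a \<in> cball 0 R'" for a
  proof
    assume ga: "g a = 0"
    define g2 where "g2 z = (if z = a then deriv g a else (g z - g a) / (z - a))" for z
    have "g2 holomorphic_on S" unfolding g2_def by (rule pole_lemma_open[OF g(1) S(1)])
    moreover have "g z = g2 z * (z - a)" for z using ga by (simp add: g2_def)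
    hence "\<forall>z\<in>S. f z = g2 z * (\<Prod>a\<leftarrow>a # as. z - a)" using g(2) by (simp add: mult.assoc)
    ultimately have "P (a # as)" unfolding P_def using asub a by auto
    from max[OF this] show False by simp
  qed
  define q where "q a z = (of_real (R^2) - cnj a * z) / of_real R" for a z
  define gt where "gt z = g z * (\<Prod>a\<leftarrow>as. q a z)" for z
  note b = zero_divisor_list_bound[OF g(1) S R'0 r(3) g(2) asub M, folded q_def gt_def]
  have den: "R^2 - R'^2 \<le> norm (of_real (R^2) - cnj a * z)"
    if "a \<in> cball 0 R'" "z \<in> cball 0 R'" for a z
  proof -
    have "norm (cnj a * z) \<le> R' * R'"
      using that R'0 unfolding norm_mult complex_mod_cnj by (intro mult_mono) auto
    moreover have "norm (of_real (R^2) :: complex) - norm (cnj a * z) \<le> norm (of_real (R^2) - cnj a * z)"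
      by (rule norm_triangle_ineq2)
    moreover have "norm (of_real (R^2) :: complex) = R^2" by (simp only: norm_of_real) simp
    ultimately show ?thesis by (simp add: power2_eq_square)
  qed
  have RR2: "0 < R^2 - R'^2" using r R'0 by (simp add: power_strict_mono)
  have q_nz: "q a z \<noteq> 0" if "a \<in> cball 0 R'" "z \<in> cball 0 R'" for a z
    using den[OF that] RR2 R0 unfolding q_def by auto
  have gt_nz: "gt z \<noteq> 0" if "z \<in> cball 0 R'" for z
    unfolding gt_def using g_nz q_nz that asub by (auto simp: prod_list_zero_iff)
  have sub: "ball 0 R' \<subseteq> S" using S r by (meson ball_subset_cball less_imp_le subset_ball subset_trans)
  obtain h where h: "h holomorphic_on ball 0 R'" "\<And>z. z \<in> ball 0 R' \<Longrightarrow> exp (h z) = gt z"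
    using holomorphic_logarithm_exists[of "ball 0 R'" gt 0] holomorphic_on_subset[OF b(3) sub] gt_nz R'0
    by auto
  have dh: "deriv h z = deriv gt z / gt z" if z: "z \<in> ball 0 R'" for z
  proof -
    have "(h has_field_derivative deriv h z) (at z)"
      using holomorphic_derivI[OF h(1) open_ball z] .
    hence "((\<lambda>z. exp (h z)) has_field_derivative exp (h z) * deriv h z) (at z)"
      by (rule DERIV_fun_exp)
    hence "(gt has_field_derivative exp (h z) * deriv h z) (at z)"
      by (rule has_field_derivative_transform_within_open[OF _ open_ball z]) (simp add: h)
    hence "deriv gt z = gt z * deriv h z" using h(2)[OF z] DERIV_imp_deriv by metis
    thus ?thesis using gt_nz[of z] z by simp
  qed
  have f0gt: "norm (f 0) \<le> norm (gt 0)"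
  proof -
    have "norm (f 0) * 1 \<le> norm (f 0) * (R / R') ^ length as"
      using RR by (intro mult_left_mono one_le_power) auto
    thus ?thesis using b(2) by linarith
  qed
  have dgt: "norm (deriv gt z / gt z) \<le> 8 * R' * (L + 1) / (R' - r)^2" if z: "z \<in> cball 0 r" for z
  proof -
    \<comment> \<open>\<open>L\<close> may be 0 and is only a weak upper bound for the real part.
      \<open>L + 1\<close> supplies the positive strict bound required.\<close>
    have "norm (deriv (\<lambda>z. h z - h 0) z) \<le> 8 * R' * (L + 1) / (R' - r)^2"
    proof (rule Borel_Caratheodory_deriv)
      show "(\<lambda>z. h z - h 0) holomorphic_on ball 0 R'" by (intro holomorphic_intros h)
      fix w :: complex assume w: "w \<in> ball 0 R'"
      have "exp (Re (h w - h 0)) = norm (gt w) / norm (gt 0)"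
        using h(2)[OF w] h(2)[of 0] R'0 by (simp add: exp_diff flip: norm_exp_eq_Re)
      also have "\<dots> \<le> M / norm (f 0)"
        using b(1)[of w] w r f0 f0gt Mpos by (intro frac_le) auto
      finally have "Re (h w - h 0) \<le> L"
        unfolding L_def using f0 Mpos by (subst ln_ge_iff) auto
      thus "Re (h w - h 0) < L + 1" by simp
    qed (use r z L0 in auto)
    moreover have zb: "z \<in> ball 0 R'" using z r by auto
    have "deriv (\<lambda>z. h z - h 0) z = deriv h z"
      by (rule DERIV_imp_deriv) (auto intro!: derivative_eq_intros holomorphic_derivI[OF h(1) open_ball zb])
    ultimately show ?thesis using dh[OF zb] by simp
  qed
  have key: "norm (deriv f z / f z - (\<Sum>a\<leftarrow>as. 1 / (z - a))) \<le>
       8 * R' * (L + 1) / (R' - r)^2 + real (length as) * (R' / (R^2 - R'^2))"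
    if z: "z \<in> cball 0 r" "f z \<noteq> 0" for z
  proof -
    let ?Q = "\<lambda>as. \<Sum>a\<leftarrow>as. (- cnj a / of_real R) / q a z" and ?s = "\<Sum>a\<leftarrow>as. 1 / (z - a)"
    have z': "z \<in> cball 0 R'" "z \<in> S" using z r sub by auto
    have dg: "(g has_field_derivative deriv g z) (at z)" using holomorphic_derivI[OF g(1) S(1) z'(2)] .
    have za: "z \<noteq> a" if "a \<in> set as" for a
      using z(2) g(2)[OF z'(2)] that by (auto simp: prod_list_zero_iff)
    have 1: "deriv f z / f z = deriv g z / g z + ?s"
      by (rule logderiv_mult_prod_list[OF dg g_nz[OF z'(1)] _ _ S(1) z'(2) g(2)])
         (use za in \<open>auto intro!: derivative_eq_intros\<close>)
    have qd: "(q a has_field_derivative (- cnj a / of_real R)) (at z)" for a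
      unfolding q_def[abs_def] using R0 by (auto intro!: derivative_eq_intros)
    have 2: "deriv gt z / gt z = deriv g z / g z + (?Q as)"
      by (rule logderiv_mult_prod_list[OF dg g_nz[OF z'(1)] qd q_nz[OF subsetD[OF asub] z'(1)] S(1) z'(2) gt_def])
    have 3: "norm (?Q as) \<le> real (length as) * (R' / (R^2 - R'^2))"
      using asub
    proof (induction as)
      case (Cons a as)
      have a: "a \<in> cball 0 R'" using Cons.prems by simp
      have "norm ((- cnj a / of_real R) / q a z) = norm a / norm (of_real (R^2) - cnj a * z)"
        using R0 by (simp add: q_def norm_divide)
      also have "\<dots> \<le> R' / (R^2 - R'^2)"
        using a den[OF a z'(1)] RR2 R'0 by (intro frac_le) auto
      finally have "norm ((- cnj a / of_real R) / q a z) \<le> R' / (R^2 - R'^2)" .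
      moreover have "norm (?Q as) \<le> real (length as) * (R' / (R^2 - R'^2))"
        using Cons by simp
      moreover have "norm (?Q (a # as)) \<le>
        norm ((- cnj a / of_real R) / q a z) + norm (?Q as)"
        unfolding list.map sum_list.Cons by (rule norm_triangle_ineq)
      ultimately have "norm (?Q (a # as)) \<le>
        R' / (R^2 - R'^2) + real (length as) * (R' / (R^2 - R'^2))" by linarith
      moreover have "real (length (a # as)) * (R' / (R^2 - R'^2)) =
        R' / (R^2 - R'^2) + real (length as) * (R' / (R^2 - R'^2))"
        unfolding length_Cons of_nat_Suc by (simp only: distrib_right mult_1_left add.commute)
      ultimately show ?case by (simp only:)
    qed simp
    have "deriv f z / f z - ?s =
       deriv gt z / gt z - (?Q as)" using 1 2 by simp
    also have "norm \<dots> \<le> norm (deriv gt z / gt z) + norm (?Q as)"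
      by (rule norm_triangle_ineq4)
    finally show ?thesis using dgt[OF z(1)] 3 by linarith
  qed
  have "f a = 0" if "a \<in> set as" for a
  proof -
    have "a \<in> S" using that asub S r by (meson cball_subset_cball_iff less_imp_le subset_eq mem_cball order_trans)
    thus ?thesis using g(2) that by (force simp: prod_list_zero_iff)
  qed
  thus ?thesis using asub len[OF as] key by (intro exI[of _ as]) auto
qed

text \<open>The order of the quantifiers is the point: the constant depends on the three radii
  alone, so one constant serves the discs around 2 + it for all t. The previous lemma is translated
  from centre 0 to centre z0.\<close>

lemma local_factorisation:
  assumes r: "0 < r" "r < R'" "R' < R"
  shows "\<exists>C>0. \<forall>f S z0 M. f holomorphic_on S \<longrightarrow> open S \<longrightarrow> cball z0 R \<subseteq> S \<longrightarrow> f z0 \<noteq> 0 \<longrightarrow>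
    (\<forall>z\<in>cball z0 R. norm (f z) \<le> M) \<longrightarrow>
    (\<exists>as. set as \<subseteq> {a \<in> cball z0 R'. f a = 0} \<and> real (length as) \<le> C * (ln (M / norm (f z0)) + 1) \<and>
      (\<forall>z\<in>cball z0 r. f z \<noteq> 0 \<longrightarrow> norm (deriv f z / f z - (\<Sum>a\<leftarrow>as. 1 / (z - a))) \<le>
         C * (ln (M / norm (f z0)) + 1)))"
  (is "\<exists>C>0. \<forall>f S z0 M. _ \<longrightarrow> _ \<longrightarrow> _ \<longrightarrow> _ \<longrightarrow> _ \<longrightarrow> ?P C f z0 M")
proof -
  define C1 where "C1 = 1 / ln (R / R')"
  define C2 where "C2 = 8 * R' / (R' - r)^2"
  define C3 where "C3 = R' / (R^2 - R'^2)"
  have RR: "1 < R / R'" using r by (simp add: field_simps)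
  have RR2: "0 < R^2 - R'^2" using r by (simp add: power_strict_mono)
  have pos: "0 < C1" "0 < C2" "0 < C3" using r RR RR2 by (auto simp: C1_def C2_def C3_def)
  have main: "?P (C1 + C2 + C1 * C3) f z0 M"
    if f: "f holomorphic_on S" and S: "open S" "cball z0 R \<subseteq> S" and f0: "f z0 \<noteq> 0"
      and M: "\<And>z. z \<in> cball z0 R \<Longrightarrow> norm (f z) \<le> M" for f S z0 M
  proof -
    define F where "F w = f (w + z0)" for w
    define T where "T = (\<lambda>w. w + z0) -` S"
    define L where "L = ln (M / norm (f z0))"
    have M0: "norm (f z0) \<le> M" using M[of z0] r by simp
    have L0: "0 \<le> L" unfolding L_def using M0 f0 by (intro ln_ge_zero) (simp add: field_simps)
    have T: "open T" unfolding T_def by (intro open_vimage S continuous_intros)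
    have FT: "F holomorphic_on T"
    proof -
      have "(f \<circ> (\<lambda>w. w + z0)) holomorphic_on T"
        by (intro holomorphic_on_compose_gen[OF _ f] holomorphic_intros) (auto simp: T_def)
      thus ?thesis by (simp add: o_def F_def[abs_def])
    qed
    have sh: "w + z0 \<in> cball z0 \<rho> \<longleftrightarrow> w \<in> cball 0 \<rho>" for w \<rho>
      by (simp add: dist_norm)
    have RT: "cball 0 R \<subseteq> T" using S(2) sh unfolding T_def by blast
    have dF: "deriv F w = deriv f (w + z0)" for w
    proof -
      have "deriv F w = deriv (F \<circ> (\<lambda>h. h + w)) 0" by (simp add: deriv_shift_0[of F w] o_def add.commute)
      also have "F \<circ> (\<lambda>h. h + w) = f \<circ> (\<lambda>h. h + (w + z0))" by (simp add: F_def o_def add_ac)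
      also have "deriv \<dots> 0 = deriv f (w + z0)" by (simp add: deriv_shift_0[of f "w + z0"] o_def add.commute)
      finally show ?thesis .
    qed
    obtain as where as: "set as \<subseteq> {a \<in> cball 0 R'. F a = 0}" "real (length as) * ln (R / R') \<le> L"
      "\<And>z. z \<in> cball 0 r \<Longrightarrow> F z \<noteq> 0 \<Longrightarrow> norm (deriv F z / F z - (\<Sum>a\<leftarrow>as. 1 / (z - a))) \<le>
       8 * R' * (L + 1) / (R' - r)^2 + real (length as) * (R' / (R^2 - R'^2))"
      using local_factorisation_0[OF FT T RT r, of M] f0 M sh unfolding L_def F_def by auto
    have len: "real (length as) \<le> C1 * (L + 1)"
    proof -
      have "real (length as) \<le> C1 * L" using as(2) RR by (simp add: C1_def field_simps)
      also have "\<dots> \<le> C1 * (L + 1)" using pos by simp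
      finally show ?thesis .
    qed
    define bs where "bs = map (\<lambda>a. a + z0) as"
    have 1: "set bs \<subseteq> {a \<in> cball z0 R'. f a = 0}" using as(1) sh unfolding bs_def F_def by auto
    have "C1 * (L + 1) \<le> (C1 + C2 + C1 * C3) * (L + 1)"
      using pos L0 by (intro mult_right_mono) auto
    hence 2: "real (length bs) \<le> (C1 + C2 + C1 * C3) * (L + 1)" using len unfolding bs_def by simp
    have 3: "norm (deriv f z / f z - (\<Sum>a\<leftarrow>bs. 1 / (z - a))) \<le> (C1 + C2 + C1 * C3) * (L + 1)"
      if z: "z \<in> cball z0 r" "f z \<noteq> 0" for z
    proof -
      have "norm (deriv F (z - z0) / F (z - z0) - (\<Sum>a\<leftarrow>as. 1 / (z - z0 - a))) \<le>
         8 * R' * (L + 1) / (R' - r)^2 + real (length as) * (R' / (R^2 - R'^2))"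
        using z sh[of "z - z0" r] by (intro as(3)) (auto simp: F_def)
      also have "\<dots> = C2 * (L + 1) + real (length as) * C3" by (simp add: C2_def C3_def)
      also have "\<dots> \<le> C2 * (L + 1) + (C1 * (L + 1)) * C3"
        using len pos by (intro add_left_mono mult_right_mono) auto
      also have "\<dots> \<le> (C1 + C2 + C1 * C3) * (L + 1)" using pos L0 by (simp add: algebra_simps)
      finally have "norm (deriv F (z - z0) / F (z - z0) - (\<Sum>a\<leftarrow>as. 1 / (z - z0 - a))) \<le> (C1 + C2 + C1 * C3) * (L + 1)" .
      moreover have "(\<Sum>a\<leftarrow>bs. 1 / (z - a)) = (\<Sum>a\<leftarrow>as. 1 / (z - z0 - a))"
        unfolding bs_def by (simp add: o_def algebra_simps)
      ultimately show ?thesis by (simp add: dF) (simp add: F_def)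
    qed
    show ?thesis unfolding L_def[symmetric] by (intro exI[of _ bs] conjI ballI impI 1 2 3)
  qed
  have "0 < C1 + C2 + C1 * C3" using pos by (simp add: add_pos_pos)
  thus ?thesis
  proof (intro exI[of _ "C1 + C2 + C1 * C3"] conjI allI impI)
    fix f S z0 M
    assume f: "f holomorphic_on S" "open S" "cball z0 R \<subseteq> S" "f z0 \<noteq> 0"
      and M: "\<forall>z\<in>cball z0 R. norm (f z) \<le> M"
    show "?P (C1 + C2 + C1 * C3) f z0 M"
      by (rule main[OF f bspec[OF M]])
  qed
qed

section \<open>The logarithmic derivative near the critical line\<close>

text \<open>The total mass pi depends neither on the width \<open>e\<close> nor on the centre. A sum
  of such densities over zeros can therefore be integrated knowing only how many zeros there
  are.\<close>

lemma Cauchy_density_nn_integral: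
  fixes e \<gamma> :: real
  assumes e: "0 < e"
  shows "(\<integral>\<^sup>+t. ennreal (e / (e^2 + (t - \<gamma>)^2)) \<partial>lborel) \<le> ennreal pi"
proof -
  let ?f = "\<lambda>t::real. e / (e^2 + (t - \<gamma>)^2)"
  have pos: "0 < e^2 + (t - \<gamma>)^2" for t using e by (simp add: add_pos_nonneg)
  let ?I = "\<integral>\<^sup>+t. ennreal (?f t) * indicator {\<gamma>..} t \<partial>lborel"
  let ?r = "\<lambda>t. ennreal (?f (2 * \<gamma> - t)) * indicator {\<gamma>..} (2 * \<gamma> - t)"
  have half: "?I = ennreal (pi / 2 - arctan ((\<gamma> - \<gamma>) / e))"
  proof (rule nn_integral_FTC_atLeast[where F = "\<lambda>t. arctan ((t - \<gamma>) / e)" and T = "pi / 2"])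
    have "filterlim (\<lambda>t. (t - \<gamma>) / e) at_top at_top" using e by real_asymp
    thus "((\<lambda>t. arctan ((t - \<gamma>) / e)) \<longlongrightarrow> pi / 2) at_top"
      by (rule filterlim_compose[OF tendsto_arctan_at_top])
    fix t :: real
    have "((\<lambda>t. arctan ((t - \<gamma>) / e)) has_real_derivative (inverse (1 + ((t - \<gamma>) / e)^2) * (1 / e))) (at t)"
      using e by (auto intro!: derivative_eq_intros)
    moreover have "inverse (1 + ((t - \<gamma>) / e)^2) * (1 / e) = ?f t"
      using e pos[of t] by (simp add: field_simps power2_eq_square)
    ultimately show "((\<lambda>t. arctan ((t - \<gamma>) / e)) has_real_derivative ?f t) (at t)" by simp
    show "0 \<le> ?f t" using e pos[of t] by simp
  qed auto
  \<comment> \<open>The density is symmetric about its centre, so the left half is the reflection of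
    the right one. The centre itself is counted twice, hence an inequality.\<close>
  have "(\<integral>\<^sup>+t. ennreal (?f t) \<partial>lborel) \<le>
     (\<integral>\<^sup>+t. ennreal (?f t) * indicator {\<gamma>..} t + ?r t \<partial>lborel)"
    by (intro nn_integral_mono) (auto simp: indicator_def power2_commute)
  also have "\<dots> = ?I +
      (\<integral>\<^sup>+t. ?r t \<partial>lborel)"
    by (intro nn_integral_add) auto
  also have "(\<integral>\<^sup>+t. ?r t \<partial>lborel) =
     ?I"
    by (subst (2) nn_integral_real_affine[where c = "-1" and t = "2 * \<gamma>"]) auto
  also have "?I + ?I
     = ennreal pi"
    unfolding half by (subst ennreal_plus[symmetric]) auto
  finally show ?thesis .
qed

lemma zf_logderiv_local:
  assumes zeros: "\<And>s. 0 < Re s \<Longrightarrow> zf s = 0 \<Longrightarrow> Re s = 1 / 2"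
  shows "\<exists>C>0. \<forall>t0. \<exists>as. (\<forall>a\<in>set as. Re a = 1 / 2) \<and> real (length as) \<le> C * ln (\<bar>t0\<bar> + 2) \<and>
    (\<forall>s. 1/2 < Re s \<longrightarrow> Re s \<le> 2 \<longrightarrow> \<bar>Im s - t0\<bar> \<le> 1/4 \<longrightarrow>
      norm (zf_logderiv s - (\<Sum>a\<leftarrow>as. 1 / (s - a))) \<le> C * ln (\<bar>t0\<bar> + 2))"
proof -
  \<comment> \<open>Radius 7/4 around 2 + it keeps Re s >= 1/4. Radius 8/5 contains the points with
    1/2 < Re s <= 2 within height 1/4 of t, as (3/2)^2 + (1/4)^2 < (8/5)^2. Any value in between
    would do for the radius containing the listed zeros.\<close>
  have radii: "0 < (8/5::real)" "(8/5::real) < 17/10" "(17/10::real) < 7/4" by simp_all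
  obtain C where C: "0 < C" and fac: "\<forall>f S z0 M. f holomorphic_on S \<longrightarrow> open S \<longrightarrow> cball z0 (7/4) \<subseteq> S \<longrightarrow>
     f z0 \<noteq> 0 \<longrightarrow> (\<forall>z\<in>cball z0 (7/4). norm (f z) \<le> M) \<longrightarrow>
    (\<exists>as. set as \<subseteq> {a \<in> cball z0 (17/10). f a = 0} \<and> real (length as) \<le> C * (ln (M / norm (f z0)) + 1) \<and>
      (\<forall>z\<in>cball z0 (8/5). f z \<noteq> 0 \<longrightarrow> norm (deriv f z / f z - (\<Sum>a\<leftarrow>as. 1 / (z - a))) \<le>
         C * (ln (M / norm (f z0)) + 1)))"
    using local_factorisation[OF radii] by (elim exE conjE) (rule that)
  obtain c where c: "0 < c" "\<And>t. c \<le> norm (zf (Complex 2 t))" using norm_zf_lower by blast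
  obtain A where A: "0 < A" "\<And>s. 1/4 \<le> Re s \<Longrightarrow> norm (zf s) \<le> A * (1 + norm s)^2" using norm_zf_bound by blast
  \<comment> \<open>With u = |t0| + 2 the logarithm of the growth bound is ln (A/c) + 2 ln (u + 3),
    and u + 3 <= u^3 gives 6 ln u. The constant part is absorbed through ln 2 <= ln u.\<close>
  define K where "K = (\<bar>ln (A / c)\<bar> + 1) / ln 2 + 6"
  have ln2: "0 < ln (2::real)" by simp
  have K: "0 < K" unfolding K_def using ln2 by (simp add: add_nonneg_pos)
  have main: "\<exists>as. (\<forall>a\<in>set as. Re a = 1 / 2) \<and> real (length as) \<le> (C * K) * ln (\<bar>t0\<bar> + 2) \<and>
    (\<forall>s. 1/2 < Re s \<longrightarrow> Re s \<le> 2 \<longrightarrow> \<bar>Im s - t0\<bar> \<le> 1/4 \<longrightarrow>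
      norm (zf_logderiv s - (\<Sum>a\<leftarrow>as. 1 / (s - a))) \<le> (C * K) * ln (\<bar>t0\<bar> + 2))" for t0
  proof -
    define z0 where "z0 = Complex 2 t0"
    define M where "M = A * (5 + \<bar>t0\<bar>)^2"
    have near: "1/4 \<le> Re s" "norm s \<le> 4 + \<bar>t0\<bar>" if "s \<in> cball z0 (7/4)" for s
    proof -
      have d: "norm (z0 - s) \<le> 7/4" using that by (simp add: dist_norm)
      have "\<bar>Re (z0 - s)\<bar> \<le> 7/4" using d abs_Re_le_cmod[of "z0 - s"] by linarith
      thus "1/4 \<le> Re s" by (simp add: z0_def abs_if split: if_splits)
      have "norm z0 \<le> 2 + \<bar>t0\<bar>" using cmod_le[of z0] by (simp add: z0_def)
      moreover have "norm s \<le> norm z0 + norm (z0 - s)" using norm_triangle_sub[of s z0] by (simp add: norm_minus_commute)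
      ultimately show "norm s \<le> 4 + \<bar>t0\<bar>" using d by simp
    qed
    have Mb: "\<forall>z\<in>cball z0 (7/4). norm (zf z) \<le> M"
    proof
      fix s assume s: "s \<in> cball z0 (7/4)"
      have "norm (zf s) \<le> A * (1 + norm s)^2" using A(2) near(1)[OF s] .
      also have "\<dots> \<le> M" unfolding M_def using A(1) near(2)[OF s] by (intro mult_left_mono power_mono) auto
      finally show "norm (zf s) \<le> M" .
    qed
    have sub: "cball z0 (7/4) \<subseteq> {s. 0 < Re s}" using near(1) by force
    have z0: "zf z0 \<noteq> 0" using c(1) c(2)[of t0] unfolding z0_def by force
    obtain as where as: "set as \<subseteq> {a \<in> cball z0 (17/10). zf a = 0}"
      "real (length as) \<le> C * (ln (M / norm (zf z0)) + 1)"
      "\<And>s. s \<in> cball z0 (8/5) \<Longrightarrow> zf s \<noteq> 0 \<Longrightarrow> norm (deriv zf s / zf s - (\<Sum>a\<leftarrow>as. 1 / (s - a))) \<le> C * (ln (M / norm (zf z0)) + 1)"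
      using fac[rule_format, OF zf_holomorphic open_halfspace_Re_gt sub z0 bspec[OF Mb]] by blast
    have L: "ln (M / norm (zf z0)) + 1 \<le> K * ln (\<bar>t0\<bar> + 2)"
    proof -
      define u where "u = \<bar>t0\<bar> + 2"
      have u: "2 \<le> u" by (simp add: u_def)
      have M0: "0 < M" using A(1) by (auto simp: M_def)
      have "ln (M / norm (zf z0)) \<le> ln (M / c)"
        using c(1) c(2)[of t0] z0 M0 unfolding z0_def by (intro ln_mono frac_le) auto
      also have "M / c = (A / c) * (u + 3)^2" by (simp add: M_def u_def add.commute)
      also have "ln \<dots> = ln (A / c) + 2 * ln (u + 3)"
        using A(1) c(1) u by (subst ln_mult) (auto simp: ln_realpow)
      also have "ln (u + 3) \<le> ln (u ^ 3)"
      proof (rule ln_mono)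
        have "2 * 2 * u \<le> u * u * u" using u by (intro mult_mono) auto
        thus "u + 3 \<le> u ^ 3" using u unfolding power3_eq_cube by linarith
      qed (use u in auto)
      also have "ln (u ^ 3) = 3 * ln u" using u by (simp add: ln_realpow)
      finally have 1: "ln (M / norm (zf z0)) + 1 \<le> (\<bar>ln (A / c)\<bar> + 1) + 6 * ln u" by simp
      have "ln 2 \<le> ln u" using u by simp
      hence "(\<bar>ln (A / c)\<bar> + 1) / ln 2 * ln 2 \<le> (\<bar>ln (A / c)\<bar> + 1) / ln 2 * ln u"
        using ln2 by (intro mult_left_mono divide_nonneg_nonneg) auto
      hence "(\<bar>ln (A / c)\<bar> + 1) \<le> (\<bar>ln (A / c)\<bar> + 1) / ln 2 * ln u" using ln2 by simp
      with 1 have "ln (M / norm (zf z0)) + 1 \<le> K * ln u" unfolding K_def by (simp add: distrib_right)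
      thus ?thesis unfolding u_def .
    qed
    have CL: "C * (ln (M / norm (zf z0)) + 1) \<le> (C * K) * ln (\<bar>t0\<bar> + 2)"
      using mult_left_mono[OF L, of C] C by (simp add: mult.assoc)
    have "Re a = 1 / 2" if "a \<in> set as" for a
    proof (rule zeros)
      show "zf a = 0" using as(1) that by auto
      have "a \<in> cball z0 (7/4)" using as(1) that by auto
      thus "0 < Re a" using near(1) by force
    qed
    moreover have "norm (zf_logderiv s - (\<Sum>a\<leftarrow>as. 1 / (s - a))) \<le> (C * K) * ln (\<bar>t0\<bar> + 2)"
      if s: "1/2 < Re s" "Re s \<le> 2" "\<bar>Im s - t0\<bar> \<le> 1/4" for s
    proof -
      have "(norm (s - z0))^2 = (2 - Re s)^2 + \<bar>Im s - t0\<bar>^2"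
        by (simp add: cmod_power2 z0_def power2_commute)
      also have "\<dots> \<le> (3/2)^2 + (1/4)^2" using s by (intro add_mono power_mono) auto
      also have "\<dots> \<le> (8/5)^2" by (simp add: power2_eq_square)
      finally have "norm (s - z0) \<le> 8/5" by (rule power2_le_imp_le) simp
      hence "s \<in> cball z0 (8/5)" by (simp add: dist_norm norm_minus_commute)
      moreover have "zf s \<noteq> 0" using zeros[of s] s by auto
      ultimately show ?thesis using as(3)[of s] CL unfolding zf_logderiv_def by linarith
    qed
    ultimately show ?thesis using as(2) CL by (intro exI[of _ as] conjI ballI allI impI) auto
  qed
  show ?thesis using C K main by (intro exI[of _ "C * K"]) auto
qed

lemma norm_sum_list_inverse_le:
  assumes "\<And>a. a \<in> set as \<Longrightarrow> norm (1 / (s - a)) \<le> B a"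
  shows "norm (\<Sum>a\<leftarrow>as. 1 / (s - a)) \<le> (\<Sum>a\<leftarrow>as. B a)"
  using assms
proof (induction as)
  case (Cons a as)
  have "norm (1 / (s - a) + (\<Sum>a\<leftarrow>as. 1 / (s - a))) \<le> norm (1 / (s - a)) + norm (\<Sum>a\<leftarrow>as. 1 / (s - a))"
    by (rule norm_triangle_ineq)
  also have "\<dots> \<le> B a + (\<Sum>a\<leftarrow>as. B a)" using Cons by (intro add_mono) auto
  finally show ?case by simp
qed simp

text \<open>Every listed zero lies on Re s = 1/2, so |s - a| >= Re s - 1/2. This crude bound serves
  only to justify the shift of the contour, where the dependence on Re s - 1/2 does not enter the
  result.\<close>

lemma zf_logderiv_pointwise:
  assumes zeros: "\<And>s. 0 < Re s \<Longrightarrow> zf s = 0 \<Longrightarrow> Re s = 1 / 2"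
  shows "\<exists>C>0. \<forall>s. 1/2 < Re s \<longrightarrow> Re s \<le> 2 \<longrightarrow> norm (zf_logderiv s) \<le> C * ln (\<bar>Im s\<bar> + 2) / (Re s - 1/2)"
proof -
  obtain C where C: "0 < C" and loc: "\<And>t0. \<exists>as. (\<forall>a\<in>set as. Re a = 1 / 2) \<and> real (length as) \<le> C * ln (\<bar>t0\<bar> + 2) \<and>
    (\<forall>s. 1/2 < Re s \<longrightarrow> Re s \<le> 2 \<longrightarrow> \<bar>Im s - t0\<bar> \<le> 1/4 \<longrightarrow>
      norm (zf_logderiv s - (\<Sum>a\<leftarrow>as. 1 / (s - a))) \<le> C * ln (\<bar>t0\<bar> + 2))"
    using zf_logderiv_local[OF zeros] by blast
  have "norm (zf_logderiv s) \<le> (3 * C) * ln (\<bar>Im s\<bar> + 2) / (Re s - 1/2)" if s: "1/2 < Re s" "Re s \<le> 2" for s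
  proof -
    define e where "e = Re s - 1/2"
    have e: "0 < e" "e \<le> 3/2" using s by (auto simp: e_def)
    define l where "l = C * ln (\<bar>Im s\<bar> + 2)"
    have l: "0 \<le> l" unfolding l_def using C by simp
    obtain as where as: "\<And>a. a \<in> set as \<Longrightarrow> Re a = 1 / 2" "real (length as) \<le> l"
      and loc_s: "\<And>s'. 1/2 < Re s' \<Longrightarrow> Re s' \<le> 2 \<Longrightarrow> \<bar>Im s' - Im s\<bar> \<le> 1/4 \<Longrightarrow>
        norm (zf_logderiv s' - (\<Sum>a\<leftarrow>as. 1 / (s' - a))) \<le> l"
      using loc[of "Im s"] unfolding l_def by blast
    let ?S = "\<Sum>a\<leftarrow>as. 1 / (s - a)"
    have as3: "norm (zf_logderiv s - ?S) \<le> l" using loc_s s by simp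
    have "norm (1 / (s - a)) \<le> 1 / e" if "a \<in> set as" for a
    proof -
      have "e \<le> norm (s - a)" using abs_Re_le_cmod[of "s - a"] as(1)[OF that] unfolding e_def by simp
      thus ?thesis using e by (simp add: norm_divide frac_le)
    qed
    hence "norm ?S \<le> (\<Sum>a\<leftarrow>as. 1 / e)" by (rule norm_sum_list_inverse_le)
    also have "\<dots> = real (length as) / e" by (simp add: sum_list_triv)
    also have "\<dots> \<le> l / e" using as(2) e by (intro divide_right_mono) auto
    finally have 1: "norm ?S \<le> l / e" .
    have "l * e \<le> l * (3/2)" using l e by (intro mult_left_mono) auto
    hence "l \<le> 2 * l / e" using e l by (simp add: field_simps)
    moreover have "3 * l / e = l / e + 2 * l / e" by (simp add: add_divide_distrib[symmetric])
    moreover have "norm (zf_logderiv s) \<le> norm (zf_logderiv s - ?S) + norm ?S"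
      by (metis diff_add_cancel norm_triangle_ineq)
    ultimately have "norm (zf_logderiv s) \<le> 3 * l / e" using 1 as3 by linarith
    thus ?thesis unfolding l_def e_def by simp
  qed
  thus ?thesis using C by (intro exI[of _ "3 * C"]) auto
qed

lemma borel_measurable_sum_list:
  fixes f :: "'b \<Rightarrow> 'a \<Rightarrow> ennreal"
  assumes "\<And>a. a \<in> set as \<Longrightarrow> f a \<in> borel_measurable M"
  shows "(\<lambda>x. \<Sum>a\<leftarrow>as. f a x) \<in> borel_measurable M"
  using assms by (induction as) (auto intro!: borel_measurable_add)

lemma nn_integral_sum_list_le:
  assumes m: "\<And>a. a \<in> set as \<Longrightarrow> f a \<in> borel_measurable M"
    and b: "\<And>a. a \<in> set as \<Longrightarrow> (\<integral>\<^sup>+x. f a x \<partial>M) \<le> B"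
  shows "(\<integral>\<^sup>+x. (\<Sum>a\<leftarrow>as. f a x) \<partial>M) \<le> of_nat (length as) * B"
  using assms
proof (induction as)
  case (Cons a as)
  have "(\<lambda>x. \<Sum>a\<leftarrow>as. f a x) \<in> borel_measurable M"
    using Cons.prems(1) by (intro borel_measurable_sum_list) auto
  hence "(\<integral>\<^sup>+x. (\<Sum>a\<leftarrow>a # as. f a x) \<partial>M) = (\<integral>\<^sup>+x. f a x \<partial>M) + (\<integral>\<^sup>+x. (\<Sum>a\<leftarrow>as. f a x) \<partial>M)"
    using Cons.prems(1) by (simp add: nn_integral_add)
  also have "\<dots> \<le> B + of_nat (length as) * B" using Cons by (intro add_mono) auto
  finally show ?case by (simp add: distrib_right)
qed simp

lemma zf_logderiv_integral:
  assumes zeros: "\<And>s. 0 < Re s \<Longrightarrow> zf s = 0 \<Longrightarrow> Re s = 1 / 2"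
  shows "\<exists>C>0. \<forall>t0 e. 0 < e \<longrightarrow> e \<le> 1 \<longrightarrow>
    (\<integral>\<^sup>+t. ennreal (norm (zf_logderiv (Complex (1/2 + e) t))) * indicator {t0 - 1/4..t0 + 1/4} t \<partial>lborel)
      \<le> ennreal (C * ln (\<bar>t0\<bar> + 2) / sqrt e)"
proof -
  obtain C where C: "0 < C" and loc: "\<And>t0. \<exists>as. (\<forall>a\<in>set as. Re a = 1 / 2) \<and> real (length as) \<le> C * ln (\<bar>t0\<bar> + 2) \<and>
    (\<forall>s. 1/2 < Re s \<longrightarrow> Re s \<le> 2 \<longrightarrow> \<bar>Im s - t0\<bar> \<le> 1/4 \<longrightarrow>
      norm (zf_logderiv s - (\<Sum>a\<leftarrow>as. 1 / (s - a))) \<le> C * ln (\<bar>t0\<bar> + 2))"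
    using zf_logderiv_local[OF zeros] by blast
  have main: "(\<integral>\<^sup>+t. ennreal (norm (zf_logderiv (Complex (1/2 + e) t))) * indicator {t0 - 1/4..t0 + 1/4} t \<partial>lborel)
      \<le> ennreal ((6 * C) * ln (\<bar>t0\<bar> + 2) / sqrt e)" if e: "0 < e" "e \<le> 1" for t0 e
  proof -
    define l where "l = C * ln (\<bar>t0\<bar> + 2)"
    have l: "0 \<le> l" unfolding l_def using C by simp
    let ?J = "{t0 - 1/4..t0 + 1/4}"
    obtain as where as: "\<And>a. a \<in> set as \<Longrightarrow> Re a = 1 / 2" "real (length as) \<le> l"
      "\<And>s. 1/2 < Re s \<Longrightarrow> Re s \<le> 2 \<Longrightarrow> \<bar>Im s - t0\<bar> \<le> 1/4 \<Longrightarrow>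
      norm (zf_logderiv s - (\<Sum>a\<leftarrow>as. 1 / (s - a))) \<le> l"
      using loc[of t0] unfolding l_def by blast
    define w where "w a t = (e / (e^2 + (t - Im a)^2)) / (2 * sqrt e)" for a t
    have w0: "0 \<le> w a t" for a t unfolding w_def using e by (intro divide_nonneg_nonneg) auto
    have wb: "norm (1 / (Complex (1/2 + e) t - a)) \<le> w a t + 1 / (2 * sqrt e)" if "a \<in> set as" for a t
    proof -
      define n where "n = norm (Complex (1/2 + e) t - a)"
      have n2: "n^2 = e^2 + (t - Im a)^2" unfolding n_def cmod_power2 by (simp add: as(1)[OF that])
      have "0 < n^2" unfolding n2 using e by (simp add: add_pos_nonneg)
      hence n: "0 < n" by (simp add: n_def)
      have q: "sqrt e * sqrt e = e" "0 < sqrt e" using e by auto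
      \<comment> \<open>AM-GM with the weight that balances the two halves: the Cauchy density e/n^2
        and the constant 1 both have integral O(1) over the window, and both carry the factor 1 / (2
        sqrt e).\<close>
      have "0 \<le> (n - sqrt e)^2" by simp
      hence "2 * (n * sqrt e) \<le> n^2 + e" using q by (simp add: power2_eq_square algebra_simps)
      hence "1 / n \<le> (e / n^2 + 1) / (2 * sqrt e)"
        using n q by (simp add: field_simps power2_eq_square)
      thus ?thesis unfolding w_def n2[symmetric] by (simp add: norm_divide n_def add_divide_distrib)
    qed
    have pt: "ennreal (norm (zf_logderiv (Complex (1/2 + e) t))) * indicator ?J t \<le>
       (\<Sum>a\<leftarrow>as. ennreal (w a t)) + ennreal (2 * l / sqrt e) * indicator ?J t" for t
    proof (cases "t \<in> ?J")
      case True
      let ?s = "Complex (1/2 + e) t"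
      let ?S = "\<Sum>a\<leftarrow>as. 1 / (?s - a)"
      have "norm (zf_logderiv ?s - ?S) \<le> l" using True e by (intro as(3)) (auto simp: abs_if)
      moreover have "norm ?S \<le> (\<Sum>a\<leftarrow>as. w a t + 1 / (2 * sqrt e))"
        by (rule norm_sum_list_inverse_le) (rule wb)
      moreover have "(\<Sum>a\<leftarrow>as. w a t + 1 / (2 * sqrt e)) = (\<Sum>a\<leftarrow>as. w a t) + real (length as) * (1 / (2 * sqrt e))"
        by (simp add: sum_list_addf sum_list_triv)
      moreover have "real (length as) * (1 / (2 * sqrt e)) \<le> l * (1 / (2 * sqrt e))"
        using as(2) e by (intro mult_right_mono) auto
      moreover have "l \<le> l / sqrt e"
        using l e by (simp add: le_divide_eq mult_left_le)
      moreover have "l * (1 / (2 * sqrt e)) \<le> l / sqrt e" using l e by (simp add: field_simps)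
      moreover have "norm (zf_logderiv ?s) \<le> norm (zf_logderiv ?s - ?S) + norm ?S"
        by (metis diff_add_cancel norm_triangle_ineq)
      ultimately have "norm (zf_logderiv ?s) \<le> (\<Sum>a\<leftarrow>as. w a t) + 2 * l / sqrt e" by simp
      hence "ennreal (norm (zf_logderiv ?s)) \<le> ennreal ((\<Sum>a\<leftarrow>as. w a t) + 2 * l / sqrt e)" by (rule ennreal_leI)
      also have "\<dots> = ennreal (\<Sum>a\<leftarrow>as. w a t) + ennreal (2 * l / sqrt e)"
        using l e w0 by (intro ennreal_plus) (auto intro!: sum_list_nonneg)
      also have "ennreal (\<Sum>a\<leftarrow>as. w a t) = (\<Sum>a\<leftarrow>as. ennreal (w a t))"
      proof (induction as)
        case (Cons a as)
        have "0 \<le> (\<Sum>a\<leftarrow>as. w a t)" using w0 by (auto intro!: sum_list_nonneg)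
        thus ?case using Cons w0 by (simp add: ennreal_plus)
      qed simp
      finally show ?thesis using True by simp
    qed auto
    have mw: "(\<lambda>t. ennreal (w a t)) \<in> borel_measurable lborel" for a unfolding w_def by measurable
    have mws: "(\<lambda>t. \<Sum>a\<leftarrow>as. ennreal (w a t)) \<in> borel_measurable lborel"
      by (intro borel_measurable_sum_list mw)
    have wi: "(\<integral>\<^sup>+t. ennreal (w a t) \<partial>lborel) \<le> ennreal (2 / sqrt e)" for a
    proof -
      have "(\<integral>\<^sup>+t. ennreal (w a t) \<partial>lborel) = (\<integral>\<^sup>+t. ennreal (1 / (2 * sqrt e)) * ennreal (e / (e^2 + (t - Im a)^2)) \<partial>lborel)"
        unfolding w_def using e by (intro nn_integral_cong) (subst ennreal_mult[symmetric], auto)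
      also have "\<dots> = ennreal (1 / (2 * sqrt e)) * (\<integral>\<^sup>+t. ennreal (e / (e^2 + (t - Im a)^2)) \<partial>lborel)"
        by (intro nn_integral_cmult) measurable
      also have "\<dots> \<le> ennreal (1 / (2 * sqrt e)) * ennreal pi"
        by (intro mult_left_mono Cauchy_density_nn_integral e) auto
      also have "\<dots> = ennreal (1 / (2 * sqrt e) * pi)" using e by (subst ennreal_mult) auto
      also have "\<dots> \<le> ennreal (2 / sqrt e)"
        using e pi_less_4 by (intro ennreal_leI) (simp add: field_simps)
      finally show ?thesis .
    qed
    have "(\<integral>\<^sup>+t. ennreal (norm (zf_logderiv (Complex (1/2 + e) t))) * indicator ?J t \<partial>lborel) \<le>
      (\<integral>\<^sup>+t. (\<Sum>a\<leftarrow>as. ennreal (w a t)) + ennreal (2 * l / sqrt e) * indicator ?J t \<partial>lborel)"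
      by (intro nn_integral_mono pt)
    also have "\<dots> = (\<integral>\<^sup>+t. (\<Sum>a\<leftarrow>as. ennreal (w a t)) \<partial>lborel) + (\<integral>\<^sup>+t. ennreal (2 * l / sqrt e) * indicator ?J t \<partial>lborel)"
      by (intro nn_integral_add mws) auto
    also have "(\<integral>\<^sup>+t. ennreal (2 * l / sqrt e) * indicator ?J t \<partial>lborel) = ennreal (2 * l / sqrt e) * ennreal (1/2)"
      by (subst nn_integral_cmult_indicator) (auto simp: emeasure_lborel_Icc_eq)
    also have "(\<integral>\<^sup>+t. (\<Sum>a\<leftarrow>as. ennreal (w a t)) \<partial>lborel) \<le> of_nat (length as) * ennreal (2 / sqrt e)"
      by (intro nn_integral_sum_list_le mw wi)
    also have "of_nat (length as) * ennreal (2 / sqrt e) + ennreal (2 * l / sqrt e) * ennreal (1/2) =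
        ennreal (real (length as) * (2 / sqrt e) + 2 * l / sqrt e * (1/2))"
    proof -
      have e1: "of_nat (length as) * ennreal (2 / sqrt e) = ennreal (real (length as) * (2 / sqrt e))"
        unfolding ennreal_of_nat_eq_real_of_nat using e by (intro ennreal_mult[symmetric]) auto
      have e2: "ennreal (2 * l / sqrt e) * ennreal (1/2) = ennreal (2 * l / sqrt e * (1/2))"
        using l e by (intro ennreal_mult[symmetric]) auto
      show ?thesis unfolding e1 e2 using l e by (intro ennreal_plus[symmetric]) auto
    qed
    also have "\<dots> \<le> ennreal (6 * l / sqrt e)"
    proof (rule ennreal_leI)
      have "real (length as) * (2 / sqrt e) \<le> l * (2 / sqrt e)" using as(2) e by (intro mult_right_mono) auto
      moreover have "0 \<le> l / sqrt e" using l e by simp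
      ultimately show "real (length as) * (2 / sqrt e) + 2 * l / sqrt e * (1/2) \<le> 6 * l / sqrt e" by simp
    qed
    finally show ?thesis unfolding l_def by (simp add: add_right_mono mult.assoc)
  qed
  show ?thesis using C main by (intro exI[of _ "6 * C"]) auto
qed

section \<open>Integrals along vertical lines\<close>

lemma integrable_one_plus_abs_powr:
  fixes e :: real
  assumes e: "0 < e"
  shows "integrable lborel (\<lambda>t. (1 + \<bar>t\<bar>) powr (-1 - e))"
proof -
  let ?l = "\<lambda>t::real. ennreal ((1 + \<bar>t\<bar>) powr (-1 - e)) * indicator {0..} t"
  let ?r = "\<lambda>t::real. ennreal ((1 + \<bar>-t\<bar>) powr (-1 - e)) * indicator {0..} (-t)" and ?I = "\<integral>\<^sup>+t. ?l t \<partial>lborel"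
  have half: "?I = 1 / e"
  proof -
    have "?I = ennreal (0 - (- ((1 + 0) powr (-e)) / e))"
    proof (rule nn_integral_FTC_atLeast)
      show "((\<lambda>t. - ((1 + t) powr (-e)) / e) \<longlongrightarrow> 0) at_top" using e by real_asymp
      fix x :: real assume x: "0 \<le> x"
      have "((\<lambda>t. - ((1 + t) powr (-e)) / e) has_real_derivative (1 + x) powr (-e - 1)) (at x)"
        using x e by (auto intro!: derivative_eq_intros)
      thus "((\<lambda>t. - ((1 + t) powr (-e)) / e) has_real_derivative (1 + \<bar>x\<bar>) powr (-1 - e)) (at x)"
        by (simp only: abs_of_nonneg[OF x] minus_diff_commute[of 1 e])
    qed auto
    thus ?thesis by simp
  qed
  have "(\<integral>\<^sup>+t. ennreal ((1 + \<bar>t\<bar>) powr (-1 - e)) \<partial>lborel) \<le>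
     (\<integral>\<^sup>+t. ?l t +
            ?r t \<partial>lborel)"
    by (intro nn_integral_mono) (auto simp: indicator_def)
  also have "\<dots> = ?I +
      (\<integral>\<^sup>+t. ?r t \<partial>lborel)"
    by (intro nn_integral_add) auto
  also have "(\<integral>\<^sup>+t. ?r t \<partial>lborel) =
     ?I"
    by (subst (2) nn_integral_real_affine[where c = "-1" and t = 0]) auto
  finally have "(\<integral>\<^sup>+t. ennreal ((1 + \<bar>t\<bar>) powr (-1 - e)) \<partial>lborel) \<le> ennreal (1 / e) + ennreal (1 / e)"
    unfolding half by simp
  hence "(\<integral>\<^sup>+t. ennreal ((1 + \<bar>t\<bar>) powr (-1 - e)) \<partial>lborel) < \<infinity>"
    by (simp add: order_le_less_trans)
  thus ?thesis by (intro integrableI_nonneg) auto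
qed

lemma has_contour_integral_rectpath_split:
  assumes f: "continuous_on (path_image (rectpath (Complex a (-T)) (Complex b T))) f"
    and I: "(f has_contour_integral I) (rectpath (Complex a (-T)) (Complex b T))"
    and T: "0 < T"
  shows "I = contour_integral (linepath (Complex a (-T)) (Complex b (-T))) f
    + \<i> * integral {-T..T} (\<lambda>t. f (Complex b t))
    - contour_integral (linepath (Complex a T) (Complex b T)) f
    - \<i> * integral {-T..T} (\<lambda>t. f (Complex a t))"
proof -
  let ?A = "Complex a (-T)" and ?B = "Complex b (-T)" and ?C = "Complex b T" and ?D = "Complex a T"
  have path: "rectpath ?A ?C = linepath ?A ?B +++ linepath ?B ?C +++ linepath ?C ?D +++ linepath ?D ?A"
    by (simp add: rectpath_def Let_def)
  have sub: "closed_segment ?A ?B \<subseteq> path_image (rectpath ?A ?C)"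
    "closed_segment ?B ?C \<subseteq> path_image (rectpath ?A ?C)"
    "closed_segment ?C ?D \<subseteq> path_image (rectpath ?A ?C)"
    "closed_segment ?D ?A \<subseteq> path_image (rectpath ?A ?C)"
    unfolding path by (auto simp: path_image_join)
  have int: "f contour_integrable_on linepath ?A ?B" "f contour_integrable_on linepath ?B ?C"
    "f contour_integrable_on linepath ?C ?D" "f contour_integrable_on linepath ?D ?A"
    by (intro contour_integrable_continuous_linepath continuous_on_subset[OF f] sub)+
  have "I = contour_integral (linepath ?A ?B) f + contour_integral (linepath ?B ?C) f
     + contour_integral (linepath ?C ?D) f + contour_integral (linepath ?D ?A) f"
    using contour_integral_unique[OF I] int unfolding path
    by (simp add: contour_integrable_join add.assoc)
  moreover have rev: "contour_integral (linepath ?C ?D) f = - contour_integral (linepath ?D ?C) f"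
    "contour_integral (linepath ?D ?A) f = - contour_integral (linepath ?A ?D) f"
    by (intro contour_integral_reverse_linepath continuous_on_subset[OF f] sub)+
  moreover have vert: "contour_integral (linepath (Complex c (-T)) (Complex c T)) f = \<i> * integral {-T..T} (\<lambda>t. f (Complex c t))"
    if "f contour_integrable_on linepath (Complex c (-T)) (Complex c T)" for c
  proof -
    have "((\<lambda>t. f (Complex c t)) has_integral (-\<i> * contour_integral (linepath (Complex c (-T)) (Complex c T)) f)) {-T..T}"
      using has_contour_integral_integral[OF that] T
      by (subst (asm) has_contour_integral_linepath_same_Re_iff) auto
    thus ?thesis by (simp add: integral_unique)
  qed
  moreover have "f contour_integrable_on linepath ?A ?D"
    using contour_integrable_reversepath[OF _ int(4)] by simp
  ultimately show ?thesis using int(2) by simp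
qed

text \<open>The integration is in dt rather than ds / (2 pi i), so a residue appears multiplied by 2
  pi. As a Bochner integral it is 0 when the integrand is not integrable.\<close>

definition vline_integral :: "real \<Rightarrow> (complex \<Rightarrow> complex) \<Rightarrow> complex" where
  "vline_integral c q = (\<integral>t. q (Complex c t) \<partial>lborel)"

lemma vline_integrable:
  fixes q :: "complex \<Rightarrow> complex"
  assumes "continuous_on {s. Re s = c} q" and e: "0 < e"
    and b: "\<And>t. norm (q (Complex c t)) \<le> B * (1 + \<bar>t\<bar>) powr (-1 - e)"
  shows "integrable lborel (\<lambda>t. q (Complex c t))"
proof (rule Bochner_Integration.integrable_bound[where f = "\<lambda>t. B * (1 + \<bar>t\<bar>) powr (-1 - e)"])
  show "integrable lborel (\<lambda>t. B * (1 + \<bar>t\<bar>) powr (-1 - e))"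
    by (intro integrable_mult_right integrable_one_plus_abs_powr[OF e])
  have "continuous_on UNIV (\<lambda>t. q (Complex c t))"
    by (intro continuous_on_compose2[OF assms(1)] continuous_intros) (auto simp: Complex_eq intro!: continuous_intros)
  thus "(\<lambda>t. q (Complex c t)) \<in> borel_measurable lborel"
    by (simp add: borel_measurable_continuous_onI)
  show "AE t in lborel. norm (q (Complex c t)) \<le> norm (B * (1 + \<bar>t\<bar>) powr (-1 - e))"
    using b by (auto intro: order_trans[OF _ abs_ge_self])
qed

lemma tendsto_integral_symmetric:
  fixes f :: "real \<Rightarrow> complex"
  assumes f: "integrable lborel f"
  shows "(\<lambda>n. integral {- real n..real n} f) \<longlonglongrightarrow> (\<integral>t. f t \<partial>lborel)"
proof -
  let ?F = "\<lambda>n t. indicator {- real n..real n} t *\<^sub>R f t"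
  have "integral {- real n..real n} f = (\<integral>t. ?F n t \<partial>lborel)" for n
  proof -
    have "set_integrable lborel {- real n..real n} f"
      unfolding set_integrable_def by (rule integrable_mult_indicator[OF _ f]) auto
    from set_borel_integral_eq_integral(2)[OF this] show ?thesis by (simp add: set_lebesgue_integral_def)
  qed
  moreover have "(\<lambda>n. \<integral>t. ?F n t \<partial>lborel) \<longlonglongrightarrow> (\<integral>t. f t \<partial>lborel)"
  proof (rule integral_dominated_convergence)
    show "integrable lborel (\<lambda>t. norm (f t))" using f by (rule integrable_norm)
    show "f \<in> borel_measurable lborel" using f by (rule borel_measurable_integrable)
    show "(\<lambda>t. ?F n t) \<in> borel_measurable lborel" for n
      using borel_measurable_integrable[OF f] by (intro borel_measurable_scaleR borel_measurable_indicator) auto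
    show "AE t in lborel. (\<lambda>n. ?F n t) \<longlonglongrightarrow> f t"
    proof (intro AE_I2)
      fix t :: real
      have "eventually (\<lambda>n. \<bar>t\<bar> \<le> real n) sequentially"
        using eventually_ge_at_top[of "nat \<lceil>\<bar>t\<bar>\<rceil>"] by eventually_elim linarith
      hence "eventually (\<lambda>n. ?F n t = f t) sequentially"
        by eventually_elim (auto simp: indicator_def abs_le_iff)
      thus "(\<lambda>n. ?F n t) \<longlonglongrightarrow> f t" by (rule tendsto_eventually)
    qed
    show "AE t in lborel. norm (?F n t) \<le> norm (f t)" for n
      by (auto simp: indicator_def)
  qed
  ultimately show ?thesis by simp
qed

text \<open>Cauchy's formula on rectangles of height tending to infinity. Decay of \<phi> like
  |t|^(-1/2) makes \<phi>(s)/(s - p) of order |t|^(-3/2), which is integrable on the vertical sides.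
  Boundedness of \<phi> already sends the horizontal sides to 0.\<close>

lemma vline_integral_Cauchy:
  assumes hol: "\<phi> holomorphic_on {s. a \<le> Re s \<and> Re s \<le> b}"
    and p: "a < Re p" "Re p < b"
    and bd: "\<And>s. a \<le> Re s \<Longrightarrow> Re s \<le> b \<Longrightarrow> norm (\<phi> s) \<le> B * (1 + \<bar>Im s\<bar>) powr (-1/2)"
  shows "vline_integral b (\<lambda>s. \<phi> s / (s - p)) - vline_integral a (\<lambda>s. \<phi> s / (s - p)) = complex_of_real (2 * pi) * \<phi> p"
    and "integrable lborel (\<lambda>t. \<phi> (Complex a t) / (Complex a t - p))"
    and "integrable lborel (\<lambda>t. \<phi> (Complex b t) / (Complex b t - p))"
proof -
  let ?S = "{s. a \<le> Re s \<and> Re s \<le> b}"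
  let ?q = "\<lambda>s. \<phi> s / (s - p)"
  have S: "?S = {s. a \<le> Re s} \<inter> {s. Re s \<le> b}" by auto
  have conv: "convex ?S" unfolding S by (intro convex_Int convex_halfspace_Re_ge convex_halfspace_Re_le)
  have int: "p \<in> interior ?S"
  proof (rule interiorI)
    show "open ({s. a < Re s} \<inter> {s. Re s < b})" by (intro open_Int open_halfspace_Re_gt open_halfspace_Re_lt)
  qed (use p in auto)
  have cont: "continuous_on (?S - {p}) ?q"
    by (intro continuous_intros continuous_on_subset[OF holomorphic_on_imp_continuous_on[OF hol]]) auto
  have B0: "0 \<le> B"
  proof -
    have "0 \<le> B * (1 + \<bar>Im p\<bar>) powr (-1/2)" using bd[of p] p norm_ge_zero[of "\<phi> p"] by linarith
    moreover have "0 < (1 + \<bar>Im p\<bar>) powr (-1/2)" by (simp add: add_pos_nonneg)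
    ultimately show ?thesis by (simp add: zero_le_mult_iff)
  qed
  have line: "integrable lborel (\<lambda>t. ?q (Complex c t))" if c: "a \<le> c" "c \<le> b" "c \<noteq> Re p" for c
  proof -
    define d where "d = \<bar>c - Re p\<bar>"
    have d: "0 < d" using c by (simp add: d_def)
    have low: "1 + \<bar>t\<bar> \<le> (1 + (1 + \<bar>Im p\<bar>) / d) * norm (Complex c t - p)" for t
    proof -
      have 1: "d \<le> norm (Complex c t - p)" unfolding d_def using abs_Re_le_cmod[of "Complex c t - p"] by simp
      have 2: "\<bar>t\<bar> \<le> norm (Complex c t - p) + \<bar>Im p\<bar>" using abs_Im_le_cmod[of "Complex c t - p"] by simp
      have "1 + \<bar>Im p\<bar> \<le> (1 + \<bar>Im p\<bar>) / d * norm (Complex c t - p)"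
        using mult_left_mono[OF 1, of "(1 + \<bar>Im p\<bar>) / d"] d by simp
      thus ?thesis using 2 by (simp add: distrib_right)
    qed
    show ?thesis
    proof (rule vline_integrable[where e = "1/2" and B = "B * (1 + (1 + \<bar>Im p\<bar>) / d)"])
      show "continuous_on {s. Re s = c} ?q" by (rule continuous_on_subset[OF cont]) (use c in auto)
      fix t :: real
      have pos: "0 < norm (Complex c t - p)" using c by (auto simp: complex_eq_iff)
      have pw: "(1 + \<bar>t\<bar>) powr (-1 - 1/2) = (1 + \<bar>t\<bar>) powr (-1/2) / (1 + \<bar>t\<bar>)"
        using powr_diff[of "1 + \<bar>t\<bar>" "-1/2" 1] by (simp add: powr_one)
      have "norm (?q (Complex c t)) = norm (\<phi> (Complex c t)) / norm (Complex c t - p)" by (simp add: norm_divide)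
      also have "\<dots> \<le> B * (1 + \<bar>t\<bar>) powr (-1/2) / norm (Complex c t - p)"
        using bd[of "Complex c t"] c by (intro divide_right_mono) auto
      also have "\<dots> \<le> B * (1 + \<bar>t\<bar>) powr (-1/2) * ((1 + (1 + \<bar>Im p\<bar>) / d) / (1 + \<bar>t\<bar>))"
        unfolding divide_inverse[of "B * (1 + \<bar>t\<bar>) powr (-1/2)"]
        using low[of t] pos B0 by (intro mult_left_mono) (auto simp: field_simps)
      finally show "norm (?q (Complex c t)) \<le> B * (1 + (1 + \<bar>Im p\<bar>) / d) * (1 + \<bar>t\<bar>) powr (-1 - 1/2)"
        unfolding pw by (simp add: mult_ac)
    qed simp
  qed
  show inta: "integrable lborel (\<lambda>t. ?q (Complex a t))" and intb: "integrable lborel (\<lambda>t. ?q (Complex b t))"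
    using line p by auto
  define hor where "hor T = contour_integral (linepath (Complex a T) (Complex b T)) ?q" for T
  have horb: "norm (hor T) \<le> B / (\<bar>T\<bar> - \<bar>Im p\<bar>) * (b - a)" if T: "\<bar>Im p\<bar> < \<bar>T\<bar>" for T
  proof -
    have seg: "a \<le> Re s \<and> Re s \<le> b \<and> Im s = T" if "s \<in> closed_segment (Complex a T) (Complex b T)" for s
      using that p by (auto simp: closed_segment_same_Im closed_segment_eq_real_ivl)
    have "norm (hor T) \<le> B / (\<bar>T\<bar> - \<bar>Im p\<bar>) * norm (Complex b T - Complex a T)"
      unfolding hor_def
    proof (rule contour_integral_bound_linepath)
      show "?q contour_integrable_on linepath (Complex a T) (Complex b T)"
        by (intro contour_integrable_continuous_linepath continuous_on_subset[OF cont]) (use seg T in force)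
      show "0 \<le> B / (\<bar>T\<bar> - \<bar>Im p\<bar>)" using B0 T by simp
      fix s assume s: "s \<in> closed_segment (Complex a T) (Complex b T)"
      have "norm (\<phi> s) \<le> B * (1 + \<bar>Im s\<bar>) powr (-1/2)" using bd seg[OF s] by auto
      also have "\<dots> \<le> B * 1" using B0 powr_mono[of "-1/2" 0 "1 + \<bar>Im s\<bar>"]
        by (intro mult_left_mono) (auto split: if_splits)
      finally have "norm (\<phi> s) \<le> B" by simp
      moreover have "\<bar>T\<bar> - \<bar>Im p\<bar> \<le> norm (s - p)"
        using abs_Im_le_cmod[of "s - p"] seg[OF s] by simp
      ultimately show "norm (?q s) \<le> B / (\<bar>T\<bar> - \<bar>Im p\<bar>)"
        unfolding norm_divide using T B0 by (intro frac_le) auto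
    qed
    moreover have "norm (Complex b T - Complex a T) = b - a" using p by (simp add: cmod_def)
    ultimately show ?thesis by simp
  qed
  have hor0: "(\<lambda>n. hor (real n)) \<longlonglongrightarrow> 0" "(\<lambda>n. hor (- real n)) \<longlonglongrightarrow> 0"
  proof -
    have lim: "(\<lambda>n. B / (real n - \<bar>Im p\<bar>) * (b - a)) \<longlonglongrightarrow> 0" by real_asymp
    have ev: "eventually (\<lambda>n. \<bar>Im p\<bar> < real n) sequentially"
      using eventually_gt_at_top[of "nat \<lceil>\<bar>Im p\<bar>\<rceil>"] by eventually_elim linarith
    show "(\<lambda>n. hor (real n)) \<longlonglongrightarrow> 0"
    proof (rule Lim_null_comparison[OF eventually_mono[OF ev] lim])
      show "norm (hor (real n)) \<le> B / (real n - \<bar>Im p\<bar>) * (b - a)" if "\<bar>Im p\<bar> < real n" for n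
        using horb[of "real n"] that by simp
    qed
    show "(\<lambda>n. hor (- real n)) \<longlonglongrightarrow> 0"
    proof (rule Lim_null_comparison[OF eventually_mono[OF ev] lim])
      show "norm (hor (- real n)) \<le> B / (real n - \<bar>Im p\<bar>) * (b - a)" if "\<bar>Im p\<bar> < real n" for n
        using horb[of "- real n"] that by simp
    qed
  qed
  let ?R = "\<lambda>n. hor (- real n) + \<i> * integral {- real n..real n} (\<lambda>t. ?q (Complex b t))
     - hor (real n) - \<i> * integral {- real n..real n} (\<lambda>t. ?q (Complex a t))"
  have rect: "2 * pi * \<i> * \<phi> p = ?R n" if n: "\<bar>Im p\<bar> < real n" for n
  proof -
    let ?A = "Complex a (- real n)" and ?C = "Complex b (real n)"
    have pb: "p \<in> box ?A ?C" using p n by (auto simp: in_box_complex_iff)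
    have le: "Re ?A \<le> Re ?C" "Im ?A \<le> Im ?C" using p by auto
    have im: "path_image (rectpath ?A ?C) \<subseteq> ?S - {p}"
    proof
      fix s assume "s \<in> path_image (rectpath ?A ?C)"
      hence "s \<in> cbox ?A ?C - box ?A ?C" using path_image_rectpath_cbox_minus_box[OF le] by blast
      thus "s \<in> ?S - {p}" using pb unfolding Diff_iff in_cbox_complex_iff by fastforce
    qed
    have "(?q has_contour_integral (2 * pi * \<i> * winding_number (rectpath ?A ?C) p * \<phi> p)) (rectpath ?A ?C)"
      by (rule Cauchy_integral_formula_convex_simple[OF conv hol int _ im]) auto
    hence "(?q has_contour_integral (2 * pi * \<i> * \<phi> p)) (rectpath ?A ?C)"
      using winding_number_rectpath[OF pb] by simp
    from has_contour_integral_rectpath_split[OF continuous_on_subset[OF cont im] this]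
    show ?thesis using n by (simp add: hor_def)
  qed
  have "(\<lambda>n. ?R n)
     \<longlonglongrightarrow> 0 + \<i> * vline_integral b ?q - 0 - \<i> * vline_integral a ?q"
    unfolding vline_integral_def
    by (intro tendsto_intros hor0 tendsto_integral_symmetric inta intb)
  moreover have "eventually (\<lambda>n. ?R n = 2 * pi * \<i> * \<phi> p) sequentially"
    using eventually_gt_at_top[of "nat \<lceil>\<bar>Im p\<bar>\<rceil>"] by eventually_elim (rule rect[symmetric], linarith)
  ultimately have "2 * pi * \<i> * \<phi> p = 0 + \<i> * vline_integral b ?q - 0 - \<i> * vline_integral a ?q"
    by (intro LIMSEQ_unique[OF tendsto_eventually])
  hence "\<i> * (vline_integral b ?q - vline_integral a ?q) = \<i> * (2 * pi * \<phi> p)" by (simp add: algebra_simps)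
  thus "vline_integral b ?q - vline_integral a ?q = complex_of_real (2 * pi) * \<phi> p" by simp
qed

lemma one_plus_abs_Im_le:
  assumes "0 < m" "m \<le> \<bar>Re s\<bar>"
  shows "1 + \<bar>Im s\<bar> \<le> (1 + 1 / m) * norm s"
proof -
  have "m \<le> norm s" using assms abs_Re_le_cmod[of s] by linarith
  hence "1 \<le> 1 / m * norm s" using assms by (simp add: field_simps)
  thus ?thesis using abs_Im_le_cmod[of s] by (simp add: distrib_right)
qed

text \<open>An artificial pole reduces this to the formula with a pole: for p midway between the
  lines, (s - p) q(s) vanishes at p, so the residue is 0.\<close>

lemma vline_integral_shift:
  assumes hol: "q holomorphic_on {s. a \<le> Re s \<and> Re s \<le> b}" and ab: "a < b"
    and bd: "\<And>s. a \<le> Re s \<Longrightarrow> Re s \<le> b \<Longrightarrow> norm (q s) \<le> B * (1 + \<bar>Im s\<bar>) powr (-3/2)"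
  shows "vline_integral a q = vline_integral b q"
proof -
  define p where "p = complex_of_real ((a + b) / 2)"
  define \<phi> where "\<phi> s = (s - p) * q s" for s
  have p: "Re p = (a + b) / 2" "Im p = 0" by (simp_all add: p_def)
  have "vline_integral b (\<lambda>s. \<phi> s / (s - p)) - vline_integral a (\<lambda>s. \<phi> s / (s - p)) = complex_of_real (2 * pi) * \<phi> p"
  proof (rule vline_integral_Cauchy(1))
    show "\<phi> holomorphic_on {s. a \<le> Re s \<and> Re s \<le> b}"
      unfolding \<phi>_def by (intro holomorphic_intros hol)
    fix s assume s: "a \<le> Re s" "Re s \<le> b"
    have pw: "(1 + \<bar>Im s\<bar>) powr (-3/2) * (1 + \<bar>Im s\<bar>) = (1 + \<bar>Im s\<bar>) powr (-1/2)"
      using powr_add[of "1 + \<bar>Im s\<bar>" "-3/2" 1] by (simp add: powr_one)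
    have "norm (s - p) \<le> \<bar>Re (s - p)\<bar> + \<bar>Im (s - p)\<bar>" by (rule cmod_le)
    also have "\<dots> \<le> (b - a) + \<bar>Im s\<bar>" using s p by (simp add: abs_if field_simps)
    also have "\<dots> \<le> (1 + b - a) * (1 + \<bar>Im s\<bar>)"
      using ab mult_nonneg_nonneg[of "b - a" "\<bar>Im s\<bar>"] by (simp add: algebra_simps)
    finally have n: "norm (s - p) \<le> (1 + b - a) * (1 + \<bar>Im s\<bar>)" .
    have "norm (\<phi> s) \<le> ((1 + b - a) * (1 + \<bar>Im s\<bar>)) * (B * (1 + \<bar>Im s\<bar>) powr (-3/2))"
      unfolding \<phi>_def norm_mult using ab n bd[OF s] by (intro mult_mono) auto
    also have "\<dots> = (1 + b - a) * B * ((1 + \<bar>Im s\<bar>) powr (-3/2) * (1 + \<bar>Im s\<bar>))" by (simp add: mult_ac)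
    finally show "norm (\<phi> s) \<le> (1 + b - a) * B * (1 + \<bar>Im s\<bar>) powr (-1/2)" unfolding pw .
  qed (use p ab in auto)
  moreover have "vline_integral c (\<lambda>s. \<phi> s / (s - p)) = vline_integral c q" if "c \<noteq> Re p" for c
  proof -
    have "Complex c t \<noteq> p" for t using that by auto
    thus ?thesis unfolding vline_integral_def by (simp add: \<phi>_def)
  qed
  moreover have "\<phi> p = 0" by (simp add: \<phi>_def)
  ultimately show ?thesis using ab p by simp
qed

lemma norm_vline_integral_le:
  assumes e: "0 < e" and b: "\<And>t. norm (q (Complex c t)) \<le> B * (1 + \<bar>t\<bar>) powr (-1 - e)"
  shows "norm (vline_integral c q) \<le> B * integral\<^sup>L lborel (\<lambda>t::real. (1 + \<bar>t\<bar>) powr (-1 - e))"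
proof -
  let ?g = "\<lambda>t::real. B * (1 + \<bar>t\<bar>) powr (-1 - e)"
  have int: "integrable lborel ?g" by (intro integrable_mult_right integrable_one_plus_abs_powr[OF e])
  have nonneg: "0 \<le> ?g t" for t using b[of t] norm_ge_zero order_trans by blast
  have "norm (\<integral>t. q (Complex c t) \<partial>lborel) \<le> integral\<^sup>L lborel ?g"
  proof (cases "integrable lborel (\<lambda>t. q (Complex c t))")
    case True
    show ?thesis
      by (rule order_trans[OF integral_norm_bound integral_mono[OF integrable_norm[OF True] int b]])
  next
    case False
    have "0 \<le> integral\<^sup>L lborel ?g" by (rule integral_nonneg_AE) (use nonneg in auto)
    thus ?thesis unfolding not_integrable_integral_eq[OF False] norm_zero .
  qed
  thus ?thesis unfolding vline_integral_def by simp
qed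

text \<open>The Mellin kernel of the Riesz mean of order 1: its integral picks out max 0 (1 - 1/y),
  and with y = x/n the weight 1 - n/x of the terms n <= x.\<close>

definition riesz_kernel :: "real \<Rightarrow> complex \<Rightarrow> complex" where
  "riesz_kernel y s = of_real y powr s / (s * (s + 1))"

lemma norm_of_real_powr: "0 < y \<Longrightarrow> norm (complex_of_real y powr s) = y powr Re s"
  by (simp add: norm_powr_real_powr)

lemma riesz_kernel_holomorphic:
  assumes "0 < y" "0 \<notin> S" "-1 \<notin> S"
  shows "riesz_kernel y holomorphic_on S"
proof -
  have "s + 1 \<noteq> 0" if "s \<in> S" for s using assms(3) that by (metis add_eq_0_iff2)
  thus ?thesis unfolding riesz_kernel_def[abs_def]
    using assms by (intro holomorphic_intros) auto
qed

lemma norm_riesz_kernel_le: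
  assumes y: "0 < y" and m: "0 < m" "m \<le> \<bar>Re s\<bar>" "m \<le> \<bar>Re s + 1\<bar>"
  shows "norm (riesz_kernel y s) \<le> (1 + 1 / m)^2 * y powr Re s * (1 + \<bar>Im s\<bar>) powr (-2)"
proof -
  have 1: "1 + \<bar>Im s\<bar> \<le> (1 + 1 / m) * norm s" by (rule one_plus_abs_Im_le[OF m(1,2)])
  have 2: "1 + \<bar>Im s\<bar> \<le> (1 + 1 / m) * norm (s + 1)" using one_plus_abs_Im_le[of m "s + 1"] m by simp
  have "(1 + \<bar>Im s\<bar>) * (1 + \<bar>Im s\<bar>) \<le> ((1 + 1 / m) * norm s) * ((1 + 1 / m) * norm (s + 1))"
    using 1 2 m by (intro mult_mono) auto
  hence 3: "(1 + \<bar>Im s\<bar>)^2 \<le> (1 + 1 / m)^2 * norm (s * (s + 1))"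
    by (simp add: power2_eq_square norm_mult mult_ac)
  have pos: "0 < (1 + \<bar>Im s\<bar>)^2" by (intro zero_less_power) simp
  hence pos': "0 < norm (s * (s + 1))" using 3 by (cases "s * (s + 1) = 0") auto
  have pw: "(1 + \<bar>Im s\<bar>) powr (-2) = 1 / (1 + \<bar>Im s\<bar>)^2"
    by (simp add: powr_minus_divide powr_numeral)
  have 4: "1 / norm (s * (s + 1)) \<le> (1 + 1 / m)^2 / (1 + \<bar>Im s\<bar>)^2"
    using 3 pos pos' by (simp add: field_simps)
  have "norm (riesz_kernel y s) = y powr Re s * (1 / norm (s * (s + 1)))"
    using y by (simp add: riesz_kernel_def norm_divide norm_of_real_powr)
  also have "\<dots> \<le> y powr Re s * ((1 + 1 / m)^2 / (1 + \<bar>Im s\<bar>)^2)"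
    by (rule mult_left_mono[OF 4]) simp
  finally show ?thesis unfolding pw by (simp add: mult_ac)
qed

lemma riesz_kernel_bound_32:
  assumes y: "0 < y" and m: "0 < m" "m \<le> \<bar>Re s\<bar>" "m \<le> \<bar>Re s + 1\<bar>" and d: "\<bar>Re s\<bar> \<le> d"
  shows "norm (riesz_kernel y s) \<le> (1 + 1 / m)^2 * max (y powr d) (y powr (-d)) * (1 + \<bar>Im s\<bar>) powr (-3/2)"
proof -
  have "y powr Re s \<le> max (y powr d) (y powr (-d))"
    using d y by (cases "1 \<le> y") (auto simp: le_max_iff_disj intro: powr_mono powr_mono')
  moreover have "(1 + \<bar>Im s\<bar>) powr (-2) \<le> (1 + \<bar>Im s\<bar>) powr (-3/2)" by (intro powr_mono) auto
  ultimately have "(1 + 1 / m)^2 * y powr Re s * (1 + \<bar>Im s\<bar>) powr (-2) \<le>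
     (1 + 1 / m)^2 * max (y powr d) (y powr (-d)) * (1 + \<bar>Im s\<bar>) powr (-3/2)"
    by (intro mult_mono) (auto intro!: mult_nonneg_nonneg simp: le_max_iff_disj)
  thus ?thesis using norm_riesz_kernel_le[OF y m] by linarith
qed

text \<open>Of the decay |s|^(-2), the power 3/2 is kept for integrability in t. The remaining half
  power becomes 1 / sqrt m, which vanishes as the line moves away from the poles.\<close>

lemma riesz_kernel_far:
  assumes y: "0 < y" and m: "1 \<le> m" "m \<le> \<bar>c\<bar>" "m \<le> \<bar>c + 1\<bar>"
  shows "norm (riesz_kernel y (Complex c t)) \<le> (4 / sqrt m) * y powr c * (1 + \<bar>t\<bar>) powr (-1 - 1/2)"
proof -
  let ?n = "norm (Complex c t) * norm (Complex c t + 1)" and ?p = "(1 + \<bar>t\<bar>) powr (1/2) * (1 + \<bar>t\<bar>)"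
  have abs1: "norm (riesz_kernel y (Complex c t)) = y powr c * (1 / ?n)"
    using y by (simp add: riesz_kernel_def norm_divide norm_mult norm_of_real_powr)
  have 1: "m \<le> norm (Complex c t)" "1 + \<bar>t\<bar> \<le> 2 * norm (Complex c t)"
    using m abs_Re_le_cmod[of "Complex c t"] one_plus_abs_Im_le[of 1 "Complex c t"] by auto
  have 2: "1 + \<bar>t\<bar> \<le> 2 * norm (Complex c t + 1)"
    using m one_plus_abs_Im_le[of 1 "Complex c t + 1"] by auto
  have "sqrt m * ?p \<le>
     sqrt (norm (Complex c t)) * (sqrt (2 * norm (Complex c t)) * (2 * norm (Complex c t + 1)))"
    using 1 2 m by (intro mult_mono) (auto simp: powr_half_sqrt)
  also have "\<dots> = (2 * sqrt 2) * ?n"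
    by (simp add: real_sqrt_mult)
  also have "\<dots> \<le> 4 * ?n"
    using sqrt2_less_2 by (intro mult_right_mono) auto
  finally have 3: "sqrt m * ?p \<le> 4 * ?n" .
  have pos: "0 < ?n" using 1 2 m by (intro mult_pos_pos) auto
  have pos2: "0 < sqrt m * ?p" using m by (auto simp: add_pos_nonneg)
  have pw: "(1 + \<bar>t\<bar>) powr (-1 - 1/2) = 1 / ?p"
    using powr_minus_divide[of "1 + \<bar>t\<bar>" "1/2 + 1"] powr_add[of "1 + \<bar>t\<bar>" "1/2" 1] by (simp add: powr_one)
  have "1 / ?n \<le> (4 / sqrt m) * (1 + \<bar>t\<bar>) powr (-1 - 1/2)"
  proof -
    have "1 / ?n = 4 / (4 * ?n)"
      by simp
    also have "\<dots> \<le> 4 / (sqrt m * ?p)"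
      using 3 pos2 by (intro frac_le) auto
    finally show ?thesis unfolding pw by simp
  qed
  hence "y powr c * (1 / ?n) \<le> y powr c * ((4 / sqrt m) * (1 + \<bar>t\<bar>) powr (-1 - 1/2))"
    by (intro mult_left_mono) auto
  thus ?thesis unfolding abs1 by (simp add: mult_ac)
qed

lemma vline_integral_riesz_kernel_eq:
  assumes y: "0 < y" and ab: "a < b" "0 < a \<or> b < -1"
  shows "vline_integral a (riesz_kernel y) = vline_integral b (riesz_kernel y)"
proof -
  \<comment> \<open>A lower bound for the distance from the strip to the poles 0 and -1, on
    whichever side of them it lies.\<close>
  define m where "m = (if 0 < a then a else -1 - b)"
  define d where "d = max \<bar>a\<bar> \<bar>b\<bar>"
  show ?thesis
  proof (rule vline_integral_shift[OF _ ab(1)])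
    show "riesz_kernel y holomorphic_on {s. a \<le> Re s \<and> Re s \<le> b}"
      using ab by (intro riesz_kernel_holomorphic y) auto
    show "norm (riesz_kernel y s) \<le> (1 + 1 / m)^2 * max (y powr d) (y powr (-d)) * (1 + \<bar>Im s\<bar>) powr (-3/2)"
      if "a \<le> Re s" "Re s \<le> b" for s
      using that ab by (intro riesz_kernel_bound_32 y) (auto simp: m_def d_def abs_if split: if_splits)
  qed
qed

text \<open>The line is pushed to infinity without crossing a pole: to the right for y <= 1 and to
  the left for y >= 1. In both directions y^(Re s) stays at most 1 and the integral tends to
  0.\<close>

lemma vline_integral_riesz_kernel_0:
  assumes y: "0 < y" and c: "(0 < c \<and> y \<le> 1) \<or> (c < -1 \<and> 1 \<le> y)"
  shows "vline_integral c (riesz_kernel y) = 0"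
proof -
  define I where "I = integral\<^sup>L lborel (\<lambda>t::real. (1 + \<bar>t\<bar>) powr (-1 - 1/2))"
  define sg :: real where "sg = (if 0 < c then 1 else -1)"
  have I0: "0 \<le> I" unfolding I_def by (rule integral_nonneg_AE) auto
  have *: "norm (vline_integral c (riesz_kernel y)) \<le> (4 / sqrt (real n)) * I" if n: "real n > \<bar>c\<bar> + 2" for n
  proof -
    \<comment> \<open>The extra 1 keeps both |d| and |d + 1| at least n, for either sign.\<close>
    define d where "d = sg * (real n + 1)"
    have "vline_integral c (riesz_kernel y) = vline_integral d (riesz_kernel y)"
    proof (cases "0 < c")
      case True
      thus ?thesis using n by (intro vline_integral_riesz_kernel_eq y) (auto simp: d_def sg_def)
    next
      case False
      have "d < c" using False n by (auto simp: d_def sg_def)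
      thus ?thesis using False c by (intro vline_integral_riesz_kernel_eq[symmetric] y) auto
    qed
    also have "norm \<dots> \<le> (4 / sqrt (real n)) * I"
      unfolding I_def
    proof (rule norm_vline_integral_le)
      fix t
      have "norm (riesz_kernel y (Complex d t)) \<le> (4 / sqrt (real n)) * y powr d * (1 + \<bar>t\<bar>) powr (-1 - 1/2)"
        using n by (intro riesz_kernel_far y) (auto simp: d_def sg_def)
      also have "y powr d \<le> 1"
      proof (cases "0 < c")
        case True
        thus ?thesis using c n y by (auto simp: d_def sg_def intro!: powr_le1)
      next
        case False
        thus ?thesis using c n y powr_mono[of d 0 y] by (auto simp: d_def sg_def split: if_splits)
      qed
      hence "(4 / sqrt (real n)) * y powr d * (1 + \<bar>t\<bar>) powr (-1 - 1/2) \<le> (4 / sqrt (real n)) * 1 * (1 + \<bar>t\<bar>) powr (-1 - 1/2)"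
        by (intro mult_right_mono mult_left_mono) auto
      finally show "norm (riesz_kernel y (Complex d t)) \<le> (4 / sqrt (real n)) * (1 + \<bar>t\<bar>) powr (-1 - 1/2)" by simp
    qed simp
    finally show ?thesis .
  qed
  have "(\<lambda>n. (4 / sqrt (real n)) * I) \<longlonglongrightarrow> 0" by real_asymp
  moreover have "eventually (\<lambda>n. norm (vline_integral c (riesz_kernel y)) \<le> (4 / sqrt (real n)) * I) sequentially"
    using eventually_gt_at_top[of "nat \<lceil>\<bar>c\<bar> + 2\<rceil>"] by eventually_elim (rule *, linarith)
  ultimately have "norm (vline_integral c (riesz_kernel y)) \<le> 0"
    using tendsto_lowerbound[OF _ _ sequentially_bot] by blast
  thus ?thesis by simp
qed

text \<open>For y > 1 the line moves left across the poles one at a time, with -1/2 as intermediate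
  abscissa. The residues are 1 at s = 0 and -1/y at s = -1, and nothing remains beyond -1.\<close>

lemma vline_integral_riesz_kernel:
  assumes y: "0 < y"
  shows "vline_integral 2 (riesz_kernel y) = 2 * pi * max 0 (1 - 1 / y)"
proof (cases "y \<le> 1")
  case True
  hence "max 0 (1 - 1 / y) = 0" using y by (simp add: field_simps)
  thus ?thesis using vline_integral_riesz_kernel_0[OF y, of 2] True by simp
next
  case False
  hence y1: "1 \<le> y" by simp
  have bd: "norm (of_real y powr s / w) \<le> 3 * y powr 2 * (1 + \<bar>Im s\<bar>) powr (-1/2)"
    if s: "Re s \<le> 2" and w: "1 + \<bar>Im s\<bar> \<le> 3 * norm w" for s w :: complex
  proof -
    have "(1 + \<bar>Im s\<bar>) powr (1/2) \<le> (1 + \<bar>Im s\<bar>) powr 1" by (intro powr_mono) auto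
    hence le: "(1 + \<bar>Im s\<bar>) powr (1/2) \<le> 3 * norm w" using w by simp
    have pos: "0 < (1 + \<bar>Im s\<bar>) powr (1/2)" by (simp add: add_pos_nonneg)
    have "norm (of_real y powr s / w) = y powr Re s / norm w" using y by (simp add: norm_divide norm_of_real_powr)
    also have "\<dots> \<le> y powr 2 / ((1 + \<bar>Im s\<bar>) powr (1/2) / 3)"
      using le pos s y1 by (intro frac_le powr_mono) auto
    also have "\<dots> = 3 * y powr 2 * (1 + \<bar>Im s\<bar>) powr (-1/2)"
      using powr_minus_divide[of "1 + \<bar>Im s\<bar>" "1/2"] by simp
    finally show ?thesis .
  qed
  have half: "2 * pi * 1 = vline_integral 2 (riesz_kernel y) - vline_integral (-1/2) (riesz_kernel y)"
  proof -
    let ?\<phi> = "\<lambda>s. of_real y powr s / (s + 1) :: complex"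
    have "vline_integral 2 (\<lambda>s. ?\<phi> s / (s - 0)) - vline_integral (-1/2) (\<lambda>s. ?\<phi> s / (s - 0)) = complex_of_real (2 * pi) * ?\<phi> 0"
    proof (rule vline_integral_Cauchy(1))
      have "s + 1 \<noteq> 0" if "-1/2 \<le> Re s" for s
      proof
        assume "s + 1 = 0"
        hence "Re s = -1" by (simp add: complex_eq_iff)
        thus False using that by simp
      qed
      thus "?\<phi> holomorphic_on {s. -1/2 \<le> Re s \<and> Re s \<le> 2}"
        using y by (intro holomorphic_intros) auto
      fix s assume s: "-1/2 \<le> Re s" "Re s \<le> 2"
      have "1 + \<bar>Im s\<bar> \<le> 3 * norm (s + 1)" using one_plus_abs_Im_le[of "1/2" "s + 1"] s by simp
      thus "norm (?\<phi> s) \<le> 3 * y powr 2 * (1 + \<bar>Im s\<bar>) powr (-1/2)" using s by (intro bd) auto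
    qed auto
    moreover have "?\<phi> s / (s - 0) = riesz_kernel y s" for s by (simp add: riesz_kernel_def mult.commute)
    ultimately show ?thesis using y by simp
  qed
  have half2: "2 * pi * (- 1 / y) = vline_integral (-1/2) (riesz_kernel y) - vline_integral (-2) (riesz_kernel y)"
  proof -
    let ?\<phi> = "\<lambda>s. of_real y powr s / s :: complex"
    have "vline_integral (-1/2) (\<lambda>s. ?\<phi> s / (s - (-1))) - vline_integral (-2) (\<lambda>s. ?\<phi> s / (s - (-1))) = complex_of_real (2 * pi) * ?\<phi> (-1)"
    proof (rule vline_integral_Cauchy(1))
      show "?\<phi> holomorphic_on {s. -2 \<le> Re s \<and> Re s \<le> -1/2}"
        using y by (intro holomorphic_intros) auto
      fix s assume s: "-2 \<le> Re s" "Re s \<le> -1/2"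
      have "1 + \<bar>Im s\<bar> \<le> 3 * norm s" using one_plus_abs_Im_le[of "1/2" s] s by simp
      thus "norm (?\<phi> s) \<le> 3 * y powr 2 * (1 + \<bar>Im s\<bar>) powr (-1/2)" using s by (intro bd) auto
    qed auto
    moreover have "?\<phi> s / (s - (-1)) = riesz_kernel y s" for s by (simp add: riesz_kernel_def)
    moreover have "complex_of_real y powr (-1) = 1 / of_real y" using y by (simp add: powr_minus_divide)
    ultimately show ?thesis using y by simp
  qed
  have "vline_integral (-2) (riesz_kernel y) = 0" using y1 by (intro vline_integral_riesz_kernel_0 y) auto
  hence "vline_integral 2 (riesz_kernel y) = 2 * pi * 1 + 2 * pi * (- 1 / y)"
    unfolding of_real_add half half2 by simp
  also have "\<dots> = 2 * pi * (1 - 1 / y)" by (simp add: algebra_simps)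
  also have "1 - 1 / y = max 0 (1 - 1 / y)" using y1 by (simp add: field_simps)
  finally show ?thesis by simp
qed

section \<open>The Chebyshev function under the Riemann hypothesis\<close>

lemma of_real_divide_powr:
  assumes "0 < x" "0 < y"
  shows "complex_of_real (x / y) powr s = of_real x powr s / of_real y powr s"
proof -
  have L1: "Ln (complex_of_real (x / y)) = of_real (ln x - ln y)"
    using assms Ln_of_real[of "x / y"] by (simp add: ln_div)
  have L2: "Ln (complex_of_real x) = of_real (ln x)" "Ln (complex_of_real y) = of_real (ln y)"
    using assms by (simp_all add: Ln_of_real)
  have "exp (s * complex_of_real (ln x - ln y)) = exp (s * of_real (ln x)) / exp (s * of_real (ln y))"
    by (simp add: exp_diff[symmetric] algebra_simps)
  thus ?thesis using assms by (simp add: powr_def L1 L2 del: of_real_divide of_real_diff)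
qed

lemma finite_nat_le_real [simp]: "finite {n::nat. real n \<le> x}"
proof -
  have "n \<le> nat \<lceil>x\<rceil>" if "real n \<le> x" for n using that by linarith
  hence "{n::nat. real n \<le> x} \<subseteq> {..nat \<lceil>x\<rceil>}" by auto
  thus ?thesis by (rule finite_subset) simp
qed

text \<open>Termwise integration is allowed because the n-th term has L1 norm O(x^2 ln n / n^2). The
  factor n^(-s) merges with x^s, so each term is the kernel at x/n; terms with n > x integrate to
  0.\<close>

lemma vline_integral_mangoldt_riesz:
  assumes x: "0 < x"
  shows "vline_integral 2 (\<lambda>s. mangoldt_series s * riesz_kernel x s) =
    of_real (2 * pi * (\<Sum>n | real n \<le> x. mangoldt n * (1 - real n / x)))"
proof -
  define f where "f n t = mangoldt n / of_nat n powr Complex 2 t * riesz_kernel x (Complex 2 t)" for n t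
  define I where "I = integral\<^sup>L lborel (\<lambda>t::real. (1 + \<bar>t\<bar>) powr (-1 - 1))"
  \<comment> \<open>9/4 is (1 + 1/m)^2 for m = 2, the distance of the line from the pole 0.\<close>
  let ?B = "\<lambda>n. (9/4) * x^2 * (ln (real n) * real n powr (-2))"
  let ?v = "\<lambda>n. complex_of_real (2 * pi * (mangoldt n * max 0 (1 - real n / x)))"
  have f_eq: "f n t = of_real (mangoldt n) * riesz_kernel (x / real n) (Complex 2 t)" for n t
  proof (cases "n = 0")
    case False
    thus ?thesis using x of_real_divide_powr[of x "real n" "Complex 2 t"]
      by (simp add: f_def riesz_kernel_def mult_ac)
  qed (simp add: f_def)
  have f_norm: "norm (f n t) \<le> ?B n * (1 + \<bar>t\<bar>) powr (-1 - 1)" for n t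
  proof (cases "n = 0")
    case False
    have "norm (f n t) = mangoldt n * norm (riesz_kernel (x / real n) (Complex 2 t))"
      unfolding f_eq by (simp add: norm_mult)
    also have "\<dots> \<le> ln (real n) * ((1 + 1 / 2)^2 * (x / real n) powr Re (Complex 2 t) * (1 + \<bar>Im (Complex 2 t)\<bar>) powr (-2))"
      using x False by (intro mult_mono mangoldt_le_ln norm_riesz_kernel_le) (auto simp: mangoldt_nonneg)
    also have "\<dots> = ?B n * (1 + \<bar>t\<bar>) powr (-1 - 1)"
      using x False by (simp add: powr_divide powr_numeral powr_minus_divide power2_eq_square)
    finally show ?thesis .
  qed (simp add: f_def)
  have int: "integrable lborel (f n)" for n
  proof (cases "n = 0")
    case False
    have "(\<lambda>s. mangoldt n / of_nat n powr s * riesz_kernel x s) holomorphic_on {s. Re s = 2}"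
      using False x by (intro holomorphic_intros riesz_kernel_holomorphic) auto
    hence "integrable lborel (\<lambda>t. (\<lambda>s. mangoldt n / of_nat n powr s * riesz_kernel x s) (Complex 2 t))"
      using f_norm[of n] unfolding f_def
      by (intro vline_integrable[where e = 1 and B = "?B n"]
            holomorphic_on_imp_continuous_on) auto
    thus ?thesis by (simp add: f_def[abs_def])
  qed (simp add: f_def[abs_def])
  have I0: "0 \<le> I" unfolding I_def by (rule integral_nonneg_AE) auto
  have inorm: "(\<integral>t. norm (f n t) \<partial>lborel) \<le> ?B n * I" for n
  proof -
    have "(\<integral>t. norm (f n t) \<partial>lborel) \<le> (\<integral>t. ?B n * (1 + \<bar>t\<bar>) powr (-1 - 1) \<partial>lborel)"
      by (intro integral_mono integrable_norm int integrable_mult_right integrable_one_plus_abs_powr f_norm) simp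
    thus ?thesis by (simp add: I_def)
  qed
  have summ: "summable (\<lambda>n. \<integral>t. norm (f n t) \<partial>lborel)"
  proof (rule summable_comparison_test'[of _ 0])
    show "summable (\<lambda>n. ?B n * I)"
      by (intro summable_mult summable_mult2 summable_ln_powr) simp
    show "norm (\<integral>t. norm (f n t) \<partial>lborel) \<le> ?B n * I" for n
    proof -
      have "0 \<le> (\<integral>t. norm (f n t) \<partial>lborel)" by (rule integral_nonneg_AE) simp
      thus ?thesis using inorm[of n] by simp
    qed
  qed
  have fsum: "(\<lambda>n. f n t) sums (mangoldt_series (Complex 2 t) * riesz_kernel x (Complex 2 t))" for t
    unfolding f_def by (intro sums_mult2 mangoldt_series_sums) simp
  have summn: "summable (\<lambda>n. norm (f n t))" for t
    unfolding f_def norm_mult by (intro summable_mult2 summable_norm_mangoldt_term) simp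
  have "(\<lambda>n. \<integral>t. f n t \<partial>lborel) sums (\<integral>t. (\<Sum>n. f n t) \<partial>lborel)"
    by (rule sums_integral[OF int _ summ]) (simp add: summn)
  moreover have "(\<Sum>n. f n t) = mangoldt_series (Complex 2 t) * riesz_kernel x (Complex 2 t)" for t
    using fsum[of t] by (simp add: sums_iff)
  ultimately have 1: "(\<lambda>n. \<integral>t. f n t \<partial>lborel) sums vline_integral 2 (\<lambda>s. mangoldt_series s * riesz_kernel x s)"
    by (simp add: vline_integral_def)
  have val: "(\<integral>t. f n t \<partial>lborel) = of_real (2 * pi * (mangoldt n * max 0 (1 - real n / x)))" for n
  proof (cases "n = 0")
    case False
    have "(\<integral>t. f n t \<partial>lborel) = of_real (mangoldt n) * vline_integral 2 (riesz_kernel (x / real n))"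
      unfolding f_eq vline_integral_def by simp
    also have "vline_integral 2 (riesz_kernel (x / real n)) = 2 * pi * max 0 (1 - 1 / (x / real n))"
      using x False by (intro vline_integral_riesz_kernel) auto
    finally show ?thesis by (simp add: mult_ac del: of_real_mangoldt)
  qed (simp add: f_def)
  have S1: "(\<lambda>n. ?v n) sums
     (\<Sum>n | real n \<le> x. ?v n)"
    by (rule sums_finite) (use x in \<open>auto simp: field_simps max_def\<close>)
  have S2: "(\<Sum>n | real n \<le> x. ?v n) =
     of_real (2 * pi * (\<Sum>n | real n \<le> x. mangoldt n * (1 - real n / x)))"
    unfolding sum_distrib_left of_real_sum using x
    by (intro sum.cong refl) (auto simp: max_def field_simps)
  show ?thesis unfolding S2[symmetric] by (rule sums_unique2[OF 1[unfolded val] S1])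
qed

text \<open>Integrability on the new line belongs to the conclusion because the formulas at x and at
  x + 1 are later subtracted under a single integral. The main term is 2 pi times the residue x/2 at
  s = 1.\<close>

lemma vline_integral_mangoldt_shift:
  assumes zeros: "\<And>s. 0 < Re s \<Longrightarrow> zf s = 0 \<Longrightarrow> Re s = 1 / 2"
    and pw: "\<And>s. 1/2 < Re s \<Longrightarrow> Re s \<le> 2 \<Longrightarrow> norm (zf_logderiv s) \<le> C * ln (\<bar>Im s\<bar> + 2) / (Re s - 1/2)"
    and C: "0 < C" and x: "0 < x" and e: "0 < e" "e \<le> 1/4"
  shows "integrable lborel (\<lambda>t. (1 / (Complex (1/2 + e) t - 1) - zf_logderiv (Complex (1/2 + e) t)) *
            riesz_kernel x (Complex (1/2 + e) t))" (is ?int)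
    and "of_real (2 * pi * (\<Sum>n | real n \<le> x. mangoldt n * (1 - real n / x))) =
      of_real (pi * x) + vline_integral (1/2 + e) (\<lambda>s. (1 / (s - 1) - zf_logderiv s) * riesz_kernel x s)" (is ?eq)
proof -
  define \<sigma> where "\<sigma> = 1/2 + e"
  \<comment> \<open>This is the integrand times s - 1. The factor cancels the pole at 1, so Cauchy's
    formula applies with p = 1.\<close>
  define \<phi> where "\<phi> s = (1 - (s - 1) * zf_logderiv s) * riesz_kernel x s" for s
  define B where "B = (1 + 4 * C / e) * (9 * (x powr 2 + 1))"
  have hol: "\<phi> holomorphic_on {s. \<sigma> \<le> Re s \<and> Re s \<le> 2}"
  proof -
    have nz: "zf s \<noteq> 0" if "\<sigma> \<le> Re s" for s using zeros[of s] that e by (auto simp: \<sigma>_def)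
    have op: "open {s. 0 < Re s}" by (rule open_halfspace_Re_gt)
    have sub: "{s. \<sigma> \<le> Re s \<and> Re s \<le> 2} \<subseteq> {s. 0 < Re s}" using e by (auto simp: \<sigma>_def)
    have "zf_logderiv holomorphic_on {s. \<sigma> \<le> Re s \<and> Re s \<le> 2}"
      unfolding zf_logderiv_def[abs_def] using nz
      by (intro holomorphic_intros holomorphic_on_subset[OF holomorphic_deriv[OF zf_holomorphic op] sub]
             holomorphic_on_subset[OF zf_holomorphic sub]) auto
    moreover have "riesz_kernel x holomorphic_on {s. \<sigma> \<le> Re s \<and> Re s \<le> 2}"
      using e by (intro riesz_kernel_holomorphic x) (auto simp: \<sigma>_def)
    ultimately show ?thesis unfolding \<phi>_def by (intro holomorphic_intros)
  qed
  have bd: "norm (\<phi> s) \<le> B * (1 + \<bar>Im s\<bar>) powr (-1/2)" if s: "\<sigma> \<le> Re s" "Re s \<le> 2" for s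
  proof -
    define u where "u = 1 + \<bar>Im s\<bar>"
    have u: "1 \<le> u" by (simp add: u_def)
    have "norm (s - 1) \<le> \<bar>Re (s - 1)\<bar> + \<bar>Im (s - 1)\<bar>" by (rule cmod_le)
    also have "\<dots> \<le> u" using s e by (simp add: u_def \<sigma>_def abs_if)
    finally have n1: "norm (s - 1) \<le> u" .
    \<comment> \<open>Half a power of u is affordable for the logarithm: u from s - 1, u^(1/2) from
      here and u^(-2) from the kernel leave exactly u^(-1/2).\<close>
    have "ln (u + 1) \<le> (u + 1) powr (1/2) / (1/2)" using u by (intro ln_powr_bound) auto
    also have "(u + 1) powr (1/2) \<le> (4 * u) powr (1/2)" using u by (intro powr_mono2) auto
    also have "(4 * u) powr (1/2) = 2 * u powr (1/2)" using u by (simp add: powr_mult powr_half_sqrt)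
    finally have lnu: "ln (\<bar>Im s\<bar> + 2) \<le> 4 * u powr (1/2)" by (simp add: u_def add_ac)
    have "norm (zf_logderiv s) \<le> C * ln (\<bar>Im s\<bar> + 2) / (Re s - 1/2)"
      using s e by (intro pw) (auto simp: \<sigma>_def)
    also have "\<dots> \<le> C * (4 * u powr (1/2)) / e"
      using lnu C s e by (intro frac_le mult_left_mono mult_nonneg_nonneg) (auto simp: \<sigma>_def)
    finally have n2: "norm (zf_logderiv s) \<le> (4 * C / e) * u powr (1/2)" by (simp add: mult_ac)
    have "norm (1 - (s - 1) * zf_logderiv s) \<le> 1 + norm (s - 1) * norm (zf_logderiv s)"
      using norm_triangle_ineq4[of 1 "(s - 1) * zf_logderiv s"] by (simp add: norm_mult)
    also have "\<dots> \<le> u powr (3/2) + u * ((4 * C / e) * u powr (1/2))"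
      using n1 n2 u by (intro add_mono mult_mono) (auto intro: ge_one_powr_ge_zero)
    also have "u * ((4 * C / e) * u powr (1/2)) = (4 * C / e) * u powr (3/2)"
      using u powr_add[of u 1 "1/2"] by (simp add: powr_one)
    finally have a: "norm (1 - (s - 1) * zf_logderiv s) \<le> (1 + 4 * C / e) * u powr (3/2)"
      by (simp add: distrib_right)
    have "norm (riesz_kernel x s) \<le> (1 + 1 / (1/2))^2 * x powr Re s * (1 + \<bar>Im s\<bar>) powr (-2)"
      using s e by (intro norm_riesz_kernel_le x) (auto simp: \<sigma>_def)
    also have "x powr Re s \<le> x powr 2 + 1"
    proof (cases "1 \<le> x")
      case True
      have "x powr Re s \<le> x powr 2" using s True by (intro powr_mono) auto
      thus ?thesis by simp
    next
      case False
      have "x powr Re s \<le> 1" using s e False x by (intro powr_le1) (auto simp: \<sigma>_def)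
      thus ?thesis by (simp add: add_increasing)
    qed
    finally have b: "norm (riesz_kernel x s) \<le> 9 * (x powr 2 + 1) * u powr (-2)"
      by (simp add: u_def mult_left_mono mult_right_mono)
    have "norm (\<phi> s) \<le> ((1 + 4 * C / e) * u powr (3/2)) * (9 * (x powr 2 + 1) * u powr (-2))"
      unfolding \<phi>_def norm_mult using a b C e by (intro mult_mono) auto
    also have "\<dots> = B * u powr (-1/2)"
      using powr_add[of u "3/2" "-2"] by (simp add: B_def mult_ac)
    finally show ?thesis by (simp add: u_def)
  qed
  have Re1: "\<sigma> < Re 1" "Re 1 < 2" using e by (simp_all add: \<sigma>_def)
  note Cauchy = vline_integral_Cauchy[OF hol Re1 bd]
  have \<phi>1: "\<phi> 1 = of_real (x / 2)" using x by (simp add: \<phi>_def riesz_kernel_def)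
  have quot: "\<phi> s / (s - 1) = (1 / (s - 1) - zf_logderiv s) * riesz_kernel x s" if "s \<noteq> 1" for s
  proof -
    have "s - 1 \<noteq> 0" using that by simp
    thus ?thesis unfolding \<phi>_def by (simp add: field_simps)
  qed
  have ne: "Complex 2 t \<noteq> 1" "Complex \<sigma> t \<noteq> 1" for t
    using e by (auto simp: complex_eq_iff \<sigma>_def)
  have 2: "vline_integral 2 (\<lambda>s. \<phi> s / (s - 1)) = vline_integral 2 (\<lambda>s. mangoldt_series s * riesz_kernel x s)"
    unfolding vline_integral_def by (simp add: quot[OF ne(1)] mangoldt_series_eq_zf)
  have 3: "vline_integral \<sigma> (\<lambda>s. \<phi> s / (s - 1)) = vline_integral \<sigma> (\<lambda>s. (1 / (s - 1) - zf_logderiv s) * riesz_kernel x s)"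
    unfolding vline_integral_def by (simp add: quot[OF ne(2)])
  show ?int using Cauchy(2) by (simp add: quot[OF ne(2)] \<sigma>_def[symmetric])
  have "complex_of_real (2 * pi) * \<phi> 1 = of_real (pi * x)" unfolding \<phi>1 by simp
  thus ?eq using Cauchy(1)
    unfolding 2 3 vline_integral_mangoldt_riesz[OF x] \<sigma>_def[symmetric] by (simp only: diff_eq_eq)
qed

text \<open>By the mean value theorem the terms after the first are dominated by a telescoping
  series. The explicit growth 1/a for small a is what later yields a factor 1/e.\<close>

lemma suminf_powr_le:
  fixes a :: real
  assumes a: "0 < a"
  shows "summable (\<lambda>n. real (n + 1) powr (-1 - a))" and "(\<Sum>n. real (n + 1) powr (-1 - a)) \<le> 1 + 1 / a"
proof -
  have sm: "summable (\<lambda>n. real n powr (-1 - a))" using a by (simp add: summable_real_powr_iff)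
  have sm1: "summable (\<lambda>n. real (Suc n) powr (-1 - a))" using sm by (subst summable_Suc_iff)
  thus 1: "summable (\<lambda>n. real (n + 1) powr (-1 - a))" by simp
  have sm2: "summable (\<lambda>n. real (Suc n + 1) powr (-1 - a))"
    using 1 by (subst summable_Suc_iff[of "\<lambda>n. real (n + 1) powr (-1 - a)"])
  let ?g = "\<lambda>n. 1 / a * real (n + 1) powr (-a)"
  have lim: "?g \<longlonglongrightarrow> 0" using a by real_asymp
  have tel: "(\<lambda>n. ?g n - ?g (Suc n)) sums (?g 0 - 0)" by (rule telescope_sums'[OF lim])
  have le: "real (Suc n + 1) powr (-1 - a) \<le> ?g n - ?g (Suc n)" for n
  proof -
    have "\<exists>z. real (n + 1) < z \<and> z < real (n + 2) \<and>
       (- (1 / a) * real (n + 2) powr (-a)) - (- (1 / a) * real (n + 1) powr (-a)) = (real (n + 2) - real (n + 1)) * (z powr (-a - 1))"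
    proof (rule MVT2)
      fix z :: real assume "real (n + 1) \<le> z"
      hence "0 < z" by simp
      thus "((\<lambda>z. - (1 / a) * z powr (-a)) has_real_derivative z powr (-a - 1)) (at z)"
        using a by (auto intro!: derivative_eq_intros)
    qed simp
    then obtain z where z: "real (n + 1) < z" "z < real (n + 2)" "?g n - ?g (Suc n) = z powr (-a - 1)" by auto
    have "real (n + 2) powr (-a - 1) \<le> z powr (-a - 1)" using z a by (intro powr_mono2') auto
    thus ?thesis unfolding z(3) by (simp add: minus_diff_commute)
  qed
  have "(\<Sum>n. real (Suc n + 1) powr (-1 - a)) \<le> (\<Sum>n. ?g n - ?g (Suc n))"
    by (rule suminf_le[OF le sm2]) (use tel in \<open>simp add: sums_iff\<close>)
  also have "\<dots> = 1 / a" using tel by (simp add: sums_iff)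
  finally show "(\<Sum>n. real (n + 1) powr (-1 - a)) \<le> 1 + 1 / a"
    using suminf_split_head[OF 1] by simp
qed

lemma zf_logderiv_weight_measurable:
  assumes zeros: "\<And>s. 0 < Re s \<Longrightarrow> zf s = 0 \<Longrightarrow> Re s = 1 / 2" and \<sigma>: "1/2 < \<sigma>"
  shows "(\<lambda>t. norm (zf_logderiv (Complex \<sigma> t))) \<in> borel_measurable lborel"
    and "(\<lambda>t. (4 + norm (zf_logderiv (Complex \<sigma> t))) * norm (Complex \<sigma> t) powr e) \<in> borel_measurable lborel"
proof -
  have contL: "continuous_on UNIV (\<lambda>t. zf_logderiv (Complex \<sigma> t))"
  proof (rule continuous_on_compose2[of "{s. 1/2 < Re s}" zf_logderiv])
    have nz: "zf s \<noteq> 0" if "1/2 < Re s" for s using zeros[of s] that by auto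
    have sub: "{s. 1/2 < Re s} \<subseteq> {s::complex. 0 < Re s}" by auto
    show "continuous_on {s. 1/2 < Re s} zf_logderiv"
      unfolding zf_logderiv_def[abs_def] using nz
      by (intro holomorphic_on_imp_continuous_on holomorphic_intros
           holomorphic_on_subset[OF holomorphic_deriv[OF zf_holomorphic open_halfspace_Re_gt] sub]
           holomorphic_on_subset[OF zf_holomorphic sub]) auto
  qed (use \<sigma> in \<open>auto simp: Complex_eq intro!: continuous_intros\<close>)
  show m1: "(\<lambda>t. norm (zf_logderiv (Complex \<sigma> t))) \<in> borel_measurable lborel"
    using borel_measurable_continuous_onI[OF contL] by measurable
  have "continuous_on UNIV (\<lambda>t. norm (Complex \<sigma> t))"
    unfolding Complex_eq by (intro continuous_intros)
  hence "(\<lambda>t. norm (Complex \<sigma> t)) \<in> borel_measurable lborel"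
    by (simp add: borel_measurable_continuous_onI)
  thus "(\<lambda>t. (4 + norm (zf_logderiv (Complex \<sigma> t))) * norm (Complex \<sigma> t) powr e) \<in> borel_measurable lborel"
    using m1 by measurable
qed

text \<open>The line is cut into windows of half-width 1/4 around \<plusminus>n/2. On each, the
  weight is of order n^(-1-e) and the mean of H contributes e^(-1/2) ln n. Summing ln n * n^(-1-e)
  costs e^(-2), whence the exponent -5/2.\<close>

lemma zf_logderiv_weighted_integral:
  assumes zeros: "\<And>s. 0 < Re s \<Longrightarrow> zf s = 0 \<Longrightarrow> Re s = 1 / 2"
  shows "\<exists>K>0. \<forall>e. 0 < e \<longrightarrow> e \<le> 1/4 \<longrightarrow>
    (\<integral>\<^sup>+t. ennreal ((4 + norm (zf_logderiv (Complex (1/2 + e) t))) * norm (Complex (1/2 + e) t) powr (-1 - e)) \<partial>lborel)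
      \<le> ennreal (K * e powr (-5/2))"
proof -
  obtain C where C: "0 < C" and int: "\<And>t0 e. 0 < e \<Longrightarrow> e \<le> 1 \<Longrightarrow>
    (\<integral>\<^sup>+t. ennreal (norm (zf_logderiv (Complex (1/2 + e) t))) * indicator {t0 - 1/4..t0 + 1/4} t \<partial>lborel)
      \<le> ennreal (C * ln (\<bar>t0\<bar> + 2) / sqrt e)"
    using zf_logderiv_integral[OF zeros] by blast
  have main: "(\<integral>\<^sup>+t. ennreal ((4 + norm (zf_logderiv (Complex (1/2 + e) t))) * norm (Complex (1/2 + e) t) powr (-1 - e)) \<partial>lborel)
      \<le> ennreal (1536 * (4 + C) * e powr (-5/2))" if e: "0 < e" "e \<le> 1/4" for e
  proof -
    define \<sigma> where "\<sigma> = 1/2 + e"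
    define h where "h t = norm (zf_logderiv (Complex \<sigma> t))" for t
    define g where "g t = ennreal ((4 + h t) * norm (Complex \<sigma> t) powr (-1 - e))" for t
    define J where "J u = {u - 1/4..u + (1/4::real)}" for u
    \<comment> \<open>256 = 64 * 4: 64 comes from the weight (see \<open>w\<close>), and 4 / e from
      2 / a with a = e/2. The two centres double this, and the sum over n is at most 3 / e, giving
      1536.\<close>
    define c where "c n = 256 * (4 + C) * e powr (-3/2) * real (n + 1) powr (-1 - e/2)" for n :: nat
    have h0: "0 \<le> h t" for t by (simp add: h_def)
    have \<sigma>: "1/2 < \<sigma>" using e by (simp add: \<sigma>_def)
    have mh: "h \<in> borel_measurable lborel"
      unfolding h_def by (rule zf_logderiv_weight_measurable(1)[OF zeros \<sigma>])
    have mg: "g \<in> borel_measurable lborel"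
      unfolding g_def h_def by (rule measurable_compose[OF zf_logderiv_weight_measurable(2)[OF zeros \<sigma>] measurable_ennreal])
    have piece: "(\<integral>\<^sup>+t. g t * indicator (J u) t \<partial>lborel) \<le> ennreal (c n)" if u: "\<bar>u\<bar> = real n / 2" for u n
    proof -
      define l where "l = ln (\<bar>u\<bar> + 2)"
      define w where "w = 64 * real (n + 1) powr (-1 - e)"
      have w0: "0 \<le> w" by (simp add: w_def)
      have gw: "g t * indicator (J u) t \<le> ennreal w * (ennreal 4 * indicator (J u) t + ennreal (h t) * indicator (J u) t)" for t
      proof (cases "t \<in> J u")
        case True
        have "\<bar>u\<bar> - 1/4 \<le> \<bar>t\<bar>" using True by (auto simp: J_def abs_if split: if_splits)
        moreover have "\<bar>t\<bar> \<le> norm (Complex \<sigma> t)" "\<sigma> \<le> norm (Complex \<sigma> t)"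
          using abs_Im_le_cmod[of "Complex \<sigma> t"] abs_Re_le_cmod[of "Complex \<sigma> t"] by auto
        \<comment> \<open>For n >= 1 this follows from |t| >= n/2 - 1/4, with equality at n = 1; for
          n = 0 it follows from \<sigma> > 1/2.\<close>
        ultimately have low: "real (n + 1) / 8 \<le> norm (Complex \<sigma> t)"
          using u e unfolding \<sigma>_def by (cases "n = 0") auto
        have "norm (Complex \<sigma> t) powr (-1 - e) \<le> (real (n + 1) / 8) powr (-1 - e)"
          using low e by (intro powr_mono2') auto
        also have "\<dots> = real (n + 1) powr (-1 - e) * 8 powr (1 + e)"
        proof -
          have "- 1 - e = - (1 + e)" by simp
          hence "(8::real) powr (-1 - e) = 1 / 8 powr (1 + e)" by (simp only: powr_minus_divide)
          moreover have "(real (n + 1) / 8) powr (-1 - e) = real (n + 1) powr (-1 - e) / 8 powr (-1 - e)"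
            by (rule powr_divide)
          ultimately show ?thesis by simp
        qed
        also have "8 powr (1 + e) \<le> (8::real) powr 2" using e by (intro powr_mono) auto
        also have "(8::real) powr 2 = 64" by (simp add: powr_numeral)
        finally have "norm (Complex \<sigma> t) powr (-1 - e) \<le> w" by (simp add: w_def mult.commute)
        hence "(4 + h t) * norm (Complex \<sigma> t) powr (-1 - e) \<le> (4 + h t) * w"
          using h0[of t] by (intro mult_left_mono) auto
        hence "g t \<le> ennreal (w * (4 + h t))" unfolding g_def by (intro ennreal_leI) (simp add: mult.commute)
        also have "\<dots> = ennreal w * (ennreal 4 + ennreal (h t))"
          using w0 h0[of t] by (subst ennreal_mult) (auto simp: ennreal_plus)
        finally show ?thesis using True by simp
      qed simp
      have l: "1/2 \<le> l"
      proof -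
        have "ln 2 \<le> l" unfolding l_def by simp
        thus ?thesis using ln2_ge_two_thirds by linarith
      qed
      have "(\<integral>\<^sup>+t. g t * indicator (J u) t \<partial>lborel) \<le>
         (\<integral>\<^sup>+t. ennreal w * (ennreal 4 * indicator (J u) t + ennreal (h t) * indicator (J u) t) \<partial>lborel)"
        by (rule nn_integral_mono) (rule gw)
      also have "\<dots> = ennreal w * ((\<integral>\<^sup>+t. ennreal 4 * indicator (J u) t \<partial>lborel) + (\<integral>\<^sup>+t. ennreal (h t) * indicator (J u) t \<partial>lborel))"
        using mh by (subst nn_integral_cmult, simp add: J_def, subst nn_integral_add) (auto simp: J_def)
      also have "(\<integral>\<^sup>+t. ennreal 4 * indicator (J u) t \<partial>lborel) = ennreal 2"
      proof -
        have "(\<integral>\<^sup>+t. ennreal 4 * indicator (J u) t \<partial>lborel) = ennreal 4 * ennreal (1/2)"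
          by (subst nn_integral_cmult_indicator) (auto simp: J_def emeasure_lborel_Icc_eq)
        also have "\<dots> = ennreal (4 * (1/2))" by (rule ennreal_mult[symmetric]) auto
        finally show ?thesis by simp
      qed
      also have "(\<integral>\<^sup>+t. ennreal (h t) * indicator (J u) t \<partial>lborel) \<le> ennreal (C * l / sqrt e)"
        using int[of e u] e unfolding h_def \<sigma>_def J_def l_def by simp
      finally have "(\<integral>\<^sup>+t. g t * indicator (J u) t \<partial>lborel) \<le> ennreal w * (ennreal 2 + ennreal (C * l / sqrt e))"
        by (simp add: mult_left_mono add_left_mono)
      also have "\<dots> = ennreal (w * (2 + C * l / sqrt e))"
      proof -
        have "0 \<le> C * l / sqrt e" using C l e by simp
        thus ?thesis using w0 by (simp add: ennreal_mult ennreal_plus)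
      qed
      also have "\<dots> \<le> ennreal (c n)"
      proof (rule ennreal_leI)
        \<comment> \<open>Half of the decay n^(-e) pays for the logarithm through ln v <= v^a / a,
          and the other half keeps the series convergent. Each half costs one factor 1/e.\<close>
        define a where "a = e / 2"
        have a: "0 < a" "a \<le> 1" using e by (auto simp: a_def)
        have sq: "0 < sqrt e" "sqrt e \<le> 1" using e by auto
        have "l \<le> ln (real n + 2)" unfolding l_def u by simp
        also have "\<dots> \<le> (real n + 2) powr a / a" using a by (intro ln_powr_bound) auto
        also have "(real n + 2) powr a \<le> (2 * real (n + 1)) powr a" using a by (intro powr_mono2) auto
        also have "\<dots> = 2 powr a * real (n + 1) powr a" by (subst powr_mult) auto
        also have "\<dots> \<le> 2 powr 1 * real (n + 1) powr a" using a by (intro mult_right_mono powr_mono) auto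
        finally have l_le: "l \<le> (2 * real (n + 1) powr a) / a" using a by (simp add: divide_right_mono)
        have "2 \<le> 4 * l / sqrt e"
        proof -
          have "2 * sqrt e \<le> 2 * 1" using sq by simp
          also have "\<dots> \<le> 4 * l" using l by simp
          finally show ?thesis using sq by (simp add: field_simps)
        qed
        hence "2 + C * l / sqrt e \<le> (4 + C) * l / sqrt e" by (simp add: add_divide_distrib distrib_right)
        also have "\<dots> \<le> (4 + C) * ((2 * real (n + 1) powr a) / a) / sqrt e"
          using l_le C sq by (intro divide_right_mono mult_left_mono) auto
        finally have "w * (2 + C * l / sqrt e) \<le> w * ((4 + C) * ((2 * real (n + 1) powr a) / a) / sqrt e)"
          using w0 by (rule mult_left_mono)
        also have "\<dots> = 256 * (4 + C) * (1 / (e * sqrt e)) * (real (n + 1) powr (-1 - e) * real (n + 1) powr a)"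
          unfolding w_def a_def using e by (simp add: field_simps)
        also have "real (n + 1) powr (-1 - e) * real (n + 1) powr a = real (n + 1) powr (-1 - e/2)"
        proof -
          have "- 1 - e + a = - 1 - e/2" unfolding a_def by simp
          thus ?thesis by (simp only: powr_add[symmetric])
        qed
        also have "1 / (e * sqrt e) = e powr (-3/2)"
          using e powr_add[of e 1 "1/2"] powr_minus_divide[of e "3/2"] by (simp add: powr_half_sqrt powr_one)
        finally show "w * (2 + C * l / sqrt e) \<le> c n" by (simp add: c_def)
      qed
      finally show ?thesis .
    qed
    \<comment> \<open>The windows around n/2 and -n/2 cover the line. The window n = 0 occurs twice,
      which an upper bound can afford.\<close>
    let ?G = "\<lambda>n t. g t * indicator (J (real n / 2)) t + g t * indicator (J (- (real n / 2))) t"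
    have cover: "g t \<le> (\<Sum>n. ?G n t)" for t
    proof -
      define n where "n = nat (round (2 * \<bar>t\<bar>))"
      have "0 \<le> round (2 * \<bar>t\<bar>)" by (simp add: round_def)
      hence "\<bar>real n - 2 * \<bar>t\<bar>\<bar> \<le> 1/2" unfolding n_def using of_int_round_abs_le[of "2 * \<bar>t\<bar>"] by simp
      hence "t \<in> J (real n / 2) \<or> t \<in> J (- (real n / 2))" by (auto simp: J_def abs_if split: if_splits)
      hence "g t \<le> ?G n t" by auto
      also have "\<dots> = (\<Sum>n\<in>{n}. ?G n t)" by simp
      also have "\<dots> \<le> (\<Sum>n. ?G n t)"
        by (rule sum_le_suminf) auto
      finally show ?thesis .
    qed
    have mJ: "(\<lambda>t. g t * indicator (J u) t) \<in> borel_measurable lborel" for u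
      using mg unfolding J_def by measurable
    have "(\<integral>\<^sup>+t. g t \<partial>lborel) \<le> (\<integral>\<^sup>+t. (\<Sum>n. ?G n t) \<partial>lborel)"
      by (rule nn_integral_mono) (rule cover)
    also have "\<dots> = (\<Sum>n. \<integral>\<^sup>+t. ?G n t \<partial>lborel)"
      by (intro nn_integral_suminf borel_measurable_add mJ)
    also have "\<dots> \<le> (\<Sum>n. ennreal (c n) + ennreal (c n))"
    proof (intro suminf_le)
      show "(\<integral>\<^sup>+t. ?G n t \<partial>lborel) \<le> ennreal (c n) + ennreal (c n)" for n
        by (subst nn_integral_add[OF mJ mJ]) (intro add_mono piece, auto)
    qed auto
    also have "\<dots> = (\<Sum>n. ennreal (2 * c n))"
    proof -
      have "0 \<le> c n" for n unfolding c_def using C by simp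
      thus ?thesis by (simp add: ennreal_plus[symmetric] del: ennreal_plus)
    qed
    also have "\<dots> = ennreal (\<Sum>n. 2 * c n)"
    proof (rule suminf_ennreal2)
      show "0 \<le> 2 * c n" for n unfolding c_def using C by simp
      show "summable (\<lambda>n. 2 * c n)" unfolding c_def using suminf_powr_le(1)[of "e/2"] e by (intro summable_mult) simp
    qed
    also have "\<dots> \<le> ennreal (1536 * (4 + C) * e powr (-5/2))"
    proof (rule ennreal_leI)
      have "(\<Sum>n. 2 * c n) = (\<Sum>n. (512 * (4 + C) * e powr (-3/2)) * real (n + 1) powr (-1 - e/2))"
        by (intro suminf_cong) (simp add: c_def algebra_simps)
      also have "\<dots> = 512 * (4 + C) * e powr (-3/2) * (\<Sum>n. real (n + 1) powr (-1 - e/2))"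
        using suminf_powr_le(1)[of "e/2"] e by (intro suminf_mult) simp
      also have "\<dots> \<le> 512 * (4 + C) * e powr (-3/2) * (3 / e)"
      proof (rule mult_left_mono)
        have "(\<Sum>n. real (n + 1) powr (-1 - e/2)) \<le> 1 + 1 / (e/2)" using e by (intro suminf_powr_le) simp
        also have "\<dots> \<le> 3 / e" using e by (simp add: field_simps)
        finally show "(\<Sum>n. real (n + 1) powr (-1 - e/2)) \<le> 3 / e" .
      qed (use C in simp)
      also have "\<dots> = 1536 * (4 + C) * (e powr (-3/2) / e)" by simp
      also have "e powr (-3/2) / e = e powr (-5/2)"
        using e powr_diff[of e "-3/2" 1] by (simp add: powr_one)
      finally show "(\<Sum>n. 2 * c n) \<le> 1536 * (4 + C) * e powr (-5/2)" .
    qed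
    finally show ?thesis unfolding g_def h_def \<sigma>_def .
  qed
  show ?thesis using C main by (intro exI[of _ "1536 * (4 + C)"]) auto
qed

text \<open>Two bounds are interpolated. The derivative (s + 1) z^s of z^(s+1) cancels the factor s
  + 1 and gives A, of order 1/|s|. The triangle inequality gives A q, of order 1/|s|^2 but larger by
  a factor of order x. Then A min(1, q) <= A q^e gains just the decay |s|^(-e) that makes the
  integral converge.\<close>

lemma norm_riesz_kernel_diff_le:
  assumes x: "0 < x" and e: "0 < e" "e \<le> 1" and s: "Re s = 1/2 + e"
  shows "norm (of_real (x + 1) * riesz_kernel (x + 1) s - of_real x * riesz_kernel x s) \<le>
     (x + 1) powr (1/2 + e) / norm s * (2 * (x + 1) / norm s) powr e"
proof -
  define X where "X = x + 1"
  have X: "0 < X" "x \<le> X" using x by (auto simp: X_def)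
  have "0 < norm s" using s e by (auto simp: complex_eq_iff)
  hence s0: "0 < norm s" "s \<noteq> 0" by auto
  have s1: "norm s \<le> norm (s + 1)"
  proof -
    have "(norm s)^2 \<le> (norm (s + 1))^2" using s e unfolding cmod_power2 by (simp add: power2_eq_square algebra_simps)
    thus ?thesis by (rule power2_le_imp_le) simp
  qed
  hence s1': "0 < norm (s + 1)" "s + 1 \<noteq> 0" using s0 by auto
  define D where "D = of_real X * riesz_kernel X s - of_real x * riesz_kernel x s"
  have mulp: "complex_of_real v * of_real v powr s = of_real v powr (s + 1)" if "0 < v" for v
    using that by (simp add: powr_add mult.commute)
  let ?N = "of_real X powr (s + 1) - of_real x powr (s + 1) :: complex"
  have D_eq: "D = ?N / (s * (s + 1))"
    unfolding D_def riesz_kernel_def using mulp[OF X(1)] mulp[OF x] by (simp add: diff_divide_distrib)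
  define A where "A = X powr (1/2 + e) / norm s"
  define q where "q = 2 * X / norm s"
  have A0: "0 \<le> A" using s0 by (simp add: A_def)
  have q0: "0 < q" using s0 X by (simp add: q_def)
  have DA: "norm D \<le> A"
  proof -
    have "norm ?N \<le> norm (s + 1) * X powr (1/2 + e) * norm (complex_of_real X - of_real x)"
    proof (rule field_differentiable_bound[of "closed_segment (of_real x) (of_real X)"])
      fix z assume "z \<in> closed_segment (complex_of_real x) (of_real X)"
      then obtain u where u: "0 \<le> u" "u \<le> 1" "z = (1 - u) *\<^sub>R of_real x + u *\<^sub>R of_real X"
        by (auto simp: closed_segment_def)
      have zr: "z = of_real (x + u * (X - x))" unfolding u(3) by (simp add: scaleR_conv_of_real algebra_simps)
      have b: "0 < x + u * (X - x)" "x + u * (X - x) \<le> X"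
        using u x X mult_left_le_one_le[of "X - x" u] by (auto intro: add_pos_nonneg)
      have zn: "z \<notin> \<real>\<^sub>\<le>\<^sub>0" unfolding zr using b by (simp del: of_real_add of_real_mult of_real_diff)
      show "((\<lambda>z. z powr (s + 1)) has_field_derivative (s + 1) * z powr s) (at z within closed_segment (of_real x) (of_real X))"
        using has_field_derivative_powr[OF zn, of "s + 1"] by (simp add: has_field_derivative_at_within)
      have "norm (z powr s) = (x + u * (X - x)) powr (1/2 + e)"
        unfolding zr using b s by (simp add: norm_of_real_powr del: of_real_add of_real_mult of_real_diff)
      also have "\<dots> \<le> X powr (1/2 + e)" using b e by (intro powr_mono2) auto
      finally show "norm ((s + 1) * z powr s) \<le> norm (s + 1) * X powr (1/2 + e)"
        by (simp add: norm_mult mult_left_mono)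
    qed auto
    also have "norm (complex_of_real X - of_real x) = 1" by (simp add: X_def)
    finally have "norm D \<le> norm (s + 1) * X powr (1/2 + e) / norm (s * (s + 1))"
      unfolding D_eq norm_divide by (intro divide_right_mono) auto
    also have "\<dots> = A" using s1' by (simp add: A_def norm_mult)
    finally show ?thesis .
  qed
  have DB: "norm D \<le> A * q"
  proof -
    have "norm ?N \<le> X powr (3/2 + e) + x powr (3/2 + e)"
      using norm_triangle_ineq4[of "of_real X powr (s + 1)" "of_real x powr (s + 1)"] X x s
      by (simp add: norm_of_real_powr)
    also have "\<dots> \<le> 2 * X powr (3/2 + e)" using x X e powr_mono2[of "3/2 + e" x X] by simp
    also have "X powr (3/2 + e) = X powr (1/2 + e) * X"
      using X powr_add[of X "1/2 + e" 1] by (simp add: powr_one)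
    finally have "norm D \<le> 2 * (X powr (1/2 + e) * X) / norm (s * (s + 1))"
      unfolding D_eq norm_divide by (intro divide_right_mono) auto
    also have "\<dots> \<le> 2 * (X powr (1/2 + e) * X) / (norm s * norm s)"
      using s0 s1 X unfolding norm_mult by (intro frac_le mult_left_mono mult_pos_pos) auto
    also have "\<dots> = A * q" by (simp add: A_def q_def)
    finally show ?thesis .
  qed
  have "norm D \<le> A * q powr e"
  proof (cases "q \<le> 1")
    case True
    have "q powr 1 \<le> q powr e" using True q0 e by (intro powr_mono') auto
    hence "A * q \<le> A * q powr e" using A0 q0 by (intro mult_left_mono) auto
    thus ?thesis using DB by linarith
  next
    case False
    have "1 \<le> q powr e" using False e by (intro ge_one_powr_ge_zero) auto
    hence "A * 1 \<le> A * q powr e" using A0 by (intro mult_left_mono) auto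
    thus ?thesis using DA by linarith
  qed
  thus ?thesis unfolding D_def A_def q_def X_def by simp
qed

section \<open>From the Riesz mean back to the Chebyshev function\<close>

definition chebyshev_psi :: "real \<Rightarrow> real" where
  "chebyshev_psi x = (\<Sum>n | real n \<le> x. mangoldt n)"

text \<open>This is the integral of \<open>chebyshev_psi\<close> from 0 to x, that is, x times the
  Riesz mean with weights 1 - n/x (for x > 0).\<close>

definition chebyshev_psi1 :: "real \<Rightarrow> real" where
  "chebyshev_psi1 x = (\<Sum>n | real n \<le> x. mangoldt n * (x - real n))"

text \<open>The difference is the average of the increasing function \<open>chebyshev_psi\<close>
  over an interval of length 1, hence lies between its values at the ends.\<close>

lemma chebyshev_psi1_diff_bounds:
  "chebyshev_psi x \<le> chebyshev_psi1 (x + 1) - chebyshev_psi1 x"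
  "chebyshev_psi1 (x + 1) - chebyshev_psi1 x \<le> chebyshev_psi (x + 1)"
proof -
  let ?A = "{n. real n \<le> x + 1}"
  have sub: "{n. real n \<le> x} \<subseteq> ?A" by auto
  have "chebyshev_psi1 x = (\<Sum>n\<in>?A. mangoldt n * max 0 (x - real n))"
    unfolding chebyshev_psi1_def by (rule sum.mono_neutral_cong_left[OF _ sub]) auto
  moreover have "chebyshev_psi1 (x + 1) = (\<Sum>n\<in>?A. mangoldt n * (x + 1 - real n))"
    by (simp add: chebyshev_psi1_def)
  ultimately have eq: "chebyshev_psi1 (x + 1) - chebyshev_psi1 x =
      (\<Sum>n\<in>?A. mangoldt n * (x + 1 - real n - max 0 (x - real n)))"
    by (simp add: sum_subtractf right_diff_distrib)
  have psi: "chebyshev_psi x = (\<Sum>n\<in>?A. mangoldt n * (if real n \<le> x then 1 else 0))"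
    unfolding chebyshev_psi_def by (rule sum.mono_neutral_cong_left[OF _ sub]) auto
  show "chebyshev_psi x \<le> chebyshev_psi1 (x + 1) - chebyshev_psi1 x"
    unfolding eq psi by (intro sum_mono mult_left_mono) (auto simp: mangoldt_nonneg max_def)
  have "chebyshev_psi (x + 1) = (\<Sum>n\<in>?A. mangoldt n * 1)" by (simp add: chebyshev_psi_def)
  thus "chebyshev_psi1 (x + 1) - chebyshev_psi1 x \<le> chebyshev_psi (x + 1)"
    unfolding eq by (simp only:) (intro sum_mono mult_left_mono, auto simp: mangoldt_nonneg max_def)
qed

lemma chebyshev_psi1_diff_estimate:
  assumes zeros: "\<And>s. 0 < Re s \<Longrightarrow> zf s = 0 \<Longrightarrow> Re s = 1 / 2"
  shows "\<exists>K>0. \<forall>x\<ge>exp 4. \<bar>chebyshev_psi1 (x + 1) - chebyshev_psi1 x - (x + 1/2)\<bar> \<le>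
     K * (sqrt (x + 1) * ln (x + 1) powr (5/2))"
proof -
  obtain C where C: "0 < C" and pw: "\<And>s. 1/2 < Re s \<Longrightarrow> Re s \<le> 2 \<Longrightarrow>
      norm (zf_logderiv s) \<le> C * ln (\<bar>Im s\<bar> + 2) / (Re s - 1/2)"
    using zf_logderiv_pointwise[OF zeros] by blast
  obtain K where K: "0 < K" and wint: "\<And>e. 0 < e \<Longrightarrow> e \<le> 1/4 \<Longrightarrow>
    (\<integral>\<^sup>+t. ennreal ((4 + norm (zf_logderiv (Complex (1/2 + e) t))) * norm (Complex (1/2 + e) t) powr (-1 - e)) \<partial>lborel)
      \<le> ennreal (K * e powr (-5/2))"
    using zf_logderiv_weighted_integral[OF zeros] by blast
  have main: "\<bar>chebyshev_psi1 (x + 1) - chebyshev_psi1 x - (x + 1/2)\<bar> \<le>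
     (exp 2 * K) * (sqrt (x + 1) * ln (x + 1) powr (5/2))" if x: "exp 4 \<le> x" for x
  proof -
    define X where "X = x + 1"
    \<comment> \<open>This makes \<open>X powr e\<close> equal to \<open>exp 1\<close>, so working
      to the right of the critical line costs only a constant. The condition x >= exp 4 ensures e <=
      1/4.\<close>
    define e where "e = 1 / ln X"
    define \<sigma> where "\<sigma> = 1/2 + e"
    have x0: "0 < x" using x exp_gt_zero[of 4] by linarith
    have X: "0 < X" "exp 4 \<le> X" using x x0 by (auto simp: X_def)
    have lnX: "4 \<le> ln X" using X by (simp add: ln_ge_iff)
    have e: "0 < e" "e \<le> 1/4" using lnX by (auto simp: e_def field_simps)
    define q where "q s = 1 / (s - 1) - zf_logderiv s" for s
    define D where "D s = of_real X * riesz_kernel X s - of_real x * riesz_kernel x s" for s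
    have int: "integrable lborel (\<lambda>t. q (Complex \<sigma> t) * riesz_kernel v (Complex \<sigma> t))" if "0 < v" for v
      unfolding q_def \<sigma>_def by (rule vline_integral_mangoldt_shift(1)[OF zeros pw C that e])
    have shift: "of_real (2 * pi * (\<Sum>n | real n \<le> v. mangoldt n * (1 - real n / v))) =
      of_real (pi * v) + vline_integral \<sigma> (\<lambda>s. q s * riesz_kernel v s)" if "0 < v" for v
      unfolding q_def \<sigma>_def by (rule vline_integral_mangoldt_shift(2)[OF zeros pw C that e])
    note int1 = int[OF x0] and int2 = int[OF X(1)]
    have psi1: "of_real (2 * pi * chebyshev_psi1 v) = of_real (pi * v^2) + of_real v * vline_integral \<sigma> (\<lambda>s. q s * riesz_kernel v s)"
      if v: "0 < v" for v
    proof -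
      have "chebyshev_psi1 v = v * (\<Sum>n | real n \<le> v. mangoldt n * (1 - real n / v))"
        unfolding chebyshev_psi1_def sum_distrib_left using v by (intro sum.cong) (auto simp: field_simps)
      hence "complex_of_real (2 * pi * chebyshev_psi1 v) = of_real v * of_real (2 * pi * (\<Sum>n | real n \<le> v. mangoldt n * (1 - real n / v)))"
        unfolding of_real_mult[symmetric] by (simp only: mult_ac)
      also have "\<dots> = of_real v * of_real (pi * v) + of_real v * vline_integral \<sigma> (\<lambda>s. q s * riesz_kernel v s)"
        unfolding shift[OF v] by (rule distrib_left)
      also have "of_real v * complex_of_real (pi * v) = of_real (pi * v^2)"
        by (simp add: power2_eq_square)
      finally show ?thesis .
    qed
    let ?d = "chebyshev_psi1 X - chebyshev_psi1 x - (x + 1/2)"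
    define E where "E = vline_integral \<sigma> (\<lambda>s. q s * D s)"
    have intD: "integrable lborel (\<lambda>t. q (Complex \<sigma> t) * D (Complex \<sigma> t))"
    proof -
      have "integrable lborel (\<lambda>t. of_real X * (q (Complex \<sigma> t) * riesz_kernel X (Complex \<sigma> t)) -
          of_real x * (q (Complex \<sigma> t) * riesz_kernel x (Complex \<sigma> t)))"
        by (intro Bochner_Integration.integrable_diff integrable_mult_right int1 int2)
      thus ?thesis by (simp add: D_def algebra_simps)
    qed
    have "E = (\<integral>t. of_real X * (q (Complex \<sigma> t) * riesz_kernel X (Complex \<sigma> t)) -
          of_real x * (q (Complex \<sigma> t) * riesz_kernel x (Complex \<sigma> t)) \<partial>lborel)"
      unfolding E_def vline_integral_def D_def by (simp add: algebra_simps)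
    also have "\<dots> = of_real X * vline_integral \<sigma> (\<lambda>s. q s * riesz_kernel X s) - of_real x * vline_integral \<sigma> (\<lambda>s. q s * riesz_kernel x s)"
      unfolding vline_integral_def
      by (subst Bochner_Integration.integral_diff) (simp_all add: int1 int2)
    also have "\<dots> = of_real (2 * pi * chebyshev_psi1 X) - of_real (pi * X^2) - (of_real (2 * pi * chebyshev_psi1 x) - of_real (pi * x^2))"
      unfolding psi1[OF X(1)] psi1[OF x0] by simp
    \<comment> \<open>The main terms combine to ((x + 1)^2 - x^2) / 2 = x + 1/2.\<close>
    also have "\<dots> = of_real (2 * pi * (?d))"
      unfolding of_real_diff[symmetric] by (rule arg_cong[of _ _ of_real]) (simp add: X_def power2_eq_square algebra_simps)
    finally have E_eq: "E = of_real (2 * pi * (?d))" .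
    have c0: "0 \<le> 2 * exp 2 * sqrt X" using X by simp
    have D_le: "norm (D (Complex \<sigma> t)) \<le> (2 * exp 2 * sqrt X) * norm (Complex \<sigma> t) powr (-1 - e)" for t
    proof -
      let ?s = "Complex \<sigma> t"
      have s0: "0 < norm ?s" using e by (auto simp: \<sigma>_def complex_eq_iff)
      have "X \<noteq> 1" using lnX by auto
      hence Xe: "X powr e = exp 1" using X by (simp add: powr_def e_def)
      have "norm (D ?s) \<le> X powr (1/2 + e) / norm ?s * (2 * X / norm ?s) powr e"
        unfolding D_def X_def using x0 e by (intro norm_riesz_kernel_diff_le) (auto simp: \<sigma>_def)
      also have "X powr (1/2 + e) = sqrt X * exp 1" using X Xe by (simp add: powr_add powr_half_sqrt)
      also have "(2 * X / norm ?s) powr e = 2 powr e * exp 1 / norm ?s powr e"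
        using X Xe by (simp add: powr_divide powr_mult)
      also have "sqrt X * exp 1 / norm ?s * (2 powr e * exp 1 / norm ?s powr e) =
         2 powr e * (exp 1 * exp 1 * sqrt X) * (1 / (norm ?s * norm ?s powr e))" by simp
      also have "exp 1 * exp 1 = exp (2::real)" by (simp add: exp_add[symmetric])
      also have "1 / (norm ?s * norm ?s powr e) = norm ?s powr (-1 - e)"
      proof -
        have "- 1 - e = - (1 + e)" by simp
        hence "norm ?s powr (-1 - e) = 1 / norm ?s powr (1 + e)" by (simp only: powr_minus_divide)
        thus ?thesis using s0 by (simp add: powr_add powr_one)
      qed
      also have "2 powr e * (exp 2 * sqrt X) * norm ?s powr (-1 - e) \<le> 2 powr 1 * (exp 2 * sqrt X) * norm ?s powr (-1 - e)"
        using e X by (intro mult_right_mono powr_mono) auto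
      finally show ?thesis by simp
    qed
    have q_le: "norm (q (Complex \<sigma> t)) \<le> 4 + norm (zf_logderiv (Complex \<sigma> t))" for t
    proof -
      \<comment> \<open>As e <= 1/4, the line keeps distance at least 1/4 from the pole. This is the
        4 in the weight.\<close>
      have "1/4 \<le> norm (Complex \<sigma> t - 1)"
        using abs_Re_le_cmod[of "Complex \<sigma> t - 1"] e by (simp add: \<sigma>_def)
      hence "norm (1 / (Complex \<sigma> t - 1)) \<le> 1 / (1/4)"
        unfolding norm_divide norm_one by (intro frac_le) auto
      thus ?thesis unfolding q_def
        using norm_triangle_ineq4[of "1 / (Complex \<sigma> t - 1)" "zf_logderiv (Complex \<sigma> t)"] by simp
    qed
    let ?w = "\<lambda>t. (4 + norm (zf_logderiv (Complex \<sigma> t))) * norm (Complex \<sigma> t) powr (-1 - e)"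
    let ?c = "2 * exp 2 * sqrt X" and ?qD = "\<lambda>t. q (Complex \<sigma> t) * D (Complex \<sigma> t)"
    have "ennreal (norm E) \<le> (\<integral>\<^sup>+t. ennreal (norm (?qD t)) \<partial>lborel)"
      unfolding E_def vline_integral_def by (rule integral_norm_bound_ennreal[OF intD])
    also have "\<dots> \<le> (\<integral>\<^sup>+t. ennreal (?c) * ennreal (?w t) \<partial>lborel)"
    proof (rule nn_integral_mono)
      fix t
      have "norm (?qD t) \<le>
        (4 + norm (zf_logderiv (Complex \<sigma> t))) * ((?c) * norm (Complex \<sigma> t) powr (-1 - e))"
        unfolding norm_mult by (intro mult_mono q_le D_le) auto
      also have "\<dots> = (?c) * (?w t)"
        by (simp only: mult_ac)
      finally show "ennreal (norm (?qD t)) \<le>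
        ennreal (?c) * ennreal (?w t)"
        using c0 by (subst ennreal_mult[symmetric]) (auto intro: ennreal_leI)
    qed
    also have "\<dots> \<le> ennreal (?c) *
       (\<integral>\<^sup>+t. ennreal (?w t) \<partial>lborel)"
    proof (rule eq_refl, rule nn_integral_cmult)
      have "1/2 < \<sigma>" using e by (simp add: \<sigma>_def)
      from measurable_compose[OF zf_logderiv_weight_measurable(2)[OF zeros this] measurable_ennreal]
      show "(\<lambda>t. ennreal (?w t)) \<in> borel_measurable lborel" .
    qed
    also have "\<dots> \<le> ennreal (?c) * ennreal (K * e powr (-5/2))"
      using wint[OF e] unfolding \<sigma>_def by (rule mult_left_mono) simp
    also have "\<dots> = ennreal (?c * (K * e powr (-5/2)))"
      using c0 K by (intro ennreal_mult[symmetric]) auto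
    finally have "norm E \<le> ?c * (K * e powr (-5/2))"
      using c0 K by (subst (asm) ennreal_le_iff) auto
    also have "e powr (-5/2) = ln X powr (5/2)"
      using lnX by (simp add: e_def powr_divide powr_minus_divide)
    finally have "2 * pi * \<bar>?d\<bar> \<le> ?c * (K * ln X powr (5/2))"
      unfolding E_eq norm_of_real by (simp add: abs_mult)
    moreover have "2 * \<bar>?d\<bar> \<le> 2 * pi * \<bar>?d\<bar>"
      using pi_ge_two by (intro mult_right_mono) auto
    ultimately have "2 * \<bar>?d\<bar> \<le> 2 * ((exp 2 * K) * (sqrt X * ln X powr (5/2)))"
      by (simp add: mult_ac)
    thus ?thesis unfolding X_def by simp
  qed
  show ?thesis using K main by (intro exI[of _ "exp 2 * K"]) auto
qed

theorem chebyshev_psi_estimate: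
  assumes zeros: "\<And>s. 0 < Re s \<Longrightarrow> zf s = 0 \<Longrightarrow> Re s = 1 / 2"
  shows "\<exists>C>0. \<forall>x\<ge>exp 5. \<bar>chebyshev_psi x - x\<bar> \<le> C * (sqrt x * ln x powr (5/2))"
proof -
  obtain K where K: "0 < K" and est: "\<And>x. exp 4 \<le> x \<Longrightarrow> \<bar>chebyshev_psi1 (x + 1) - chebyshev_psi1 x - (x + 1/2)\<bar> \<le>
     K * (sqrt (x + 1) * ln (x + 1) powr (5/2))" using chebyshev_psi1_diff_estimate[OF zeros] by blast
  have "\<bar>chebyshev_psi x - x\<bar> \<le> (16 * K + 1) * (sqrt x * ln x powr (5/2))" if x: "exp 5 \<le> x" for x
  proof -
    define F where "F = sqrt x * ln x powr (5/2)"
    have e1: "(2::real) \<le> exp 1" using exp_ge_add_one_self[of 1] by simp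
    have e4: "1 \<le> exp (4::real)" by simp
    have "exp (5::real) = exp 4 * exp 1" by (simp add: exp_add[symmetric])
    moreover have "exp 4 * 2 \<le> exp 4 * exp (1::real)" using e1 by (intro mult_left_mono) auto
    \<comment> \<open>The lower bound for \<psi>(x) uses the difference estimate at x - 1, which
      must still be at least exp 4; hence exp 5 in the statement.\<close>
    ultimately have x4: "exp 4 + 1 \<le> x" using x e4 by linarith
    hence x2: "2 \<le> x" using e4 by linarith
    have lnx: "5 \<le> ln x" using x x2 by (simp add: ln_ge_iff)
    have F1: "1 \<le> F"
    proof -
      have "1 * 1 \<le> sqrt x * ln x powr (5/2)" using x2 lnx by (intro mult_mono) (auto intro: ge_one_powr_ge_zero)
      thus ?thesis by (simp add: F_def)
    qed
    have "sqrt (x + 1) * ln (x + 1) powr (5/2) \<le> (2 * sqrt x) * (8 * ln x powr (5/2))"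
    proof (intro mult_mono)
      have "sqrt (x + 1) \<le> sqrt (4 * x)" using x2 by (intro real_sqrt_le_mono) auto
      thus "sqrt (x + 1) \<le> 2 * sqrt x" by (simp add: real_sqrt_mult)
      have "ln (x + 1) \<le> ln (x^2)"
      proof (rule ln_mono)
        have "2 * x \<le> x * x" using x2 by (intro mult_right_mono) auto
        thus "x + 1 \<le> x^2" using x2 unfolding power2_eq_square by linarith
      qed (use x2 in auto)
      also have "\<dots> = 2 * ln x" using x2 by (simp add: ln_realpow)
      finally have "ln (x + 1) powr (5/2) \<le> (2 * ln x) powr (5/2)" using x2 by (intro powr_mono2) auto
      also have "\<dots> = 2 powr (5/2) * ln x powr (5/2)" using lnx by (simp add: powr_mult)
      also have "\<dots> \<le> 2 powr 3 * ln x powr (5/2)" by (intro mult_right_mono powr_mono) auto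
      also have "(2::real) powr 3 = 8" by (simp add: powr_numeral)
      finally show "ln (x + 1) powr (5/2) \<le> 8 * ln x powr (5/2)" .
    qed (use x2 in auto)
    hence up: "sqrt (x + 1) * ln (x + 1) powr (5/2) \<le> 16 * F" by (simp add: F_def)
    have "chebyshev_psi x \<le> x + 1/2 + K * (sqrt (x + 1) * ln (x + 1) powr (5/2))"
      using chebyshev_psi1_diff_bounds(1)[of x] est[of x] x4 by linarith
    also have "\<dots> \<le> x + 1/2 + K * (16 * F)" using up K by (intro add_left_mono mult_left_mono) auto
    finally have 1: "chebyshev_psi x - x \<le> (16 * K + 1) * F" using F1 by (simp add: algebra_simps)
    have "x - 1/2 - K * F \<le> chebyshev_psi x"
      using chebyshev_psi1_diff_bounds(2)[of "x - 1"] est[of "x - 1"] x4 unfolding F_def by simp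
    moreover have "0 \<le> K * F" using K F1 by simp
    ultimately have 2: "x - chebyshev_psi x \<le> (16 * K + 1) * F" using F1 by (simp add: algebra_simps)
    show ?thesis using 1 2 unfolding F_def by linarith
  qed
  thus ?thesis using K by (intro exI[of _ "16 * K + 1"]) auto
qed

section \<open>Primes\<close>

definition chebyshev_theta :: "real \<Rightarrow> real" where
  "chebyshev_theta x = (\<Sum>p | prime p \<and> real p \<le> x. ln (real p))"

lemma finite_primes_le_real [simp]: "finite {p::nat. prime p \<and> real p \<le> x}"
  by (rule finite_subset[OF _ finite_nat_le_real[of x]]) auto

text \<open>A proper prime power up to x has its prime at most sqrt x. For a fixed prime p at most
  ln x / ln p exponents occur, each weighted ln p, so each prime contributes at most ln x.\<close>

lemma chebyshev_psi_minus_theta: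
  assumes x: "1 \<le> x"
  shows "chebyshev_psi x - chebyshev_theta x \<le> sqrt x * ln x"
proof -
  define S where "S = {n. real n \<le> x \<and> primepow n \<and> \<not> prime n}"
  define T where "T = {p::nat. prime p \<and> p \<le> nat \<lfloor>sqrt x\<rfloor>}"
  have finS: "finite S" unfolding S_def by (rule finite_subset[OF _ finite_nat_le_real[of x]]) auto
  have finT: "finite T" unfolding T_def by (rule finite_subset[of _ "{..nat \<lfloor>sqrt x\<rfloor>}"]) auto
  have "chebyshev_psi x = (\<Sum>n\<in>S \<union> {p. prime p \<and> real p \<le> x}. mangoldt n)"
    unfolding chebyshev_psi_def by (rule sum.mono_neutral_right) (auto simp: S_def mangoldt_def)
  also have "\<dots> = (\<Sum>n\<in>S. mangoldt n) + (\<Sum>p | prime p \<and> real p \<le> x. mangoldt p)"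
    by (rule sum.union_disjoint) (use finS in \<open>auto simp: S_def\<close>)
  also have "(\<Sum>p | prime p \<and> real p \<le> x. mangoldt p) = chebyshev_theta x"
    unfolding chebyshev_theta_def by (intro sum.cong) auto
  finally have eq: "chebyshev_psi x - chebyshev_theta x = (\<Sum>n\<in>S. mangoldt n)" by simp
  have lnx: "0 \<le> ln x" using x by simp
  have rep: "\<exists>k\<ge>2. n = aprimedivisor n ^ k \<and> prime (aprimedivisor n)" if n: "n \<in> S" for n
  proof -
    from n obtain p k where pk: "prime p" "0 < k" "n = p ^ k" by (auto simp: S_def primepow_def)
    have "aprimedivisor n = p" using pk by (simp add: aprimedivisor_prime_power)
    moreover have "k \<noteq> 1" using n pk by (auto simp: S_def)
    ultimately show ?thesis using pk by (intro exI[of _ k]) auto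
  qed
  have img: "aprimedivisor ` S \<subseteq> T"
  proof
    fix p assume "p \<in> aprimedivisor ` S"
    then obtain n where n: "n \<in> S" "p = aprimedivisor n" by auto
    from rep[OF n(1)] n(2) obtain k where k: "2 \<le> k" "n = p ^ k" "prime p" by auto
    have "real p ^ 2 \<le> real p ^ k" using k prime_gt_0_nat[OF k(3)] by (intro power_increasing) auto
    also have "\<dots> \<le> x" using n(1) k(2) by (simp add: S_def)
    finally have "real p \<le> sqrt x" by (rule real_le_rsqrt)
    thus "p \<in> T" using k(3) by (auto simp: T_def le_nat_floor)
  qed
  have fiber: "(\<Sum>n | n \<in> S \<and> aprimedivisor n = p. mangoldt n) \<le> ln x" if p: "p \<in> T" for p
  proof -
    have pp: "prime p" using p by (simp add: T_def)
    have lnp: "0 < ln (real p)" using prime_gt_1_nat[OF pp] by simp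
    define m where "m = nat \<lfloor>ln x / ln (real p)\<rfloor>"
    have sub: "{n \<in> S. aprimedivisor n = p} \<subseteq> (\<lambda>k. p ^ k) ` {1..m}"
    proof
      fix n assume n: "n \<in> {n \<in> S. aprimedivisor n = p}"
      then obtain k where k: "2 \<le> k" "n = p ^ k" using rep[of n] by auto
      have "real p ^ k \<le> x" using n k(2) by (simp add: S_def)
      hence "ln (real p ^ k) \<le> ln x" using prime_gt_0_nat[OF pp] x by (intro ln_mono) auto
      hence "real k * ln (real p) \<le> ln x" using prime_gt_0_nat[OF pp] by (simp add: ln_realpow)
      hence "real k \<le> ln x / ln (real p)" using lnp by (simp add: field_simps)
      hence "k \<le> m" unfolding m_def by (rule le_nat_floor)
      thus "n \<in> (\<lambda>k. p ^ k) ` {1..m}" using k by auto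
    qed
    have card: "card {n \<in> S. aprimedivisor n = p} \<le> m"
      using card_mono[OF _ sub] card_image_le[of "{1..m}" "\<lambda>k. p ^ k"] by simp
    have "(\<Sum>n | n \<in> S \<and> aprimedivisor n = p. mangoldt n) = (\<Sum>n | n \<in> S \<and> aprimedivisor n = p. ln (real p))"
      by (intro sum.cong) (auto simp: S_def mangoldt_def)
    also have "\<dots> = real (card {n \<in> S. aprimedivisor n = p}) * ln (real p)" by simp
    also have "\<dots> \<le> real m * ln (real p)" using card lnp by (intro mult_right_mono) auto
    also have "\<dots> \<le> (ln x / ln (real p)) * ln (real p)"
      using lnp lnx unfolding m_def by (intro mult_right_mono of_nat_floor divide_nonneg_nonneg) auto
    also have "\<dots> = ln x" using lnp by simp
    finally show ?thesis .
  qed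
  have "(\<Sum>n\<in>S. mangoldt n) = (\<Sum>p\<in>T. \<Sum>n | n \<in> S \<and> aprimedivisor n = p. mangoldt n :: real)"
    by (rule sum.group[symmetric, OF finS finT img])
  also have "\<dots> \<le> (\<Sum>p\<in>T. ln x)" by (intro sum_mono fiber)
  also have "\<dots> = real (card T) * ln x" by simp
  also have "\<dots> \<le> sqrt x * ln x"
  proof (rule mult_right_mono[OF _ lnx])
    have "T \<subseteq> {1..nat \<lfloor>sqrt x\<rfloor>}" unfolding T_def using prime_gt_0_nat by (auto simp: Suc_le_eq)
    hence "card T \<le> nat \<lfloor>sqrt x\<rfloor>" using card_mono[of "{1..nat \<lfloor>sqrt x\<rfloor>}" T] by simp
    hence "real (card T) \<le> real (nat \<lfloor>sqrt x\<rfloor>)" by simp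
    also have "\<dots> \<le> sqrt x" using x by (intro of_nat_floor) auto
    finally show "real (card T) \<le> sqrt x" .
  qed
  finally show ?thesis unfolding eq .
qed

lemma prime_pi_interval_le:
  assumes x: "1 < x" and y: "0 \<le> y"
  shows "(real (prime_pi (x + y)) - real (prime_pi x)) * ln x \<le> chebyshev_psi (x + y) - chebyshev_psi x"
proof -
  let ?A = "{p::nat. prime p \<and> real p \<le> x}" and ?B = "{p::nat. prime p \<and> real p \<le> x + y}"
  have sub: "?A \<subseteq> ?B" using y by auto
  have "card (?B - ?A) = card ?B - card ?A" by (intro card_Diff_subset sub) simp
  moreover have "card ?A \<le> card ?B" by (intro card_mono sub) simp
  ultimately have c: "real (prime_pi (x + y)) - real (prime_pi x) = real (card (?B - ?A))"
    unfolding prime_pi_def by (simp add: of_nat_diff)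
  have "real (card (?B - ?A)) * ln x = (\<Sum>p\<in>?B - ?A. ln x)" by simp
  also have "\<dots> \<le> (\<Sum>p\<in>?B - ?A. mangoldt p)"
  proof (rule sum_mono)
    fix p assume p: "p \<in> ?B - ?A"
    hence "ln x \<le> ln (real p)" using x by (intro ln_mono) auto
    thus "ln x \<le> mangoldt p" using p by simp
  qed
  also have "\<dots> \<le> (\<Sum>n\<in>{n. real n \<le> x + y} - {n. real n \<le> x}. mangoldt n)"
    by (intro sum_mono2) (auto simp: mangoldt_nonneg)
  also have "\<dots> = chebyshev_psi (x + y) - chebyshev_psi x"
    unfolding chebyshev_psi_def by (rule sum_diff) (use y in auto)
  finally show ?thesis unfolding c .
qed

lemma chebyshev_theta_le_prime_pi:
  assumes y: "1 \<le> y"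
  shows "chebyshev_theta y \<le> real (prime_pi y) * ln y"
proof -
  have "chebyshev_theta y \<le> (\<Sum>p | prime p \<and> real p \<le> y. ln y)"
    unfolding chebyshev_theta_def
  proof (rule sum_mono)
    fix p :: nat assume p: "p \<in> {p. prime p \<and> real p \<le> y}"
    hence "0 < p" using prime_gt_0_nat by auto
    thus "ln (real p) \<le> ln y" using p by (intro ln_mono) auto
  qed
  thus ?thesis by (simp add: prime_pi_def)
qed

text \<open>The second-order gain for large y: each of the primes up to y/2 has ln 2 to spare below
  ln y. Their number is bounded below by \<theta>(y/2) / ln y, so that the estimate for \<psi> can
  be applied again.\<close>

lemma prime_pi_lower_improved:
  assumes y: "2 \<le> y"
  shows "chebyshev_theta y + ln 2 * (chebyshev_theta (y / 2) / ln y) \<le> real (prime_pi y) * ln y"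
proof -
  let ?A = "{p::nat. prime p \<and> real p \<le> y / 2}" and ?B = "{p::nat. prime p \<and> real p \<le> y}"
  have sub: "?A \<subseteq> ?B" using y by auto
  have lny: "0 < ln y" using y by simp
  have "(\<Sum>p\<in>?B. ln (real p) + (if real p \<le> y / 2 then ln 2 else 0)) \<le> (\<Sum>p\<in>?B. ln y)"
  proof (rule sum_mono)
    fix p :: nat assume p: "p \<in> ?B"
    hence p0: "0 < real p" using prime_gt_0_nat by auto
    show "ln (real p) + (if real p \<le> y / 2 then ln 2 else 0) \<le> ln y"
    proof (cases "real p \<le> y / 2")
      case True
      have "ln (real p) + ln 2 = ln (real p * 2)" using p0 by (simp add: ln_mult)
      also have "\<dots> \<le> ln y" using True p0 by (intro ln_mono) auto
      finally show ?thesis using True by simp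
    next
      case False
      thus ?thesis using p p0 by (auto intro: ln_mono)
    qed
  qed
  also have "\<dots> = real (prime_pi y) * ln y" by (simp add: prime_pi_def)
  also have "(\<Sum>p\<in>?B. ln (real p) + (if real p \<le> y / 2 then ln 2 else 0)) =
     chebyshev_theta y + (\<Sum>p\<in>?B. if real p \<le> y / 2 then ln 2 else 0)"
    by (simp add: sum.distrib chebyshev_theta_def)
  also have "(\<Sum>p\<in>?B. if real p \<le> y / 2 then ln 2 else 0) = (\<Sum>p\<in>?A. ln (2::real))"
    by (rule sum.mono_neutral_cong_right[OF _ sub]) auto
  also have "\<dots> = ln 2 * real (prime_pi (y / 2))" by (simp add: prime_pi_def)
  finally have 1: "chebyshev_theta y + ln 2 * real (prime_pi (y / 2)) \<le> real (prime_pi y) * ln y" .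
  have "chebyshev_theta (y / 2) \<le> real (prime_pi (y / 2)) * ln (y / 2)"
    using y by (intro chebyshev_theta_le_prime_pi) auto
  also have "\<dots> \<le> real (prime_pi (y / 2)) * ln y" using y by (intro mult_left_mono ln_mono) auto
  finally have "chebyshev_theta (y / 2) / ln y \<le> real (prime_pi (y / 2))"
    using lny by (simp add: field_simps)
  hence "ln 2 * (chebyshev_theta (y / 2) / ln y) \<le> ln 2 * real (prime_pi (y / 2))"
    by (intro mult_left_mono) auto
  thus ?thesis using 1 by linarith
qed

lemma eventually_all_ge:
  fixes P :: "real \<Rightarrow> bool"
  assumes "eventually P at_top"
  shows "\<exists>N. \<forall>x\<ge>N. P x"
  using assms by (simp add: eventually_at_top_linorder)

lemma prime_pi_subadditive_of_psi_estimate: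
  assumes C: "0 < C" and est: "\<And>x. X1 \<le> x \<Longrightarrow> \<bar>chebyshev_psi x - x\<bar> \<le> C * (sqrt x * ln x powr (5/2))"
  shows "\<exists>X0::real. X0 \<ge> 2 \<and> (\<forall>x::real. x \<ge> X0 \<longrightarrow>
      (\<forall>y::real. x powr (1 / 2) * ln x ^ 3 \<le> y \<and> y \<le> x \<longrightarrow>
        prime_pi (x + y) < prime_pi x + prime_pi y))"
proof -
  \<comment> \<open>The extra 1 absorbs the difference between \<psi> and \<theta>, which is at most
    sqrt y ln y.\<close>
  define D where "D = C + 1"
  have D: "0 < D" using C by (simp add: D_def)
  define F where "F y = D * (sqrt y * ln y powr (5/2))" for y
  \<comment> \<open>The four limits bring each error below one hundredth of what it is compared
    with: \<open>F\<close> against y, \<open>E\<close> against y, \<open>E\<close> against y / ln y,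
    and \<open>F\<close> against y / ln y. The factors 16 * C and 32 * C are the constants of
    \<open>E\<close> in terms of x and of y.\<close>
  have l1: "eventually (\<lambda>y. sqrt y * ln y powr (5/2) / y < 1 / (100 * D)) at_top"
    by (rule order_tendstoD(2)[of _ 0]) (real_asymp, use D in simp)
  have l2: "eventually (\<lambda>x::real. 1 / sqrt (ln x) < 1 / (100 * (16 * C))) at_top"
    by (rule order_tendstoD(2)[of _ 0]) (real_asymp, use C in simp)
  have l3: "eventually (\<lambda>y. y powr (5/9) * ln y powr (5/2) * ln y / y < 1 / (100 * (32 * C))) at_top"
    by (rule order_tendstoD(2)[of _ 0]) (real_asymp, use C in simp)
  have l4: "eventually (\<lambda>y. sqrt y * ln y powr (5/2) * ln y / y < 1 / (100 * D)) at_top"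
    by (rule order_tendstoD(2)[of _ 0]) (real_asymp, use D in simp)
  have "eventually (\<lambda>y. sqrt y * ln y powr (5/2) / y < 1 / (100 * D) \<and>
     y powr (5/9) * ln y powr (5/2) * ln y / y < 1 / (100 * (32 * C)) \<and>
     sqrt y * ln y powr (5/2) * ln y / y < 1 / (100 * D) \<and> X1 \<le> y \<and> exp 1 \<le> y) at_top"
    (is "eventually ?P _")
    using l1 l3 l4 eventually_ge_at_top[of X1] eventually_ge_at_top[of "exp 1"] by eventually_elim auto
  then obtain N where "\<And>y. N \<le> y \<Longrightarrow> ?P y" using eventually_all_ge by blast
  note N = this[THEN conjunct1] this[THEN conjunct2, THEN conjunct1]
    this[THEN conjunct2, THEN conjunct2, THEN conjunct1]
    this[THEN conjunct2, THEN conjunct2, THEN conjunct2, THEN conjunct1]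
    this[THEN conjunct2, THEN conjunct2, THEN conjunct2, THEN conjunct2]
  \<comment> \<open>Since y >= sqrt x >= 2 * N, the estimates are also available at y/2.\<close>
  have "eventually (\<lambda>x::real. 1 / sqrt (ln x) < 1 / (100 * (16 * C)) \<and> 2 * N \<le> sqrt x \<and> N \<le> x \<and> exp 1 \<le> x \<and> 2 \<le> x) at_top"
  proof -
    have "filterlim (\<lambda>x::real. sqrt x) at_top at_top" by real_asymp
    hence "eventually (\<lambda>x::real. 2 * N \<le> sqrt x) at_top" by (simp add: filterlim_at_top)
    thus ?thesis using l2 eventually_ge_at_top[of N] eventually_ge_at_top[of "exp 1"] eventually_ge_at_top[of 2]
      by eventually_elim auto
  qed
  then obtain X0 where X0: "\<And>x. X0 \<le> x \<Longrightarrow> 1 / sqrt (ln x) < 1 / (100 * (16 * C)) \<and> 2 * N \<le> sqrt x \<and> N \<le> x \<and> exp 1 \<le> x \<and> 2 \<le> x"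
    using eventually_all_ge by blast
  have theta_low: "y - F y \<le> chebyshev_theta y" if y: "N \<le> y" for y
  proof -
    have y1: "1 \<le> y" using N(5)[OF y] exp_ge_add_one_self[of 1] by simp
    have lny: "1 \<le> ln y" using N(5)[OF y] y1 by (simp add: ln_ge_iff)
    have "ln y powr 1 \<le> ln y powr (5/2)" using lny by (intro powr_mono) auto
    hence "sqrt y * ln y \<le> sqrt y * ln y powr (5/2)" using lny y1 by (intro mult_left_mono) auto
    moreover have "y - C * (sqrt y * ln y powr (5/2)) \<le> chebyshev_psi y" using est[OF N(4)[OF y]] by linarith
    ultimately show ?thesis using chebyshev_psi_minus_theta[OF y1] unfolding F_def D_def
      by (simp add: distrib_right)
  qed
  have main: "prime_pi (x + y) < prime_pi x + prime_pi y"
    if x: "X0 \<le> x" and y: "x powr (1/2) * ln x ^ 3 \<le> y" "y \<le> x" for x y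
  proof -
    note x_facts = X0[OF x]
    define L where "L = ln x"
    define l where "l = ln y"
    have x2: "2 \<le> x" and xe: "exp 1 \<le> x" using x_facts by auto
    have L1: "1 \<le> L" unfolding L_def using xe x2 by (simp add: ln_ge_iff)
    have sq: "x powr (1/2) = sqrt x" using x2 by (simp add: powr_half_sqrt)
    have "sqrt x * 1 \<le> sqrt x * L ^ 3" using L1 x2 by (intro mult_left_mono one_le_power) auto
    hence sy: "sqrt x \<le> y" using y(1) unfolding sq L_def by linarith
    hence yN2: "2 * N \<le> y" using x_facts by linarith
    have sx1: "1 \<le> sqrt x" using x2 by simp
    have y0: "1 \<le> y" using sy sx1 by linarith
    have yN: "N \<le> y" "N \<le> y / 2" using yN2 y0 by linarith+
    have ye: "exp 1 \<le> y" using N(5)[OF yN(1)] .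
    have y2: "2 \<le> y" using ye exp_ge_add_one_self[of 1] by linarith
    have l1': "1 \<le> l" unfolding l_def using ye y0 by (simp add: ln_ge_iff)
    have lL: "l \<le> L" unfolding l_def L_def using y(2) y0 by (intro ln_mono) auto
    \<comment> \<open>16 = 15 + 1: \<psi>(x + y) contributes 15/8 * 8, from sqrt (x + y) <= 15/8
      sqrt x and (2 L)^(5/2) <= 8 L^(5/2), and \<psi>(x) contributes 1.\<close>
    define E where "E = 16 * C * (sqrt x * L powr (5/2))"
    have psi_le: "chebyshev_psi (x + y) - chebyshev_psi x \<le> y + E"
    proof -
      have Nx: "X1 \<le> x" "X1 \<le> x + y" using N(4)[of x] N(4)[of "x + y"] x_facts y0 by auto
      have "ln (x + y) \<le> ln (x * x)"
      proof (rule ln_mono)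
        have "x * 2 \<le> x * x" using x2 by (intro mult_left_mono) auto
        thus "x + y \<le> x * x" using y(2) by linarith
      qed (use x2 y0 in auto)
      also have "\<dots> = 2 * L" using x2 by (simp add: L_def ln_mult)
      finally have "ln (x + y) powr (5/2) \<le> (2 * L) powr (5/2)" using x2 y0 by (intro powr_mono2) auto
      also have "\<dots> = 2 powr (5/2) * L powr (5/2)" using L1 by (simp add: powr_mult)
      also have "\<dots> \<le> 2 powr 3 * L powr (5/2)" by (intro mult_right_mono powr_mono) auto
      finally have a: "ln (x + y) powr (5/2) \<le> 8 * L powr (5/2)" by (simp add: powr_numeral)
      have "sqrt (x + y) \<le> sqrt ((15/8)^2 * x)"
        using y x2 by (intro real_sqrt_le_mono) (simp add: power2_eq_square)
      also have "\<dots> = 15/8 * sqrt x" by (simp add: real_sqrt_mult)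
      finally have b: "sqrt (x + y) \<le> 15/8 * sqrt x" .
      have "sqrt (x + y) * ln (x + y) powr (5/2) \<le> (15/8 * sqrt x) * (8 * L powr (5/2))"
        using a b x2 y0 by (intro mult_mono) auto
      hence "C * (sqrt (x + y) * ln (x + y) powr (5/2)) \<le> C * ((15/8 * sqrt x) * (8 * L powr (5/2)))"
        using C by (intro mult_left_mono) auto
      hence c: "C * (sqrt (x + y) * ln (x + y) powr (5/2)) \<le> 15 * (C * (sqrt x * L powr (5/2)))" by simp
      have d: "C * (sqrt x * ln x powr (5/2)) = C * (sqrt x * L powr (5/2))" by (simp add: L_def)
      have "chebyshev_psi (x + y) \<le> x + y + 15 * (C * (sqrt x * L powr (5/2)))" using est[OF Nx(2)] c by linarith
      moreover have "x - C * (sqrt x * L powr (5/2)) \<le> chebyshev_psi x" using est[OF Nx(1)] d by linarith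
      ultimately show ?thesis unfolding E_def by (simp add: algebra_simps)
    qed
    have E0: "0 \<le> E" unfolding E_def using C x2 by simp
    have piL: "real (prime_pi (x + y)) - real (prime_pi x) \<le> (y + E) / L"
      using prime_pi_interval_le[of x y] psi_le x2 y0 L1 unfolding L_def[symmetric] by (simp add: field_simps)
    have E_small: "E \<le> y / 100"
    proof -
      \<comment> \<open>The saved half logarithm: the factor 1 / sqrt L tends to 0 and eventually
        beats the constant 16 * C, whatever C is.\<close>
      have "L powr (5/2) = L ^ 3 * (1 / sqrt L)"
        using L1 powr_diff[of L 3 "1/2"] by (simp add: powr_half_sqrt powr_numeral)
      hence "E = 16 * C * (sqrt x * L ^ 3) * (1 / sqrt L)" unfolding E_def by simp
      also have "\<dots> \<le> 16 * C * y * (1 / (100 * (16 * C)))"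
        using y(1) x_facts C x2 L1 y0 unfolding sq L_def by (intro mult_mono) auto
      also have "\<dots> = y / 100" using C by simp
      finally show ?thesis .
    qed
    have F_small: "F y \<le> y / 100"
      using N(1)[OF yN(1)] D y0 unfolding F_def by (simp add: field_simps)
    \<comment> \<open>If l <= 9/10 L, the ratio of the logarithms leaves a margin of a tenth, more
      than errors of y/100 can use up. Otherwise L <= 10/9 l gives sqrt x <= y^(5/9), so
      \<open>E\<close> is smaller than y by a power and can be compared with y / l.\<close>
    have "(y + E) / L < real (prime_pi y)"
    proof (cases "l \<le> 9/10 * L")
      case True
      have th: "y - F y \<le> real (prime_pi y) * l"
        using theta_low[OF yN(1)] chebyshev_theta_le_prime_pi[OF y0] unfolding l_def by linarith
      have "(y + E) * (9/10) = 9/10 * y + 9/10 * E" by (simp add: distrib_right)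
      hence "(y + E) * (9/10) < y - F y" using E_small F_small y0 by linarith
      also have "\<dots> \<le> real (prime_pi y) * (9/10 * L)"
        using th mult_left_mono[OF True, of "real (prime_pi y)"] by simp
      finally have "y + E < real (prime_pi y) * L" by simp
      thus ?thesis using L1 by (simp add: divide_less_eq)
    next
      case False
      hence Ll: "L \<le> 10/9 * l" by simp
      have th: "chebyshev_theta y + ln 2 * (chebyshev_theta (y / 2) / l) \<le> real (prime_pi y) * l"
        unfolding l_def by (rule prime_pi_lower_improved[OF y2])
      have "F (y / 2) \<le> (y / 2) / 100"
        using N(1)[OF yN(2)] D y0 unfolding F_def by (simp add: field_simps)
      hence th2: "y / 4 \<le> chebyshev_theta (y / 2)" using theta_low[OF yN(2)] y0 by linarith
      have "2/3 * ((y / 4) / l) \<le> ln 2 * (chebyshev_theta (y / 2) / l)"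
        using th2 l1' y0 ln2_ge_two_thirds by (intro mult_mono divide_right_mono) auto
      hence gain: "y / (6 * l) \<le> ln 2 * (chebyshev_theta (y / 2) / l)" by simp
      have F2: "F y \<le> y / (100 * l)"
        using N(3)[OF yN(1)] D y0 l1' unfolding F_def l_def[symmetric] by (simp add: field_simps)
      have "E \<le> 32 * C * (y powr (5/9) * l powr (5/2))"
      proof -
        have "sqrt x = exp (L * (1/2))" using x2 by (simp add: powr_half_sqrt[symmetric] powr_def L_def mult.commute)
        also have "\<dots> \<le> exp (5/9 * l)" using Ll by simp
        also have "\<dots> = y powr (5/9)" using y0 by (simp add: powr_def l_def)
        finally have a: "sqrt x \<le> y powr (5/9)" .
        have "L powr (5/2) \<le> (10/9 * l) powr (5/2)" using Ll L1 by (intro powr_mono2) auto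
        also have "\<dots> = (10/9) powr (5/2) * l powr (5/2)" using l1' by (subst powr_mult) auto
        also have "(10/9) powr (5/2) \<le> (10/9 :: real) powr 3" by (intro powr_mono) auto
        also have "(10/9 :: real) powr 3 \<le> 2" by (simp add: powr_numeral power3_eq_cube)
        finally have b: "L powr (5/2) \<le> 2 * l powr (5/2)" by (simp add: mult_right_mono)
        have "sqrt x * L powr (5/2) \<le> y powr (5/9) * (2 * l powr (5/2))"
          using a b x2 by (intro mult_mono) auto
        hence "16 * C * (sqrt x * L powr (5/2)) \<le> 16 * C * (y powr (5/9) * (2 * l powr (5/2)))"
          using C by (intro mult_left_mono) auto
        thus ?thesis unfolding E_def by (simp add: mult_ac)
      qed
      also have "\<dots> \<le> y / (100 * l)"
        using N(2)[OF yN(1)] C y0 l1' unfolding l_def[symmetric] by (simp add: field_simps)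
      finally have E2: "E \<le> y / (100 * l)" .
      \<comment> \<open>The gain 1/6 is 2/3 * 1/4, from ln 2 >= 2/3 and \<theta>(y/2) >= y/4. It
        exceeds the two losses of 1/100.\<close>
      have sm: "y / (100 * l) + y / (100 * l) < y / (6 * l)" using y0 l1' by (simp add: field_simps)
      have "y + E < chebyshev_theta y + ln 2 * (chebyshev_theta (y / 2) / l)"
        using theta_low[OF yN(1)] gain F2 E2 sm by linarith
      also have "\<dots> \<le> real (prime_pi y) * l" by (rule th)
      also have "\<dots> \<le> real (prime_pi y) * L" using lL by (intro mult_left_mono) auto
      finally show ?thesis using L1 by (simp add: divide_less_eq)
    qed
    hence "real (prime_pi (x + y)) < real (prime_pi x + prime_pi y)" using piL by simp
    thus ?thesis by (simp only: of_nat_less_iff)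
  qed
  show ?thesis using main X0 by (intro exI[of _ "max 2 X0"]) auto
qed

theorem theorem1p2:
  assumes RH: "\<And>s. riemann_zeta s = 0 \<Longrightarrow> 0 < Re s \<Longrightarrow> Re s < 1 \<Longrightarrow> Re s = 1 / 2"
  shows "\<exists>X0::real. X0 \<ge> 2 \<and>
    (\<forall>x::real. x \<ge> X0 \<longrightarrow>
      (\<forall>y::real. x powr (1 / 2) * ln x ^ 3 \<le> y \<and> y \<le> x \<longrightarrow>
        prime_pi (x + y) < prime_pi x + prime_pi y))"
proof -
  have zeros: "Re s = 1 / 2" if "0 < Re s" "zf s = 0" for s
    using zf_zero_imp_critical[OF RH] that by blast
  obtain C where "0 < C" "\<And>x. exp 5 \<le> x \<Longrightarrow> \<bar>chebyshev_psi x - x\<bar> \<le> C * (sqrt x * ln x powr (5/2))"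
    using chebyshev_psi_estimate[OF zeros] by blast
  thus ?thesis by (rule prime_pi_subadditive_of_psi_estimate)
qed

end
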